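(* Let $(R,\mathfrak m,K)$ be an $F$-finite regular ring of characteristic $p>0$ which is either local, or a standard graded polynomial ring over the field $K$ with homogeneous maximal ideal $\mathfrak m$. Let $I\subseteq R$ be a symbolic $F$-split ideal (homogeneous in the graded case), and let $\mu(I)$ be its minimal number of (homogeneous) generators. If $I^n=I^{(n)}$ for every $n\le\left\lceil\frac{\mu(I)(p-1)}{p}\right\rceil$, then $I^n=I^{(n)}$ for every integer $n\ge0$.
   Context: For $n\ge0$, $I^{(n)}=I^nR_S\cap R$, where $S$ is the complement of the union of the minimal primes of $I$. A ring of characteristic $p$ is $F$-finite if it is a finitely generated module over itself via Frobenius. The ideal $I$ is called symbolic $F$-split if there is an $R$-linear map $\phi:R^{1/p}\to R$ with $\phi|_R=\mathrm{id}_R$ (a splitting of the inclusion $R\subseteq R^{1/p}$) such that $\phi\big((I^{(np+1)})^{1/p}\big)\subseteq I^{(n+1)}$ for every $n\ge0$, where $R^{1/p}$ is the ring of $p$-th roots of elements of $R$ and $J^{1/p}=\{f^{1/p}\mid f\in J\}$. In the graded case all objects considered are homogeneous. *)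

theory Defs
  imports "HOL-Algebra.Algebra" "HOL-Library.Extended_Nat"
begin

section \<open>Localization\<close>

text \<open>
  The localization of a commutative ring at a multiplicative subset \<open>S\<close> (containing \<open>1\<close>),
  as a ring of equivalence classes of pairs. The set \<open>S\<close> may contain \<open>0\<close>, in which case
  the localization is the zero ring.
\<close>

definition loc_rel :: "('a, 'b) ring_scheme \<Rightarrow> 'a set \<Rightarrow> (('a \<times> 'a) \<times> ('a \<times> 'a)) set" where
  "loc_rel R S = {((a, s), (b, t)). a \<in> carrier R \<and> s \<in> S \<and> b \<in> carrier R \<and> t \<in> S \<and>
     (\<exists>u\<in>S. u \<otimes>\<^bsub>R\<^esub> (t \<otimes>\<^bsub>R\<^esub> a \<ominus>\<^bsub>R\<^esub> s \<otimes>\<^bsub>R\<^esub> b) = \<zero>\<^bsub>R\<^esub>)}"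

definition loc_frac :: "('a, 'b) ring_scheme \<Rightarrow> 'a set \<Rightarrow> 'a \<Rightarrow> 'a \<Rightarrow> ('a \<times> 'a) set" where
  "loc_frac R S a s = loc_rel R S `` {(a, s)}"

definition localization :: "('a, 'b) ring_scheme \<Rightarrow> 'a set \<Rightarrow> ('a \<times> 'a) set ring" where
  "localization R S =
    \<lparr> carrier = (carrier R \<times> S) // loc_rel R S,
      monoid.mult = (\<lambda>A B. \<Union>(a, s)\<in>A. \<Union>(b, t)\<in>B. loc_frac R S (a \<otimes>\<^bsub>R\<^esub> b) (s \<otimes>\<^bsub>R\<^esub> t)),
      one = loc_frac R S \<one>\<^bsub>R\<^esub> \<one>\<^bsub>R\<^esub>,
      ring.zero = loc_frac R S \<zero>\<^bsub>R\<^esub> \<one>\<^bsub>R\<^esub>,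
      ring.add = (\<lambda>A B. \<Union>(a, s)\<in>A. \<Union>(b, t)\<in>B.
               loc_frac R S (a \<otimes>\<^bsub>R\<^esub> t \<oplus>\<^bsub>R\<^esub> b \<otimes>\<^bsub>R\<^esub> s) (s \<otimes>\<^bsub>R\<^esub> t)) \<rparr>"


section \<open>Powers and symbolic powers of ideals\<close>

abbreviation ideal_pow :: "('a, 'b) ring_scheme \<Rightarrow> 'a set \<Rightarrow> nat \<Rightarrow> 'a set" where
  "ideal_pow R I n \<equiv> I [^]\<^bsub>ideals_set R\<^esub> n"

definition minimal_primes :: "('a, 'b) ring_scheme \<Rightarrow> 'a set \<Rightarrow> 'a set set" where
  "minimal_primes R I = {P. primeideal P R \<and> I \<subseteq> P \<and>
     (\<forall>Q. primeideal Q R \<longrightarrow> I \<subseteq> Q \<longrightarrow> Q \<subseteq> P \<longrightarrow> Q = P)}"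

text \<open>
  \<open>J R\<^sub>S \<inter> R\<close>, read as the preimage of the extended ideal under \<open>R \<rightarrow> R\<^sub>S\<close>, \<open>r \<mapsto> r/1\<close>.
\<close>

definition loc_contraction :: "('a, 'b) ring_scheme \<Rightarrow> 'a set \<Rightarrow> 'a set \<Rightarrow> 'a set" where
  "loc_contraction R S J = {r \<in> carrier R.
     loc_frac R S r \<one>\<^bsub>R\<^esub> \<in> Idl\<^bsub>localization R S\<^esub> ((\<lambda>a. loc_frac R S a \<one>\<^bsub>R\<^esub>) ` J)}"

definition symbolic_power :: "('a, 'b) ring_scheme \<Rightarrow> 'a set \<Rightarrow> nat \<Rightarrow> 'a set" where
  "symbolic_power R I n =
     loc_contraction R (carrier R - \<Union>(minimal_primes R I)) (ideal_pow R I n)"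


section \<open>Regular rings\<close>

text \<open>
  The minimal number of generators of the ideal \<open>I\<close> among generating sets contained in \<open>H\<close>.
  The value is meaningful only if \<open>I\<close> has a finite generating set contained in \<open>H\<close>.
\<close>

definition min_num_gens :: "('a, 'b) ring_scheme \<Rightarrow> 'a set \<Rightarrow> 'a set \<Rightarrow> nat" where
  "min_num_gens R H I = (LEAST n. \<exists>A. A \<subseteq> H \<and> finite A \<and> card A = n \<and> I = Idl\<^bsub>R\<^esub> A)"

definition krull_dim :: "('a, 'b) ring_scheme \<Rightarrow> enat" where
  "krull_dim R = Sup {enat n |n. \<exists>P :: nat \<Rightarrow> 'a set.
     (\<forall>i\<le>n. primeideal (P i) R) \<and> (\<forall>i<n. P i \<subset> P (Suc i))}"

definition local_ring :: "('a, 'b) ring_scheme \<Rightarrow> 'a set \<Rightarrow> bool" where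
  "local_ring R \<mm> \<longleftrightarrow> cring R \<and> maximalideal \<mm> R \<and> (\<forall>\<nn>. maximalideal \<nn> R \<longrightarrow> \<nn> = \<mm>)"

definition regular_local_ring :: "('a, 'b) ring_scheme \<Rightarrow> 'a set \<Rightarrow> bool" where
  "regular_local_ring R \<mm> \<longleftrightarrow> local_ring R \<mm> \<and> noetherian_ring R \<and>
     enat (min_num_gens R (carrier R) \<mm>) = krull_dim R"

definition regular_ring :: "('a, 'b) ring_scheme \<Rightarrow> bool" where
  "regular_ring R \<longleftrightarrow> cring R \<and> noetherian_ring R \<and>
     (\<forall>P. primeideal P R \<longrightarrow> (\<exists>\<mm>. regular_local_ring (localization R (carrier R - P)) \<mm>))"


section \<open>Positive characteristic\<close>

definition has_characteristic :: "('a, 'b) ring_scheme \<Rightarrow> nat \<Rightarrow> bool" where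
  "has_characteristic R p \<longleftrightarrow> (\<forall>n::nat. add_pow R n \<one>\<^bsub>R\<^esub> = \<zero>\<^bsub>R\<^esub> \<longleftrightarrow> p dvd n)"

definition F_finite :: "('a, 'b) ring_scheme \<Rightarrow> nat \<Rightarrow> bool" where
  "F_finite R p \<longleftrightarrow> (\<exists>B. B \<subseteq> carrier R \<and> finite B \<and>
     (\<forall>r\<in>carrier R. \<exists>c\<in>B \<rightarrow> carrier R. r = (\<Oplus>\<^bsub>R\<^esub>b\<in>B. (c b [^]\<^bsub>R\<^esub> p) \<otimes>\<^bsub>R\<^esub> b)))"

text \<open>
  \<open>R\<^sup>1\<^sup>/\<^sup>p\<close> for a reduced ring \<open>R\<close> of prime characteristic \<open>p\<close>: the element \<open>PRoot f\<close> is the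
  \<open>p\<close>-th root of \<open>f\<close>. As taking \<open>p\<close>-th roots is a ring isomorphism from \<open>R\<close> onto
  \<open>R\<^sup>1\<^sup>/\<^sup>p\<close>, sums and products are formed on radicands. The inclusion of \<open>R\<close> sends \<open>r\<close> to the
  \<open>p\<close>-th root of \<open>r\<^sup>p\<close>, and \<open>R\<close> acts on \<open>R\<^sup>1\<^sup>/\<^sup>p\<close> through this inclusion.
\<close>

datatype 'a proot = PRoot (radicand: 'a)

definition pth_root_incl :: "('a, 'b) ring_scheme \<Rightarrow> nat \<Rightarrow> 'a \<Rightarrow> 'a proot" where
  "pth_root_incl R p r = PRoot (r [^]\<^bsub>R\<^esub> p)"

definition pth_root_ring :: "('a, 'b) ring_scheme \<Rightarrow> nat \<Rightarrow> ('a, 'a proot) module" where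
  "pth_root_ring R p =
    \<lparr> carrier = PRoot ` carrier R,
      monoid.mult = (\<lambda>x y. PRoot (radicand x \<otimes>\<^bsub>R\<^esub> radicand y)),
      one = PRoot \<one>\<^bsub>R\<^esub>,
      ring.zero = PRoot \<zero>\<^bsub>R\<^esub>,
      ring.add = (\<lambda>x y. PRoot (radicand x \<oplus>\<^bsub>R\<^esub> radicand y)),
      module.smult = (\<lambda>r x. PRoot (radicand (pth_root_incl R p r) \<otimes>\<^bsub>R\<^esub> radicand x)) \<rparr>"

definition R_linear_to_ring ::
    "('a, 'b) ring_scheme \<Rightarrow> ('a, 'm, 'c) module_scheme \<Rightarrow> ('m \<Rightarrow> 'a) \<Rightarrow> bool" where
  "R_linear_to_ring R M \<phi> \<longleftrightarrow>
     \<phi> \<in> carrier M \<rightarrow> carrier R \<and>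
     (\<forall>x\<in>carrier M. \<forall>y\<in>carrier M. \<phi> (x \<oplus>\<^bsub>M\<^esub> y) = \<phi> x \<oplus>\<^bsub>R\<^esub> \<phi> y) \<and>
     (\<forall>r\<in>carrier R. \<forall>x\<in>carrier M. \<phi> (r \<odot>\<^bsub>M\<^esub> x) = r \<otimes>\<^bsub>R\<^esub> \<phi> x)"

definition symbolic_F_split :: "('a, 'b) ring_scheme \<Rightarrow> nat \<Rightarrow> 'a set \<Rightarrow> bool" where
  "symbolic_F_split R p I \<longleftrightarrow> (\<exists>\<phi>.
     R_linear_to_ring R (pth_root_ring R p) \<phi> \<and>
     (\<forall>r\<in>carrier R. \<phi> (pth_root_incl R p r) = r) \<and>
     (\<forall>n. \<phi> ` (PRoot ` symbolic_power R I (n * p + 1)) \<subseteq> symbolic_power R I (n + 1)))"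


section \<open>Standard graded polynomial rings\<close>

text \<open>
  \<open>R = K[x\<^sub>0, \<dots>, x\<^sub>d\<^sub>-\<^sub>1]\<close> internally: \<open>K\<close> is a subfield of \<open>R\<close>, and every element of \<open>R\<close> is, in a
  unique way, a finite \<open>K\<close>-linear combination of monomials in the \<open>x\<^sub>i\<close>. A polynomial is
  represented by its coefficient function on exponent vectors, which are functions
  \<open>nat \<Rightarrow> nat\<close> vanishing from \<open>d\<close> on.
\<close>

definition exponents :: "nat \<Rightarrow> (nat \<Rightarrow> nat) set" where
  "exponents d = {\<alpha>. \<forall>i\<ge>d. \<alpha> i = 0}"

definition coeff_funs ::
    "('a, 'b) ring_scheme \<Rightarrow> 'a set \<Rightarrow> nat \<Rightarrow> ((nat \<Rightarrow> nat) \<Rightarrow> 'a) set" where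
  "coeff_funs R K d = {c. (\<forall>\<alpha>. c \<alpha> \<in> K) \<and> finite {\<alpha>. c \<alpha> \<noteq> \<zero>\<^bsub>R\<^esub>} \<and>
     {\<alpha>. c \<alpha> \<noteq> \<zero>\<^bsub>R\<^esub>} \<subseteq> exponents d}"

definition coeff_eval ::
    "('a, 'b) ring_scheme \<Rightarrow> nat \<Rightarrow> (nat \<Rightarrow> 'a) \<Rightarrow> ((nat \<Rightarrow> nat) \<Rightarrow> 'a) \<Rightarrow> 'a" where
  "coeff_eval R d x c =
     (\<Oplus>\<^bsub>R\<^esub>\<alpha>\<in>{\<alpha>. c \<alpha> \<noteq> \<zero>\<^bsub>R\<^esub>}. c \<alpha> \<otimes>\<^bsub>R\<^esub> (\<Otimes>\<^bsub>R\<^esub>i\<in>{..<d}. x i [^]\<^bsub>R\<^esub> \<alpha> i))"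

definition std_graded_polynomial_ring ::
    "('a, 'b) ring_scheme \<Rightarrow> 'a set \<Rightarrow> nat \<Rightarrow> (nat \<Rightarrow> 'a) \<Rightarrow> bool" where
  "std_graded_polynomial_ring R K d x \<longleftrightarrow> cring R \<and> subfield K R \<and>
     (\<forall>i<d. x i \<in> carrier R) \<and>
     bij_betw (coeff_eval R d x) (coeff_funs R K d) (carrier R)"

definition graded_piece ::
    "('a, 'b) ring_scheme \<Rightarrow> 'a set \<Rightarrow> nat \<Rightarrow> (nat \<Rightarrow> 'a) \<Rightarrow> nat \<Rightarrow> 'a set" where
  "graded_piece R K d x j = coeff_eval R d x `
     {c \<in> coeff_funs R K d. \<forall>\<alpha>. c \<alpha> \<noteq> \<zero>\<^bsub>R\<^esub> \<longrightarrow> (\<Sum>i<d. \<alpha> i) = j}"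

definition homogeneous_elements ::
    "('a, 'b) ring_scheme \<Rightarrow> 'a set \<Rightarrow> nat \<Rightarrow> (nat \<Rightarrow> 'a) \<Rightarrow> 'a set" where
  "homogeneous_elements R K d x = (\<Union>j. graded_piece R K d x j)"

definition homogeneous_ideal ::
    "('a, 'b) ring_scheme \<Rightarrow> 'a set \<Rightarrow> nat \<Rightarrow> (nat \<Rightarrow> 'a) \<Rightarrow> 'a set \<Rightarrow> bool" where
  "homogeneous_ideal R K d x I \<longleftrightarrow>
     ideal I R \<and> (\<exists>A \<subseteq> homogeneous_elements R K d x. I = Idl\<^bsub>R\<^esub> A)"

definition homogeneous_maximal_ideal ::
    "('a, 'b) ring_scheme \<Rightarrow> nat \<Rightarrow> (nat \<Rightarrow> 'a) \<Rightarrow> 'a set" where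
  "homogeneous_maximal_ideal R d x = Idl\<^bsub>R\<^esub> (x ` {..<d})"

end

theory Submission
  imports Defs
begin

text \<open>
  A splitting \<open>\<phi>\<close> as in the definition of symbolic \<open>F\<close>-splitness also satisfies
  \<open>\<phi>((I\<^sup>n\<^sup>p\<^sup>+\<^sup>1)\<^sup>1\<^sup>/\<^sup>p) \<subseteq> I\<^sup>n\<^sup>+\<^sup>1\<close> for the ordinary powers. In the range where \<open>I\<^sup>n = I\<^sup>(\<^sup>n\<^sup>)\<close> is assumed this is
  the hypothesis, and beyond it the pigeonhole principle writes \<open>I\<^sup>n\<^sup>p\<^sup>+\<^sup>1\<close> as the Frobenius power of \<open>I\<close>
  times \<open>I\<^sup>(\<^sup>n\<^sup>-\<^sup>1\<^sup>)\<^sup>p\<^sup>+\<^sup>1\<close>. Hence the associated graded ring of \<open>I\<close> is reduced.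

  If some \<open>I\<^sup>n\<close> were smaller than \<open>I\<^sup>(\<^sup>n\<^sup>)\<close>, that graded ring would have a nonzero homogeneous
  element \<open>g\<close> of degree \<open>k\<close> whose annihilator in \<open>R\<close> is a prime \<open>Q\<close>, not minimal over \<open>I\<close>.
  Localize at \<open>Q\<close>: in the regular local ring \<open>(R\<^sub>Q, \<mm>)\<close> the ideal \<open>I\<close> differs from \<open>\<mm>\<close>, so by
  Nakayama its linear forms miss one of the variables, say \<open>y\<close>. As \<open>y g \<in> I\<^sup>k\<^sup>+\<^sup>1\<close>, comparing leading forms in
  the polynomial ring \<open>gr\<^sub>\<mm>(R\<^sub>Q)\<close> shows \<open>g \<in> \<mm>\<^sup>k\<^sup>+\<^sup>1\<close>, and then \<open>\<mm> g \<subseteq> I\<^sup>k\<^sup>+\<^sup>1\<close> makes \<open>g\<close> nilpotent in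
  the reduced ring, a contradiction.
\<close>

section \<open>Ideals of a commutative ring\<close>

text \<open>The bound is the least \<open>N\<close> with \<open>N p \<ge> \<mu>(p-1)\<close>. Among
  \<open>np+1\<close> factors taken from \<open>\<mu>\<close> generators one occurs \<open>p\<close>
  times once \<open>np+1 > \<mu>(p-1)\<close>; this covers every \<open>n \<ge> N\<close>, while for
  \<open>n < N\<close> the target degree \<open>n+1\<close> falls under the hypothesis. Regularity
  is given numerically: the maximal ideal has as many generators as the longest chain of primes has
  steps. That the associated graded ring of \<open>\<mm>\<close> behaves like a polynomial ring has
  to be derived from this. The tool is Krull's principal ideal theorem, which shows that every
  subset of such generators generates a prime ideal. Reducedness is never transported to the local
  ring. By the maximal choice of \<open>Q\<close> all powers of \<open>g\<close> have annihilator
  \<open>Q\<close> already over \<open>R\<close>, so a local relation making \<open>g\<close>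
  nilpotent contradicts this once its denominators are cleared.\<close>

no_notation Sum_Type.Plus (infixr "<+>" 65)

text \<open>\<open>ideal_pow\<close> is an instance of \<open>[^]\<close>, which the simplifier would unfold in \<open>ideals_set R\<close>.\<close>

declare nat_pow_0 [simp del] nat_pow_Suc [simp del]

context cring
begin

lemma ideal_add_closed: "ideal J R \<Longrightarrow> a \<in> J \<Longrightarrow> b \<in> J \<Longrightarrow> a \<oplus> b \<in> J"
  by (meson additive_subgroup.a_closed ideal.axioms(1))

lemma ideal_zero_closed: "ideal J R \<Longrightarrow> \<zero> \<in> J"
  by (meson additive_subgroup.zero_closed ideal.axioms(1))

lemma ideal_uminus_closed: "ideal J R \<Longrightarrow> a \<in> J \<Longrightarrow> \<ominus> a \<in> J"
  by (metis abelian_group.a_inv_closed additive_subgroup.a_inv_closed ideal.axioms(1))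

lemma ideal_minus_closed: "ideal J R \<Longrightarrow> a \<in> J \<Longrightarrow> b \<in> J \<Longrightarrow> a \<ominus> b \<in> J"
  by (simp add: a_minus_def ideal_add_closed ideal_uminus_closed)

lemma ideal_subset: "ideal J R \<Longrightarrow> J \<subseteq> carrier R"
  by (auto dest: ideal.Icarr)

lemma ideal_diff_cancel:
  assumes "ideal J R" "a \<oplus> b \<in> J" "b \<in> J" "a \<in> carrier R"
  shows "a \<in> J"
proof -
  have "b \<in> carrier R" by (rule ideal.Icarr[OF assms(1,3)])
  then have "(a \<oplus> b) \<ominus> b = a" using assms(4) by algebra
  then show ?thesis using ideal_minus_closed[OF assms(1-3)] by simp
qed

lemma mem_set_add: "a \<in> J <+> K \<longleftrightarrow> (\<exists>j\<in>J. \<exists>k\<in>K. a = j \<oplus> k)"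
  by (auto simp: set_add_def')

lemma mem_add_principal:
  "a \<in> J <+> PIdl x \<longleftrightarrow> (\<exists>j\<in>J. \<exists>r\<in>carrier R. a = j \<oplus> r \<otimes> x)"
  by (auto simp: set_add_def' cgenideal_def)

lemma subset_add_left:
  assumes "ideal J R" "ideal K R" shows "J \<subseteq> J <+> K"
proof
  fix a assume "a \<in> J"
  then show "a \<in> J <+> K"
    using assms ideal.Icarr ideal_zero_closed mem_set_add by (metis r_zero)
qed

lemma subset_add_right:
  assumes "ideal J R" "ideal K R" shows "K \<subseteq> J <+> K"
  using subset_add_left[OF assms(2,1)] set_add_comm[of J K] assms ideal_subset by auto

lemma add_subset:
  assumes "ideal L R" "J \<subseteq> L" "K \<subseteq> L" shows "J <+> K \<subseteq> L"
  using ideal_add_closed[OF assms(1)] assms(2,3) unfolding mem_set_add subset_iff by blast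

lemma Idl_insert:
  assumes "A \<subseteq> carrier R" "x \<in> carrier R"
  shows "Idl (insert x A) = Idl A <+> PIdl x"
proof -
  have iA: "ideal (Idl A) R" and ix: "ideal (PIdl x) R"
    using assms genideal_ideal cgenideal_ideal by auto
  have "Idl (insert x A) \<subseteq> Idl A <+> PIdl x"
    using genideal_self[OF assms(1)] cgenideal_self[OF assms(2)]
      subset_add_left[OF iA ix] subset_add_right[OF iA ix]
    by (intro genideal_minimal add_ideals iA ix) auto
  moreover have "Idl A <+> PIdl x \<subseteq> Idl (insert x A)"
    using assms genideal_self[of "insert x A"]
    by (intro add_subset genideal_ideal genideal_minimal cgenideal_minimal) auto
  ultimately show ?thesis by blast
qed

lemma Idl_mono:
  assumes "B \<subseteq> carrier R" "A \<subseteq> B" shows "Idl A \<subseteq> Idl B"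
  using assms subset_Idl_subset by blast

lemma Idl_empty: "Idl {} = {\<zero>}"
proof -
  have "Idl {} \<subseteq> {\<zero>}" by (intro genideal_minimal zeroideal) auto
  then show ?thesis using ideal_zero_closed genideal_ideal[of "{}"] by auto
qed

lemma Idl_ideal: "ideal J R \<Longrightarrow> Idl J = J"
  using genideal_minimal[of J J] genideal_self[of J] ideal_subset by blast

text \<open>Reduces claims \<open>a \<otimes> g \<in> J\<close> about all \<open>a\<close> in an
  ideal to claims about generators or products, by minimality.\<close>

lemma colon_ideal:
  assumes "ideal J R" "g \<in> carrier R"
  shows "ideal {a \<in> carrier R. a \<otimes> g \<in> J} R"
proof (rule idealI[OF ring_axioms])
  show "subgroup {a \<in> carrier R. a \<otimes> g \<in> J} (add_monoid R)"
  proof (rule group.subgroupI)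
    show "Group.group (add_monoid R)" by (rule a_group)
    show "{a \<in> carrier R. a \<otimes> g \<in> J} \<noteq> {}"
      using assms ideal_zero_closed by (auto intro!: exI[of _ \<zero>])
  qed (use assms in \<open>auto simp: l_distr ideal_add_closed l_minus ideal_uminus_closed
        simp flip: a_inv_def\<close>)
next
  fix a x assume a: "a \<in> {a \<in> carrier R. a \<otimes> g \<in> J}" and x: "x \<in> carrier R"
  then show "x \<otimes> a \<in> {a \<in> carrier R. a \<otimes> g \<in> J}"
    using assms by (auto simp: m_assoc ideal.I_l_closed)
  then show "a \<otimes> x \<in> {a \<in> carrier R. a \<otimes> g \<in> J}"
    using a x m_comm by auto
qed

lemma Idl_mult_subset:
  assumes "ideal J R" "A \<subseteq> carrier R" "g \<in> carrier R" "\<And>a. a \<in> A \<Longrightarrow> a \<otimes> g \<in> J" "a \<in> Idl A"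
  shows "a \<otimes> g \<in> J"
  using genideal_minimal[OF colon_ideal[OF assms(1,3)], of A] assms by blast


section \<open>Powers of an ideal\<close>

lemma ideal_pow_0: "ideal_pow R I 0 = carrier R"
  by (simp add: ideals_set_def nat_pow_def)

lemma ideal_pow_Suc: "ideal_pow R I (Suc n) = ideal_pow R I n \<cdot> I"
  by (simp add: ideals_set_def nat_pow_def)

lemma ideal_pow_ideal: "ideal I R \<Longrightarrow> ideal (ideal_pow R I n) R"
  by (induction n) (auto simp: ideal_pow_0 ideal_pow_Suc oneideal ideal_prod_is_ideal)

lemma ideal_pow_1: "ideal I R \<Longrightarrow> ideal_pow R I (Suc 0) = I"
  using ideal_prod_one ideal_prod_commute oneideal by (simp add: ideal_pow_0 ideal_pow_Suc)

lemma ideal_prod_minimal: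
  assumes "ideal L R" "\<And>a b. a \<in> J \<Longrightarrow> b \<in> K \<Longrightarrow> a \<otimes> b \<in> L"
  shows "J \<cdot> K \<subseteq> L"
proof
  fix z assume "z \<in> J \<cdot> K"
  then show "z \<in> L" by induction (use assms ideal_add_closed in auto)
qed

lemma ideal_pow_mult:
  assumes "ideal I R" "a \<in> ideal_pow R I m" "b \<in> ideal_pow R I n"
  shows "a \<otimes> b \<in> ideal_pow R I (m + n)"
proof -
  have "ideal_pow R I (m + n) = ideal_pow R I m \<cdot> ideal_pow R I n"
  proof (induction n)
    case 0
    then show ?case using assms by (simp add: ideal_pow_0 ideal_prod_one ideal_pow_ideal)
  next
    case (Suc n)
    then show ?case using assms by (simp add: ideal_pow_Suc ideal_prod_assoc ideal_pow_ideal)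
  qed
  then show ?thesis using assms ideal_prod.prod by metis
qed

lemma ideal_pow_antimono:
  assumes "ideal I R" "m \<le> n"
  shows "ideal_pow R I n \<subseteq> ideal_pow R I m"
  using assms(2)
proof (induction n rule: dec_induct)
  case (step n)
  then show ?case using ideal_prod_inter[OF ideal_pow_ideal[OF assms(1)] assms(1), of n]
    by (auto simp: ideal_pow_Suc)
qed simp

lemma ideal_pow_mono:
  assumes "ideal I R" "ideal J R" "I \<subseteq> J"
  shows "ideal_pow R I n \<subseteq> ideal_pow R J n"
proof (induction n)
  case (Suc n)
  then show ?case using assms unfolding ideal_pow_Suc
    by (intro ideal_prod_minimal ideal_prod_is_ideal ideal_pow_ideal) (auto intro: ideal_prod.prod)
qed (simp add: ideal_pow_0)

lemma nat_pow_mem_ideal_pow: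
  assumes "ideal I R" "a \<in> ideal_pow R I k"
  shows "a [^] j \<in> ideal_pow R I (k * j)"
proof (induction j)
  case (Suc j)
  then show ?case using ideal_pow_mult[OF assms(1) Suc assms(2)] by (simp add: add.commute nat_pow_Suc)
qed (simp add: ideal_pow_0 nat_pow_0)

text \<open>Division by a single generator: of a product of \<open>n + 1\<close> sums only the part
  in the power of \<open>J\<close> avoids \<open>x\<close>, and everything else loses one factor to
  it.\<close>

lemma ideal_pow_add_principal:
  assumes "ideal J R" "x \<in> carrier R" "z \<in> ideal_pow R (J <+> PIdl x) (Suc n)"
  obtains z0 z1 where "z0 \<in> ideal_pow R J (Suc n)" "z1 \<in> ideal_pow R (J <+> PIdl x) n"
    "z = z0 \<oplus> x \<otimes> z1"
proof -
  let ?K = "J <+> PIdl x"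
  have K: "ideal ?K R" using assms add_ideals cgenideal_ideal by auto
  have JK: "J \<subseteq> ?K" using assms subset_add_left cgenideal_ideal by auto
  have xK: "x \<in> ?K"
    using subset_add_right[OF assms(1) cgenideal_ideal[OF assms(2)]] cgenideal_self[OF assms(2)] by auto
  have "\<exists>z0 \<in> ideal_pow R J (Suc n). \<exists>z1 \<in> ideal_pow R ?K n. z = z0 \<oplus> x \<otimes> z1"
    if "z \<in> ideal_pow R ?K (Suc n)" for z n
    using that
  proof (induction n arbitrary: z)
    case 0
    then obtain j r where "j \<in> J" "r \<in> carrier R" "z = j \<oplus> r \<otimes> x"
      using K by (auto simp: ideal_pow_1 mem_add_principal)
    then show ?case using assms by (auto simp: ideal_pow_1 ideal_pow_0 m_comm)
  next
    case (Suc n)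
    from Suc.prems have "z \<in> ideal_pow R ?K (Suc n) \<cdot> ?K" by (simp only: ideal_pow_Suc)
    then show ?case
    proof induction
      case (prod a b)
      from Suc.IH[OF prod(1)] obtain a0 a1 where a: "a0 \<in> ideal_pow R J (Suc n)"
        "a1 \<in> ideal_pow R ?K n" "a = a0 \<oplus> x \<otimes> a1" by blast
      from prod(2) obtain j r where b: "j \<in> J" "r \<in> carrier R" "b = j \<oplus> r \<otimes> x"
        by (auto simp: mem_add_principal)
      have c: "a0 \<in> carrier R" "a1 \<in> carrier R" "j \<in> carrier R" "b \<in> carrier R"
        by (rule ideal.Icarr[OF ideal_pow_ideal[OF assms(1)] a(1)]
            ideal.Icarr[OF ideal_pow_ideal[OF K] a(2)] ideal.Icarr[OF assms(1) b(1)]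
            ideal.Icarr[OF K prod(2)])+
      \<comment> \<open>Only \<open>a0 \<otimes> j\<close> is free of \<open>x\<close>. Keeping
        \<open>b\<close> whole in \<open>a1 \<otimes> b\<close> leaves the cofactor of
        \<open>x\<close> in the power \<open>Suc n\<close> of \<open>?K\<close>, so just one degree
        is lost.\<close>
      have "a \<otimes> b = a0 \<otimes> j \<oplus> x \<otimes> (a0 \<otimes> r \<oplus> a1 \<otimes> b)"
        unfolding a(3) b(3) using c b(2) assms(2) by algebra
      moreover have "a0 \<otimes> j \<in> ideal_pow R J (Suc (Suc n))"
        unfolding ideal_pow_Suc[of _ "Suc n"] by (rule ideal_prod.prod[OF a(1) b(1)])
      moreover have "a0 \<in> ideal_pow R ?K (Suc n)"
        using a ideal_pow_mono[OF assms(1) K JK] by blast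
      then have "a0 \<otimes> r \<in> ideal_pow R ?K (Suc n)"
        using b K by (simp add: ideal.I_r_closed ideal_pow_ideal)
      moreover have "a1 \<otimes> b \<in> ideal_pow R ?K (Suc n)"
        unfolding ideal_pow_Suc[of _ n] by (rule ideal_prod.prod[OF a(2) prod(2)])
      ultimately show ?case using ideal_add_closed[OF ideal_pow_ideal[OF K]] by blast
    next
      case (sum s1 s2)
      then obtain a0 a1 b0 b1 where *: "a0 \<in> ideal_pow R J (Suc (Suc n))" "b0 \<in> ideal_pow R J (Suc (Suc n))"
        "a1 \<in> ideal_pow R ?K (Suc n)" "b1 \<in> ideal_pow R ?K (Suc n)"
        "s1 = a0 \<oplus> x \<otimes> a1" "s2 = b0 \<oplus> x \<otimes> b1" by blast
      then have "a0 \<in> carrier R" "b0 \<in> carrier R" "a1 \<in> carrier R" "b1 \<in> carrier R"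
        using ideal.Icarr[OF ideal_pow_ideal[OF assms(1)]] ideal.Icarr[OF ideal_pow_ideal[OF K]]
        by blast+
      then have "s1 \<oplus> s2 = (a0 \<oplus> b0) \<oplus> x \<otimes> (a1 \<oplus> b1)"
        unfolding *(5,6) using assms(2) by algebra
      moreover have "a0 \<oplus> b0 \<in> ideal_pow R J (Suc (Suc n))" "a1 \<oplus> b1 \<in> ideal_pow R ?K (Suc n)"
        using ideal_add_closed[OF ideal_pow_ideal[OF K]] ideal_add_closed[OF ideal_pow_ideal[OF assms(1)]] * by blast+
      ultimately show ?case by blast
    qed
  qed
  then show ?thesis using assms that by blast
qed

end

section \<open>Contraction from the local ring at a prime\<close>

text \<open>\<open>J R\<^sub>P \<inter> R\<close>, which allows arguments over \<open>R\<^sub>P\<close> to be carried out inside \<open>R\<close>.\<close>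

definition sat :: "('a, 'b) ring_scheme \<Rightarrow> 'a set \<Rightarrow> 'a set \<Rightarrow> 'a set" where
  "sat R P J = {a \<in> carrier R. \<exists>s \<in> carrier R - P. s \<otimes>\<^bsub>R\<^esub> a \<in> J}"

locale noetherian_cring = noetherian_ring R + cring R for R (structure)

context cring
begin

lemma ideal_carr: "ideal J R \<Longrightarrow> a \<in> J \<Longrightarrow> a \<in> carrier R"
  by (rule ideal.Icarr)

lemma ideal_lmult: "ideal J R \<Longrightarrow> r \<in> carrier R \<Longrightarrow> a \<in> J \<Longrightarrow> r \<otimes> a \<in> J"
  by (rule ideal.I_l_closed)

lemma ideal_rmult: "ideal J R \<Longrightarrow> r \<in> carrier R \<Longrightarrow> a \<in> J \<Longrightarrow> a \<otimes> r \<in> J"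
  by (rule ideal.I_r_closed)

lemma prime_ideal: "primeideal P R \<Longrightarrow> ideal P R"
  by (rule primeideal.axioms(1))

lemma one_notin_prime:
  assumes "primeideal P R" shows "\<one> \<notin> P"
  using primeideal.I_notcarr[OF assms] ideal.one_imp_carrier[OF prime_ideal[OF assms]] by auto

lemma prime_compl_mult:
  assumes "primeideal P R" "s \<in> carrier R - P" "t \<in> carrier R - P"
  shows "s \<otimes> t \<in> carrier R - P"
  using primeideal.I_prime[OF assms(1), of s t] assms(2,3) by auto

lemma prime_pow_mem:
  assumes "primeideal P R" "a \<in> carrier R" "a [^] (n::nat) \<in> P"
  shows "a \<in> P"
  using assms(3)
proof (induction n)
  case 0
  then show ?case using one_notin_prime[OF assms(1)] by (simp add: nat_pow_0)
next
  case (Suc n)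
  then show ?case using primeideal.I_prime[OF assms(1), of "a [^] n" a] assms(2)
    by (auto simp: nat_pow_Suc)
qed

lemma satI: "a \<in> carrier R \<Longrightarrow> s \<in> carrier R - P \<Longrightarrow> s \<otimes> a \<in> J \<Longrightarrow> a \<in> sat R P J"
  by (auto simp: sat_def)

lemma sat_ideal:
  assumes P: "primeideal P R" and J: "ideal J R"
  shows "ideal (sat R P J) R"
proof (rule idealI[OF ring_axioms])
  show "subgroup (sat R P J) (add_monoid R)"
  proof (rule group.subgroupI)
    show "Group.group (add_monoid R)" by (rule a_group)
    show "sat R P J \<subseteq> carrier (add_monoid R)" by (auto simp: sat_def)
    show "sat R P J \<noteq> {}"
      using satI[of \<zero> \<one> P J] one_notin_prime[OF P] ideal_zero_closed[OF J] by auto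
  next
    fix a assume "a \<in> sat R P J"
    then obtain s where "a \<in> carrier R" "s \<in> carrier R - P" "s \<otimes> a \<in> J" by (auto simp: sat_def)
    then show "inv\<^bsub>add_monoid R\<^esub> a \<in> sat R P J"
      using ideal_uminus_closed[OF J] satI[of "\<ominus> a" s P J] by (auto simp: r_minus simp flip: a_inv_def)
  next
    fix a b assume "a \<in> sat R P J" "b \<in> sat R P J"
    then obtain s t where a: "a \<in> carrier R" "s \<in> carrier R - P" "s \<otimes> a \<in> J"
      and b: "b \<in> carrier R" "t \<in> carrier R - P" "t \<otimes> b \<in> J" by (auto simp: sat_def)
    then have "(s \<otimes> t) \<otimes> (a \<oplus> b) = t \<otimes> (s \<otimes> a) \<oplus> s \<otimes> (t \<otimes> b)"
      by (simp add: r_distr m_ac)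
    also have "\<dots> \<in> J" using a b by (intro ideal_add_closed[OF J] ideal_lmult[OF J _ a(3)] ideal_lmult[OF J _ b(3)]) auto
    finally show "a \<otimes>\<^bsub>add_monoid R\<^esub> b \<in> sat R P J"
      using satI[OF _ prime_compl_mult[OF P a(2) b(2)], of "a \<oplus> b"] a b by auto
  qed
next
  fix a x assume "a \<in> sat R P J" and x: "x \<in> carrier R"
  then obtain s where a: "a \<in> carrier R" "s \<in> carrier R - P" "s \<otimes> a \<in> J" by (auto simp: sat_def)
  then have "s \<otimes> (x \<otimes> a) = x \<otimes> (s \<otimes> a)" using x by (simp add: m_ac)
  then show "x \<otimes> a \<in> sat R P J"
    using satI[of "x \<otimes> a" s P J] a x ideal_lmult[OF J x a(3)] by simp
  then show "a \<otimes> x \<in> sat R P J" using x a m_comm by simp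
qed

lemma subset_sat:
  assumes P: "primeideal P R" and J: "ideal J R" shows "J \<subseteq> sat R P J"
proof
  fix a assume a: "a \<in> J"
  then show "a \<in> sat R P J"
    using satI[of a \<one> P J] one_notin_prime[OF P] ideal_carr[OF J a] by simp
qed

lemma sat_mono: "J \<subseteq> K \<Longrightarrow> sat R P J \<subseteq> sat R P K"
  by (auto simp: sat_def)

lemma sat_cancel:
  assumes "primeideal P R" "a \<in> carrier R" "s \<in> carrier R - P" "s \<otimes> a \<in> sat R P J"
  shows "a \<in> sat R P J"
proof -
  obtain t where t: "t \<in> carrier R - P" "t \<otimes> (s \<otimes> a) \<in> J" using assms(4) by (auto simp: sat_def)
  then have "(t \<otimes> s) \<otimes> a \<in> J" using assms by (simp add: m_assoc)
  then show ?thesis using satI[OF assms(2) prime_compl_mult[OF assms(1) t(1) assms(3)]] by blast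
qed

lemma sat_sat: "primeideal P R \<Longrightarrow> sat R P (sat R P J) = sat R P J"
proof
  assume P: "primeideal P R"
  show "sat R P (sat R P J) \<subseteq> sat R P J"
    using sat_cancel[OF P] by (auto simp: sat_def[of R P "sat R P J"])
  show "sat R P J \<subseteq> sat R P (sat R P J)"
    using satI[of _ \<one> P "sat R P J"] one_notin_prime[OF P] by (auto simp: sat_def[of R P J])
qed

lemma sat_prime:
  assumes P: "primeideal P R" and Q: "primeideal Q R" "Q \<subseteq> P" shows "sat R P Q = Q"
proof
  show "sat R P Q \<subseteq> Q"
    using primeideal.I_prime[OF Q(1)] Q(2) by (auto simp: sat_def)
qed (rule subset_sat[OF P prime_ideal[OF Q(1)]])

text \<open>The product of the denominators of finitely many generators serves the whole ideal, so
  local relations become relations in \<open>R\<close> simultaneously.\<close>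

lemma sat_common_denominator:
  assumes P: "primeideal P R" and J: "ideal J R" and "finite A" "A \<subseteq> sat R P J"
  obtains s where "s \<in> carrier R - P" "\<And>a. a \<in> Idl A \<Longrightarrow> s \<otimes> a \<in> J"
proof -
  have A: "A \<subseteq> carrier R" using assms(4) by (auto simp: sat_def)
  have "\<exists>s \<in> carrier R - P. \<forall>a\<in>A. s \<otimes> a \<in> J"
    using assms(3,4)
  proof (induction A)
    case empty
    then show ?case using one_notin_prime[OF P] by auto
  next
    case (insert a A)
    then obtain s where s: "s \<in> carrier R - P" "\<forall>a\<in>A. s \<otimes> a \<in> J" by auto
    obtain t where t: "a \<in> carrier R" "t \<in> carrier R - P" "t \<otimes> a \<in> J"
      using insert.prems by (auto simp: sat_def)
    have "(s \<otimes> t) \<otimes> b \<in> J" if "b \<in> insert a A" for b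
    proof (cases "b = a")
      case True
      then show ?thesis using s t ideal_lmult[OF J, of s "t \<otimes> a"] by (simp add: m_assoc)
    next
      case False
      then have b: "b \<in> A" using that by simp
      then have "b \<in> carrier R" using insert.prems by (auto simp: sat_def)
      then have "(s \<otimes> t) \<otimes> b = t \<otimes> (s \<otimes> b)" using s t by (simp add: m_ac)
      then show ?thesis using s(2) t b ideal_lmult[OF J, of t "s \<otimes> b"] by simp
    qed
    then show ?case using prime_compl_mult[OF P s(1) t(2)] by blast
  qed
  then obtain s where s: "s \<in> carrier R - P" "\<forall>a\<in>A. s \<otimes> a \<in> J" by blast
  have "s \<otimes> a \<in> J" if "a \<in> Idl A" for a
  proof -
    have "a \<otimes> s \<in> J"
      using Idl_mult_subset[OF J A _ _ that] s A m_comm by (metis DiffD1 subsetD)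
    then show ?thesis using m_comm s that ideal_carr[OF genideal_ideal[OF A]] by auto
  qed
  then show ?thesis using that s by blast
qed

end

section \<open>Noetherian induction, existence of primes, Nakayama's lemma\<close>

context noetherian_cring
begin

text \<open>In a Noetherian ring a nonempty chain of ideals contains its union, so Zorn's lemma
  applies to every nonempty family. This is the form of Noetherian induction used
  throughout.\<close>

lemma ideal_family_maximal:
  assumes "C \<noteq> {}" "\<And>J. J \<in> C \<Longrightarrow> ideal J R"
  obtains M where "M \<in> C" "\<And>J. J \<in> C \<Longrightarrow> M \<subseteq> J \<Longrightarrow> J = M"
proof -
  have "\<exists>M\<in>C. \<forall>N\<in>C. M \<subseteq> N \<longrightarrow> N = M"
  proof (rule subset_Zorn)
    fix D assume D: "subset.chain C D"
    show "\<exists>U\<in>C. \<forall>N\<in>D. N \<subseteq> U"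
    proof (cases "D = {}")
      case True
      then show ?thesis using assms(1) by auto
    next
      case False
      have "subset.chain {I. ideal I R} D"
        using D assms(2) unfolding pred_on.chain_def by auto
      then have "\<Union>D \<in> D" using ideal_chain_is_trivial[OF False] by blast
      moreover have "D \<subseteq> C" using D by (simp add: pred_on.chain_def)
      ultimately show ?thesis by (intro bexI[of _ "\<Union>D"]) auto
    qed
  qed
  then show ?thesis using that by blast
qed

text \<open>An ideal maximal among those over \<open>J\<close> missing \<open>T\<close> is prime:
  adding \<open>a\<close> or \<open>b\<close> from outside makes it meet \<open>T\<close>, and the
  product of the two elements of \<open>T\<close> so found would lie in it if
  \<open>a \<otimes> b\<close> did.\<close>

lemma prime_avoiding_multiplicative_set:
  assumes J: "ideal J R" and T: "T \<subseteq> carrier R" "\<one> \<in> T" "\<And>s t. s \<in> T \<Longrightarrow> t \<in> T \<Longrightarrow> s \<otimes> t \<in> T"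
    and JT: "J \<inter> T = {}"
  obtains Q where "primeideal Q R" "J \<subseteq> Q" "Q \<inter> T = {}"
proof -
  define C where "C = {K. ideal K R \<and> J \<subseteq> K \<and> K \<inter> T = {}}"
  have "C \<noteq> {}" using J JT by (auto simp: C_def)
  moreover have "ideal K R" if "K \<in> C" for K using that by (simp add: C_def)
  ultimately obtain M where MC: "M \<in> C" and maxC: "\<And>K. K \<in> C \<Longrightarrow> M \<subseteq> K \<Longrightarrow> K = M"
    by (rule ideal_family_maximal) (assumption | rule that)+
  have M: "ideal M R" "J \<subseteq> M" "M \<inter> T = {}" using MC by (auto simp: C_def)
  have max: "K = M" if "ideal K R" "J \<subseteq> K" "K \<inter> T = {}" "M \<subseteq> K" for K
    using maxC[of K] that by (simp add: C_def)
  have meets: "\<exists>m\<in>M. \<exists>r\<in>carrier R. m \<oplus> r \<otimes> a \<in> T" if a: "a \<in> carrier R" "a \<notin> M" for a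
  proof -
    let ?K = "M <+> PIdl a"
    have K: "ideal ?K R" "M \<subseteq> ?K" "a \<in> ?K"
      using add_ideals[OF M(1) cgenideal_ideal[OF a(1)]] subset_add_left[OF M(1) cgenideal_ideal[OF a(1)]]
        subset_add_right[OF M(1) cgenideal_ideal[OF a(1)]] cgenideal_self[OF a(1)] by auto
    then have "?K \<inter> T \<noteq> {}" using max[of ?K] M(2) a(2) by blast
    then show ?thesis by (auto simp: mem_add_principal)
  qed
  have "primeideal M R"
  proof (rule primeidealI[OF M(1) is_cring])
    show "carrier R \<noteq> M" using M(3) T(2) by auto
  next
    fix a b assume ab: "a \<in> carrier R" "b \<in> carrier R" "a \<otimes> b \<in> M"
    show "a \<in> M \<or> b \<in> M"
    proof (rule ccontr)
      assume "\<not> (a \<in> M \<or> b \<in> M)"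
      then obtain m r n q where m: "m \<in> M" "r \<in> carrier R" "m \<oplus> r \<otimes> a \<in> T"
        and n: "n \<in> M" "q \<in> carrier R" "n \<oplus> q \<otimes> b \<in> T" using meets ab by metis
      have c: "m \<in> carrier R" "n \<in> carrier R" using ideal_carr[OF M(1)] m n by auto
      have "(m \<oplus> r \<otimes> a) \<otimes> (n \<oplus> q \<otimes> b) = (n \<oplus> q \<otimes> b) \<otimes> m \<oplus> ((r \<otimes> a) \<otimes> n \<oplus> (r \<otimes> q) \<otimes> (a \<otimes> b))"
        using c m(2) n(2) ab(1,2) by algebra
      moreover have "\<dots> \<in> M"
        using m(2) n(2) ab(1,2) c by (intro ideal_add_closed[OF M(1)] ideal_lmult[OF M(1) _ m(1)]
            ideal_lmult[OF M(1) _ n(1)] ideal_lmult[OF M(1) _ ab(3)]) auto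
      ultimately show False using T(3)[OF m(3) n(3)] M(3) by auto
    qed
  qed
  then show ?thesis using that M by blast
qed

text \<open>Nakayama's lemma for the local ring at \<open>P\<close>. The generators of
  \<open>M\<close> are discarded one at a time: modulo \<open>L\<close> and the others,
  \<open>b\<close> is locally a multiple of itself with coefficient in \<open>P\<close>, hence
  zero.\<close>

lemma nakayama_sat:
  assumes P: "primeideal P R" and M: "ideal M R" and L: "ideal L R"
    and sub: "M \<subseteq> sat R P (L <+> P \<cdot> M)"
  shows "M \<subseteq> sat R P L"
proof -
  have Pi: "ideal P R" by (rule prime_ideal[OF P])
  obtain A where A: "A \<subseteq> carrier R" "finite A" "M = Idl A" using finetely_gen[OF M] by blast
  have AM: "A \<subseteq> M" using genideal_self[OF A(1)] A(3) by simp
  have "M \<subseteq> sat R P L" if "finite B" "B \<subseteq> M" "M \<subseteq> sat R P (L <+> Idl B)" for B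
    using that
  proof (induction B)
    case empty
    then show ?case using L unfolding Idl_empty
      using add_subset[OF L, of L "{\<zero>}"] ideal_zero_closed[OF L] sat_mono[of "L <+> {\<zero>}" L P] by auto
  next
    case (insert b B)
    have bc: "b \<in> carrier R" "B \<subseteq> carrier R" using insert.prems ideal_subset[OF M] by auto
    have Bi: "ideal (Idl B) R" "ideal (PIdl b) R" using bc genideal_ideal cgenideal_ideal by auto
    define L1 where "L1 = L <+> Idl B"
    have L1: "ideal L1 R" unfolding L1_def using L Bi add_ideals by auto
    have L1b: "ideal (L1 <+> PIdl b) R" using L1 Bi add_ideals by auto
    have "L <+> Idl (insert b B) = L1 <+> PIdl b"
      unfolding L1_def Idl_insert[OF bc(2,1)]
      using L Bi ideal_subset by (simp add: add.set_mult_assoc set_add_defs(1))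
    then have M1: "M \<subseteq> sat R P (L1 <+> PIdl b)" using insert.prems by simp
    obtain s where s: "s \<in> carrier R - P" "\<And>a. a \<in> M \<Longrightarrow> s \<otimes> a \<in> L1 <+> PIdl b"
      using sat_common_denominator[OF P L1b A(2)] AM M1 A(3) by blast
    \<comment> \<open>Up to the denominator \<open>s\<close>, elements of \<open>P \<cdot> M\<close>
      need \<open>b\<close> only with coefficients in \<open>P\<close>.\<close>
    have z: "\<exists>l\<in>L1. \<exists>p\<in>P. s \<otimes> z = l \<oplus> p \<otimes> b" if "z \<in> P \<cdot> M" for z
      using that
    proof induction
      case (prod p m)
      obtain l r where l: "l \<in> L1" "r \<in> carrier R" "s \<otimes> m = l \<oplus> r \<otimes> b"
        using s(2)[OF prod(2)] by (auto simp: mem_add_principal)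
      have c: "p \<in> carrier R" "m \<in> carrier R" "l \<in> carrier R"
        using ideal_carr[OF Pi prod(1)] ideal_carr[OF M prod(2)] ideal_carr[OF L1 l(1)] by auto
      have "s \<otimes> (p \<otimes> m) = p \<otimes> (s \<otimes> m)" using c s(1) by (simp add: m_ac)
      also have "\<dots> = p \<otimes> l \<oplus> (p \<otimes> r) \<otimes> b" unfolding l(3) using c l(2) bc by algebra
      finally show ?case using ideal_lmult[OF L1 c(1) l(1)] ideal_rmult[OF Pi l(2) prod(1)] by blast
    next
      case (sum z1 z2)
      then obtain l1 p1 l2 p2 where *: "l1 \<in> L1" "p1 \<in> P" "l2 \<in> L1" "p2 \<in> P"
        "s \<otimes> z1 = l1 \<oplus> p1 \<otimes> b" "s \<otimes> z2 = l2 \<oplus> p2 \<otimes> b" by blast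
      have c: "l1 \<in> carrier R" "p1 \<in> carrier R" "l2 \<in> carrier R" "p2 \<in> carrier R"
        using ideal_carr[OF L1] ideal_carr[OF Pi] * by auto
      have "z1 \<in> carrier R" "z2 \<in> carrier R"
        using sum(1,2) ideal_carr[OF ideal_prod_is_ideal[OF Pi M]] by auto
      then have "s \<otimes> (z1 \<oplus> z2) = s \<otimes> z1 \<oplus> s \<otimes> z2" using s(1) by (simp add: r_distr)
      also have "\<dots> = (l1 \<oplus> l2) \<oplus> (p1 \<oplus> p2) \<otimes> b" unfolding *(5,6) using c bc by algebra
      finally show ?case using ideal_add_closed[OF L1 *(1,3)] ideal_add_closed[OF Pi *(2,4)] by blast
    qed
    obtain t where t: "t \<in> carrier R - P" "t \<otimes> b \<in> L <+> P \<cdot> M"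
      using insert.prems sub by (auto simp: sat_def)
    then obtain l z where lz: "l \<in> L" "z \<in> P \<cdot> M" "t \<otimes> b = l \<oplus> z" by (auto simp: mem_set_add)
    obtain l' p where p: "l' \<in> L1" "p \<in> P" "s \<otimes> z = l' \<oplus> p \<otimes> b" using z[OF lz(2)] by blast
    have lL1: "l \<in> L1" using subset_add_left[OF L Bi(1)] lz(1) L1_def by auto
    have c: "l \<in> carrier R" "l' \<in> carrier R" "p \<in> carrier R" "z \<in> carrier R"
      using ideal_carr[OF L1] ideal_carr[OF Pi] lL1 p lz(2) ideal_carr[OF ideal_prod_is_ideal[OF Pi M]] by auto
    have "(s \<otimes> t \<ominus> p) \<otimes> b = s \<otimes> (t \<otimes> b) \<ominus> p \<otimes> b" using c s t bc by simp algebra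
    also have "\<dots> = s \<otimes> l \<oplus> s \<otimes> z \<ominus> p \<otimes> b" unfolding lz(3) using c s bc by (simp add: r_distr)
    also have "\<dots> = s \<otimes> l \<oplus> l'" unfolding p(3) using c s bc by simp algebra
    finally have eq: "(s \<otimes> t \<ominus> p) \<otimes> b \<in> L1"
      using ideal_add_closed[OF L1 ideal_lmult[OF L1 _ lL1] p(1)] s by auto
    \<comment> \<open>\<open>s \<otimes> t\<close> lies outside \<open>P\<close> and
      \<open>p\<close> inside, so the difference is a denominator for \<open>b\<close>.\<close>
    have "s \<otimes> t \<ominus> p \<notin> P"
    proof
      assume a: "s \<otimes> t \<ominus> p \<in> P"
      have "s \<otimes> t \<in> carrier R" using s t by auto
      then have "(s \<otimes> t \<ominus> p) \<oplus> p = s \<otimes> t" using c(3) by algebra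
      then show False using ideal_add_closed[OF Pi a p(2)] prime_compl_mult[OF P s(1) t(1)] by auto
    qed
    then have "b \<in> sat R P L1" using satI[OF bc(1) _ eq] s t c by auto
    then have "L1 <+> PIdl b \<subseteq> sat R P L1"
      using subset_sat[OF P L1] by (intro add_subset sat_ideal P L1 cgenideal_minimal)
    then have "M \<subseteq> sat R P L1" using M1 sat_mono[of _ "sat R P L1" P] sat_sat[OF P] by blast
    then show ?case using insert L1_def by auto
  qed
  moreover have "M \<subseteq> sat R P (L <+> Idl A)"
    using A(3) subset_add_right[OF L M] subset_sat[OF P add_ideals[OF L M]] by auto
  ultimately show ?thesis using A(2) AM by blast
qed

end

section \<open>Krull's principal ideal theorem\<close>

context cring
begin

lemma set_add_subset_mono: "J \<subseteq> J' \<Longrightarrow> K \<subseteq> K' \<Longrightarrow> J <+> K \<subseteq> J' <+> K'"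
  unfolding set_add_def' by blast

text \<open>Exponents add up: a product of \<open>N + n\<close> generators with fewer than
  \<open>n\<close> copies of \<open>a\<close> has more than \<open>N\<close> factors from
  \<open>A\<close>.\<close>

lemma ideal_pow_subset_of_gens:
  assumes E: "ideal E R" and "finite A" "A \<subseteq> carrier R"
    and "\<And>a. a \<in> A \<Longrightarrow> \<exists>n::nat. a [^] n \<in> E"
  shows "\<exists>N. ideal_pow R (Idl A) N \<subseteq> E"
  using assms(2-)
proof (induction A)
  case empty
  have "ideal_pow R (Idl {}) (Suc 0) \<subseteq> E"
    using ideal_pow_1[OF zeroideal] ideal_zero_closed[OF E] by (simp add: Idl_empty)
  then show ?case by blast
next
  case (insert a A)
  obtain n where n: "a [^] (n::nat) \<in> E" using insert.prems(2)[of a] by auto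
  have "\<exists>N. ideal_pow R (Idl A) N \<subseteq> E" using insert.prems by (intro insert.IH) auto
  then obtain N where N: "ideal_pow R (Idl A) N \<subseteq> E" by blast
  have a: "a \<in> carrier R" "A \<subseteq> carrier R" using insert.prems by auto
  let ?K = "Idl A" and ?L = "Idl A <+> PIdl a"
  have K: "ideal ?K R" using a genideal_ideal by auto
  have L: "ideal ?L R" using K a add_ideals cgenideal_ideal by auto
  \<comment> \<open>\<open>i\<close> counts the copies of \<open>a\<close> split off so far. The
    induction runs down from \<open>i = n\<close>, where \<open>a [^] n \<in> E\<close>.\<close>
  have "a [^] i \<otimes> z \<in> E" if "i \<le> n" "z \<in> ideal_pow R ?L t" "N + n \<le> t + i" for i z t
    using that
  proof (induction i arbitrary: z t rule: inc_induct)
    case base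
    then show ?case using ideal_rmult[OF E _ n] ideal_carr[OF ideal_pow_ideal[OF L]] by blast
  next
    case (step i)
    then obtain t' where t: "t = Suc t'" using not0_implies_Suc[of t] by auto
    obtain z0 z1 where z: "z0 \<in> ideal_pow R ?K (Suc t')" "z1 \<in> ideal_pow R ?L t'" "z = z0 \<oplus> a \<otimes> z1"
      using ideal_pow_add_principal[OF K a(1)] step.prems(1) unfolding t by metis
    have c: "z0 \<in> carrier R" "z1 \<in> carrier R"
      using z ideal_carr[OF ideal_pow_ideal[OF K]] ideal_carr[OF ideal_pow_ideal[OF L]] by auto
    have "N \<le> Suc t'" using step t by simp
    then have "z0 \<in> E" using ideal_pow_antimono[OF K] N z(1) by blast
    moreover have "a [^] Suc i \<otimes> z1 \<in> E" using step.IH[OF z(2)] step.prems(2) t by simp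
    moreover have "a [^] i \<otimes> z = a [^] i \<otimes> z0 \<oplus> a [^] Suc i \<otimes> z1"
      using a c by (simp add: z(3) r_distr nat_pow_Suc m_assoc)
    ultimately show ?case
      using ideal_add_closed[OF E ideal_lmult[OF E]] a by simp
  qed
  from this[of 0 _ "N + n"] have "ideal_pow R ?L (N + n) \<subseteq> E"
    using ideal_carr[OF ideal_pow_ideal[OF L]] by (auto simp: nat_pow_0 subset_iff)
  then show ?case using Idl_insert[OF a(2,1)] by auto
qed

text \<open>The modular law up to saturation. It reduces stationarity of a chain to that of its sums
  and of its intersections with \<open>E\<close>.\<close>

lemma sat_add_stable:
  assumes P: "primeideal P R" and J: "ideal J R" "sat R P J = J" and K: "ideal K R" "K \<subseteq> J"
    and E: "ideal E R" and eq: "sat R P (J <+> E) = sat R P (K <+> E)" "J \<inter> E = K \<inter> E"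
  shows "J \<subseteq> sat R P K"
proof
  fix a assume a: "a \<in> J"
  then have "a \<in> sat R P (K <+> E)"
    using eq(1) subset_sat[OF P add_ideals[OF J(1) E]] subset_add_left[OF J(1) E] by blast
  then obtain s k e where s: "s \<in> carrier R - P" "k \<in> K" "e \<in> E" "s \<otimes> a = k \<oplus> e"
    by (auto simp: sat_def mem_set_add)
  have c: "k \<in> carrier R" "e \<in> carrier R" "a \<in> carrier R"
    using s ideal_carr[OF K(1)] ideal_carr[OF E] ideal_carr[OF J(1) a] by auto
  have "e \<oplus> k \<in> J" using s a ideal_lmult[OF J(1), of s a] c a_comm by auto
  then have "e \<in> J" using ideal_diff_cancel[OF J(1)] c s K by blast
  then have "e \<in> K" using eq(2) s by blast
  then have "s \<otimes> a \<in> K" using s ideal_add_closed[OF K(1)] by simp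
  then show "a \<in> sat R P K" using satI[OF c(3) s(1)] by blast
qed

end

context noetherian_cring
begin

text \<open>The ring of fractions of \<open>R / E\<close> at \<open>P\<close> is Artinian. The induction enlarges \<open>E\<close> by one
  element \<open>w\<close> of the socle; a saturated ideal meets \<open>E + (w)\<close> either in \<open>E\<close> or in everything.\<close>

lemma sat_descending_stationary:
  fixes J :: "nat \<Rightarrow> 'a set"
  assumes P: "primeideal P R" and "ideal E R" "sat R P E = E" "ideal_pow R P N \<subseteq> E"
    and "\<And>n. ideal (J n) R" "\<And>n. sat R P (J n) = J n" "\<And>n. E \<subseteq> J n" "\<And>n. J (Suc n) \<subseteq> J n"
  shows "\<exists>m. \<forall>n\<ge>m. J n = J m"
proof -
  define desc where "desc E J \<longleftrightarrow> (\<forall>n. ideal (J n) R \<and> sat R P (J n) = J n \<and> E \<subseteq> J n \<and> J (Suc n) \<subseteq> J n)"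
    for E and J :: "nat \<Rightarrow> 'a set"
  \<comment> \<open>\<open>C\<close> collects the counterexamples. For a maximal one, the larger
    ideal \<open>F\<close> below is no counterexample.\<close>
  define C where "C = {E. ideal E R \<and> sat R P E = E \<and> ideal_pow R P N \<subseteq> E \<and>
    (\<exists>J. desc E J \<and> \<not> (\<exists>m. \<forall>n\<ge>m. J n = J m))}"
  have "C = {}"
  proof (rule ccontr)
    assume "C \<noteq> {}"
    moreover have "ideal K R" if "K \<in> C" for K using that by (simp add: C_def)
    ultimately obtain E where EC: "E \<in> C" and max: "\<And>K. K \<in> C \<Longrightarrow> E \<subseteq> K \<Longrightarrow> K = E"
      by (rule ideal_family_maximal) (assumption | rule that)+
    then obtain J where E: "ideal E R" "sat R P E = E" "ideal_pow R P N \<subseteq> E" "desc E J"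
      and nst: "\<not> (\<exists>m. \<forall>n\<ge>m. J n = J m)" unfolding C_def by blast
    have J: "ideal (J n) R" "sat R P (J n) = J n" "E \<subseteq> J n" "J (Suc n) \<subseteq> J n" for n
      using E(4) by (auto simp: desc_def)
    have Pi: "ideal P R" by (rule prime_ideal[OF P])
    have anti: "J n \<subseteq> J m" if "m \<le> n" for m n using J(4) that by (rule lift_Suc_antimono_le)
    have "\<one> \<notin> E"
    proof
      assume "\<one> \<in> E"
      then have "E = carrier R" using ideal.one_imp_carrier[OF E(1)] by auto
      then have "J n = carrier R" for n using J(3)[of n] ideal_subset[OF J(1)] by auto
      then show False using nst by auto
    qed
    then have ex0: "\<not> ideal_pow R P 0 \<subseteq> E" by (auto simp: ideal_pow_0)
    \<comment> \<open>The last power of \<open>P\<close> not inside \<open>E\<close> supplies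
      \<open>w\<close>; multiplying by \<open>P\<close> leads to the next power, which lies in
      \<open>E\<close>.\<close>
    define i where "i = (LEAST i. ideal_pow R P i \<subseteq> E)"
    have i: "ideal_pow R P i \<subseteq> E" unfolding i_def using E(3) by (rule LeastI)
    then have "i \<noteq> 0" using ex0 by metis
    then obtain k where k: "i = Suc k" using not0_implies_Suc by blast
    then have "\<not> ideal_pow R P k \<subseteq> E" using not_less_Least[of k "\<lambda>i. ideal_pow R P i \<subseteq> E"] i_def by simp
    then obtain w where w: "w \<in> ideal_pow R P k" "w \<notin> E" by blast
    have wc: "w \<in> carrier R" using ideal_carr[OF ideal_pow_ideal[OF Pi] w(1)] .
    have Pw: "p \<otimes> w \<in> E" if "p \<in> P" for p
    proof -
      have "w \<otimes> p \<in> ideal_pow R P i" unfolding k ideal_pow_Suc using w(1) that by (rule ideal_prod.prod)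
      then show ?thesis using i m_comm[of w p] wc ideal_carr[OF Pi that] by auto
    qed
    define F where "F = sat R P (E <+> PIdl w)"
    have Ewi: "ideal (E <+> PIdl w) R" using add_ideals[OF E(1) cgenideal_ideal[OF wc]] .
    have F: "ideal F R" "sat R P F = F" unfolding F_def using sat_ideal[OF P Ewi] sat_sat[OF P] by auto
    have EF: "E \<subseteq> F" using subset_add_left[OF E(1) cgenideal_ideal[OF wc]] subset_sat[OF P Ewi] F_def by blast
    have wF: "w \<in> F" using subset_add_right[OF E(1) cgenideal_ideal[OF wc]] cgenideal_self[OF wc]
        subset_sat[OF P Ewi] F_def by blast
    have "F \<notin> C" using max[of F] EF wF w(2) by blast
    then have stF: "\<exists>m. \<forall>n\<ge>m. L n = L m" if "desc F L" for L
      using that F E(3) EF unfolding C_def by blast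
    define L where "L n = sat R P (J n <+> F)" for n
    have JF: "ideal (J n <+> F) R" for n using add_ideals[OF J(1) F(1)] .
    have "desc F L" unfolding desc_def
    proof (intro allI conjI)
      fix n
      show "ideal (L n) R" unfolding L_def using sat_ideal[OF P JF] .
      show "sat R P (L n) = L n" unfolding L_def using sat_sat[OF P] .
      show "F \<subseteq> L n" unfolding L_def using subset_add_right[OF J(1) F(1)] subset_sat[OF P JF] by blast
      have "J (Suc n) <+> F \<subseteq> J n <+> F" using J(4)[of n] by (rule set_add_subset_mono) simp
      then show "L (Suc n) \<subseteq> L n" unfolding L_def by (rule sat_mono)
    qed
    then obtain m1 where m1: "\<And>n. n \<ge> m1 \<Longrightarrow> L n = L m1" using stF by blast
    have meet: "J n \<inter> F = (if w \<in> J n then F else E)" for n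
    proof (cases "w \<in> J n")
      case True
      have "F \<subseteq> J n" unfolding F_def
        using sat_mono[OF add_subset[OF J(1,3) cgenideal_minimal[OF J(1) True]]] J(2)[of n] by blast
      then show ?thesis using True by auto
    next
      case False
      have "a \<in> E" if a: "a \<in> J n" "a \<in> F" for a
      proof -
        obtain s e r where s: "s \<in> carrier R - P" "e \<in> E" "r \<in> carrier R" "s \<otimes> a = e \<oplus> r \<otimes> w"
          using a(2) by (auto simp: F_def sat_def mem_add_principal)
        have c: "a \<in> carrier R" "e \<in> carrier R" using ideal_carr[OF J(1) a(1)] ideal_carr[OF E(1) s(2)] .
        have "r \<otimes> w \<oplus> e \<in> J n" using s a c wc ideal_lmult[OF J(1), of s a n] a_comm by auto
        then have "r \<otimes> w \<in> J n" using ideal_diff_cancel[OF J(1)] s c wc J(3) by blast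
        then have "r \<in> P" using satI[OF wc, of r P "J n"] J(2)[of n] s(3) False by auto
        then have "s \<otimes> a \<in> E" using s Pw ideal_add_closed[OF E(1)] by simp
        then show ?thesis using satI[OF c(1) s(1)] E(2) by blast
      qed
      then show ?thesis using False J(3) EF by auto
    qed
    \<comment> \<open>In a decreasing chain \<open>w\<close> can disappear only once.\<close>
    obtain m2 where m2: "\<And>n. n \<ge> m2 \<Longrightarrow> J n \<inter> F = J m2 \<inter> F"
    proof (cases "\<exists>m. w \<notin> J m")
      case True
      then obtain m where "w \<notin> J m" by blast
      then have "w \<notin> J n" if "n \<ge> m" for n using anti[OF that] by blast
      then show ?thesis using that[of m] unfolding meet by simp
    next
      case False
      then show ?thesis using that[of 0] unfolding meet by simp
    qed
    define m where "m = max m1 m2"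
    have "J n = J m" if "n \<ge> m" for n
    proof
      show "J n \<subseteq> J m" using anti[OF that] .
      have "L m = L n" using m1[of m] m1[of n] that m_def by simp
      moreover have "J m \<inter> F = J n \<inter> F" using m2[of m] m2[of n] that m_def by simp
      ultimately show "J m \<subseteq> J n"
        using sat_add_stable[OF P J(1,2) J(1) anti[OF that] F(1)] J(2)[of n] unfolding L_def by simp
    qed
    then show False using nst by blast
  qed
  have J: "desc E J" using assms(5-8) by (simp add: desc_def)
  show ?thesis
  proof (rule ccontr)
    assume "\<not> ?thesis"
    with J have "\<exists>J. desc E J \<and> \<not> (\<exists>m. \<forall>n\<ge>m. J n = J m)" by (intro exI[of _ J] conjI)
    then have "E \<in> C" using assms(2-4) by (simp add: C_def)
    with \<open>C = {}\<close> show False by simp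
  qed
qed

text \<open>Otherwise \<open>P2\<close> is minimal over \<open>P0 + (x)\<close>, and the symbolic powers of \<open>P1\<close> become stationary
  modulo \<open>x\<close>, hence stationary by Nakayama.\<close>

theorem krull_principal_ideal:
  assumes P0: "primeideal P0 R" and P1: "primeideal P1 R" and P2: "primeideal P2 R"
    and lt: "P0 \<subset> P1" "P1 \<subset> P2" and x: "x \<in> P2"
  shows "\<exists>Q. primeideal Q R \<and> P0 \<subset> Q \<and> Q \<subset> P2 \<and> x \<in> Q"
proof (rule ccontr)
  assume no: "\<not> ?thesis"
  note P0i = prime_ideal[OF P0] and P1i = prime_ideal[OF P1] and P2i = prime_ideal[OF P2]
  have xP1: "x \<notin> P1" using no P1 lt by blast
  have xc: "x \<in> carrier R" using ideal_carr[OF P2i x] .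
  define J0 where "J0 = P0 <+> PIdl x"
  have J0: "ideal J0 R" unfolding J0_def using add_ideals[OF P0i cgenideal_ideal[OF xc]] .
  have P0J0: "P0 \<subseteq> J0" unfolding J0_def using subset_add_left[OF P0i cgenideal_ideal[OF xc]] .
  have xJ0: "x \<in> J0" unfolding J0_def
    using subset_add_right[OF P0i cgenideal_ideal[OF xc]] cgenideal_self[OF xc] by auto
  define E where "E = sat R P2 J0"
  have E: "ideal E R" "sat R P2 E = E" unfolding E_def using sat_ideal[OF P2 J0] sat_sat[OF P2] by auto
  \<comment> \<open>A prime over \<open>J0\<close> missing all \<open>s \<otimes> y [^] n\<close>
    would lie inside \<open>P2\<close>, contain \<open>x\<close> and omit \<open>y\<close>: exactly
    what \<open>no\<close> forbids.\<close>
  have rad: "\<exists>n::nat. y [^] n \<in> E" if y: "y \<in> P2" for y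
  proof (rule ccontr)
    assume n: "\<not> ?thesis"
    have yc: "y \<in> carrier R" using ideal_carr[OF P2i y] .
    define T where "T = {s \<otimes> y [^] n | s n::nat. s \<in> carrier R - P2}"
    have T: "T \<subseteq> carrier R" using yc by (auto simp: T_def)
    have T1: "\<one> \<in> T" unfolding T_def using one_notin_prime[OF P2] by (auto intro!: exI[of _ \<one>] exI[of _ 0] simp: nat_pow_0)
    have Tm: "s \<otimes> t \<in> T" if "s \<in> T" "t \<in> T" for s t
    proof -
      from that obtain u m v n where u: "u \<in> carrier R - P2" "s = u \<otimes> y [^] (m::nat)"
        and v: "v \<in> carrier R - P2" "t = v \<otimes> y [^] (n::nat)" unfolding T_def by blast
      then have "s \<otimes> t = (u \<otimes> v) \<otimes> y [^] (m + n)" using yc by (simp add: nat_pow_mult[symmetric] m_ac)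
      then show ?thesis using prime_compl_mult[OF P2 u(1) v(1)] unfolding T_def by blast
    qed
    have "J0 \<inter> T = {}"
    proof (rule ccontr)
      assume "J0 \<inter> T \<noteq> {}"
      then obtain s m where "s \<in> carrier R - P2" "s \<otimes> y [^] (m::nat) \<in> J0" by (auto simp: T_def)
      then have "y [^] m \<in> E" unfolding E_def using satI[of "y [^] m"] yc by simp
      then show False using n by blast
    qed
    then obtain Q where Q: "primeideal Q R" "J0 \<subseteq> Q" "Q \<inter> T = {}"
      using prime_avoiding_multiplicative_set[OF J0 T T1 Tm] by auto
    have "s \<in> T" if "s \<in> carrier R - P2" for s
      unfolding T_def using that by (auto intro!: exI[of _ s] exI[of _ 0] simp: nat_pow_0)
    then have "Q \<subseteq> P2" using Q(3) ideal_subset[OF prime_ideal[OF Q(1)]] by blast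
    moreover have "y \<in> T"
      unfolding T_def using one_notin_prime[OF P2] yc
      by (auto intro!: exI[of _ \<one>] exI[of _ "Suc 0"] simp: nat_pow_0 nat_pow_Suc)
    then have "y \<notin> Q" using Q(3) by blast
    moreover have "P0 \<noteq> Q" using xJ0 Q(2) xP1 lt by blast
    ultimately show False using no Q(1,2) P0J0 xJ0 y by blast
  qed
  obtain A where A: "A \<subseteq> carrier R" "finite A" "P2 = Idl A" using finetely_gen[OF P2i] by blast
  have "A \<subseteq> P2" using genideal_self[OF A(1)] A(3) by simp
  then obtain N where N: "ideal_pow R P2 N \<subseteq> E"
    using ideal_pow_subset_of_gens[OF E(1) A(2,1)] rad A(3) by blast
  \<comment> \<open>The symbolic powers of \<open>P1\<close> modulo \<open>P0\<close>. Being
    saturated at \<open>P1\<close>, they allow \<open>x \<notin> P1\<close> to be cancelled.\<close>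
  define S where "S n = sat R P1 (P0 <+> ideal_pow R P1 n)" for n
  have pi: "ideal (P0 <+> ideal_pow R P1 n) R" for n using add_ideals[OF P0i ideal_pow_ideal[OF P1i]] .
  have S: "ideal (S n) R" "sat R P1 (S n) = S n" for n
    unfolding S_def using sat_ideal[OF P1 pi] sat_sat[OF P1] by auto
  have S0: "P0 \<subseteq> S n" for n
    unfolding S_def using subset_add_left[OF P0i ideal_pow_ideal[OF P1i]] subset_sat[OF P1 pi] by blast
  have Spow: "ideal_pow R P1 n \<subseteq> S n" for n
    unfolding S_def using subset_add_right[OF P0i ideal_pow_ideal[OF P1i]] subset_sat[OF P1 pi] by blast
  have Sdec: "S (Suc n) \<subseteq> S n" for n
    unfolding S_def using ideal_pow_antimono[OF P1i, of n "Suc n"]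
    by (intro sat_mono set_add_subset_mono) auto
  define J where "J n = sat R P2 (S n <+> PIdl x)" for n
  have Sx: "ideal (S n <+> PIdl x) R" for n using add_ideals[OF S(1) cgenideal_ideal[OF xc]] .
  have "\<exists>m. \<forall>n\<ge>m. J n = J m"
  proof (rule sat_descending_stationary[OF P2 E N])
    fix n
    show "ideal (J n) R" "sat R P2 (J n) = J n"
      unfolding J_def using sat_ideal[OF P2 Sx] sat_sat[OF P2] by auto
    show "E \<subseteq> J n" unfolding E_def J_def J0_def using S0[of n] by (intro sat_mono set_add_subset_mono) auto
    show "J (Suc n) \<subseteq> J n" unfolding J_def using Sdec[of n] by (intro sat_mono set_add_subset_mono) auto
  qed
  then obtain n where "\<forall>k\<ge>n. J k = J n" by blast
  then have n: "J (Suc n) = J n" by (elim allE[of _ "Suc n"] impE) (rule le_SucI[OF le_refl])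
  \<comment> \<open>Stationarity modulo \<open>x\<close> writes \<open>a\<close> locally as an
    element of \<open>S (Suc n)\<close> plus \<open>r \<otimes> x\<close>. Cancelling
    \<open>x\<close> gives \<open>r \<in> S n\<close>, so the error lies in
    \<open>P2 \<cdot> S n\<close>.\<close>
  have "S n \<subseteq> sat R P2 (S (Suc n) <+> P2 \<cdot> S n)"
  proof
    fix a assume a: "a \<in> S n"
    have "a \<in> S n <+> PIdl x" using subset_add_left[OF S(1) cgenideal_ideal[OF xc]] a by auto
    then have "a \<in> J (Suc n)" unfolding n using subset_sat[OF P2 Sx[of n]] by (auto simp: J_def)
    then obtain s b r where s: "s \<in> carrier R - P2" "b \<in> S (Suc n)" "r \<in> carrier R" "s \<otimes> a = b \<oplus> r \<otimes> x"
      by (auto simp: J_def sat_def mem_add_principal)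
    have c: "a \<in> carrier R" "b \<in> carrier R" using ideal_carr[OF S(1) a] ideal_carr[OF S(1) s(2)] .
    have "r \<otimes> x \<oplus> b \<in> S n" using s a c xc ideal_lmult[OF S(1), of s a n] a_comm by auto
    then have "r \<otimes> x \<in> S n" using ideal_diff_cancel[OF S(1)] s Sdec c xc by blast
    then have "r \<in> sat R P1 (S n)" using satI[of r x P1 "S n"] s(3) xc xP1 m_comm by auto
    then have "x \<otimes> r \<in> P2 \<cdot> S n" using S(2) x by (metis ideal_prod.prod)
    then have "s \<otimes> a \<in> S (Suc n) <+> P2 \<cdot> S n" using s m_comm[OF s(3) xc] by (auto simp: mem_set_add)
    then show "a \<in> sat R P2 (S (Suc n) <+> P2 \<cdot> S n)" using satI[OF c(1) s(1)] by blast
  qed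
  then have "S n \<subseteq> sat R P2 (S (Suc n))" using nakayama_sat[OF P2 S(1) S(1)] by blast
  also have "\<dots> \<subseteq> sat R P1 (S (Suc n))" using lt(2) by (auto simp: sat_def)
  \<comment> \<open>Nakayama again, now at \<open>P1\<close>: a power of \<open>P1\<close> lies in
    \<open>P0\<close>, which forces \<open>P1 \<subseteq> P0\<close>.\<close>
  finally have "ideal_pow R P1 n \<subseteq> sat R P1 (P0 <+> P1 \<cdot> ideal_pow R P1 n)"
    using Spow[of n] S(2)[of "Suc n"] ideal_prod_commute[OF P1i ideal_pow_ideal[OF P1i]]
    by (auto simp: S_def ideal_pow_Suc)
  then have sub: "ideal_pow R P1 n \<subseteq> sat R P1 P0" using nakayama_sat[OF P1 ideal_pow_ideal[OF P1i] P0i] by blast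
  have "P1 \<subseteq> P0"
  proof
    fix y assume y: "y \<in> P1"
    then have "y [^] n \<in> ideal_pow R P1 n"
      using nat_pow_mem_ideal_pow[OF P1i, of y "Suc 0" n] ideal_pow_1[OF P1i] by simp
    then have "y [^] n \<in> P0" using sub sat_prime[OF P1 P0] lt(1) by blast
    then show "y \<in> P0" using prime_pow_mem[OF P0 ideal_carr[OF P1i y]] by blast
  qed
  then show False using lt by blast
qed

end

section \<open>Regular local rings\<close>

text \<open>Encodes chains of primes of \<open>R / J\<close> without forming the quotient;
  \<open>n\<close> counts the inclusions.\<close>

definition prime_chain :: "('a, 'b) ring_scheme \<Rightarrow> 'a set \<Rightarrow> nat \<Rightarrow> (nat \<Rightarrow> 'a set) \<Rightarrow> bool" where
  "prime_chain R J n P \<longleftrightarrow>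
     (\<forall>i\<le>n. primeideal (P i) R) \<and> (\<forall>i<n. P i \<subset> P (Suc i)) \<and> J \<subseteq> P 0"

text \<open>Stands in for a regular sequence in any order: an element outside a prime ideal is a
  nonzerodivisor modulo it.\<close>

definition prime_independent :: "('a, 'b) ring_scheme \<Rightarrow> 'a set \<Rightarrow> bool" where
  "prime_independent R V \<longleftrightarrow> finite V \<and> V \<subseteq> carrier R \<and>
     (\<forall>A\<subseteq>V. primeideal (Idl\<^bsub>R\<^esub> A) R \<and> (\<forall>x\<in>V - A. x \<notin> Idl\<^bsub>R\<^esub> A))"

context noetherian_cring
begin

text \<open>Going down from the top, Krull's theorem replaces each prime by one containing
  \<open>x\<close>, and only the bottom prime is lost. So dividing by \<open>x\<close> costs one
  step of the chain.\<close>

lemma prime_chain_reroute: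
  assumes "prime_chain R J (Suc n) P" "x \<in> P (Suc n)"
  shows "\<exists>Q. prime_chain R J n Q \<and> x \<in> Q 0 \<and> Q n = P (Suc n)"
  using assms
proof (induction n arbitrary: P)
  case 0
  then have "prime_chain R J 0 (\<lambda>_. P (Suc 0))" by (auto simp: prime_chain_def)
  with 0 show ?case by (intro exI[of _ "\<lambda>_. P (Suc 0)"]) simp
next
  case (Suc n)
  have pr: "primeideal (P i) R" if "i \<le> Suc (Suc n)" for i
    using Suc.prems(1) that by (simp add: prime_chain_def)
  have st: "P i \<subset> P (Suc i)" if "i < Suc (Suc n)" for i
    using Suc.prems(1) that by (simp add: prime_chain_def)
  obtain Q' where Q': "primeideal Q' R" "P n \<subset> Q'" "Q' \<subset> P (Suc (Suc n))" "x \<in> Q'"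
    using krull_principal_ideal[OF pr[of n] pr[of "Suc n"] pr[of "Suc (Suc n)"] _ _ Suc.prems(2)] st by auto
  have "prime_chain R J (Suc n) (P(Suc n := Q'))"
    using Suc.prems(1) Q' by (auto simp: prime_chain_def less_Suc_eq)
  from Suc.IH[OF this] Q'(4) obtain Q where Q: "prime_chain R J n Q" "x \<in> Q 0" "Q n = Q'" by auto
  have c: "prime_chain R J (Suc n) (Q(Suc n := P (Suc (Suc n))))"
    using Q Q' pr[of "Suc (Suc n)"] by (auto simp: prime_chain_def less_Suc_eq le_Suc_eq)
  show ?case
    by (rule exI[of _ "Q(Suc n := P (Suc (Suc n)))"], intro conjI, rule c) (use Q(2) in simp_all)
qed

end

section \<open>Noetherian local rings and primes generated by parameters\<close>

locale noetherian_local = noetherian_cring +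
  fixes \<mm>
  assumes max: "maximalideal \<mm> R" and max_unique: "maximalideal M R \<Longrightarrow> M = \<mm>"
begin

lemma max_ideal: "ideal \<mm> R"
  using max by (rule maximalideal.axioms(1))

lemma max_prime: "primeideal \<mm> R"
  by (rule maximalideal_prime[OF max])

lemma proper_ideal_subset_max:
  assumes K: "ideal K R" "\<one> \<notin> K" shows "K \<subseteq> \<mm>"
proof -
  define C where "C = {L. ideal L R \<and> K \<subseteq> L \<and> \<one> \<notin> L}"
  have "C \<noteq> {}" using K by (auto simp: C_def)
  moreover have "ideal L R" if "L \<in> C" for L using that by (simp add: C_def)
  ultimately obtain M where MC: "M \<in> C" and maxC: "\<And>L. L \<in> C \<Longrightarrow> M \<subseteq> L \<Longrightarrow> L = M"
    by (rule ideal_family_maximal) (assumption | rule that)+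
  have M: "ideal M R" "K \<subseteq> M" "\<one> \<notin> M" using MC by (auto simp: C_def)
  have "maximalideal M R"
  proof (rule maximalidealI[OF M(1)])
    show "carrier R \<noteq> M" using M(3) by auto
  next
    fix L assume L: "ideal L R" "M \<subseteq> L" "L \<subseteq> carrier R"
    show "L = M \<or> L = carrier R"
    proof (cases "\<one> \<in> L")
      case True
      then show ?thesis using ideal.one_imp_carrier[OF L(1)] by simp
    next
      case False
      then show ?thesis using maxC[of L] L M(2) by (auto simp: C_def)
    qed
  qed
  then show ?thesis using max_unique M(2) by auto
qed

lemma unit_outside_max:
  assumes "a \<in> carrier R" "a \<notin> \<mm>"
  obtains b where "b \<in> carrier R" "b \<otimes> a = \<one>"
proof -
  have "\<one> \<in> PIdl a"
    using proper_ideal_subset_max[OF cgenideal_ideal[OF assms(1)]] cgenideal_self[OF assms(1)] assms(2) by auto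
  then show ?thesis using that by (auto simp: cgenideal_def)
qed

lemma mem_of_unit_multiple:
  assumes "ideal L R" "a \<in> carrier R" "s \<in> carrier R - \<mm>" "s \<otimes> a \<in> L"
  shows "a \<in> L"
proof -
  obtain b where b: "b \<in> carrier R" "b \<otimes> s = \<one>" using unit_outside_max assms(3) by blast
  have "b \<otimes> (s \<otimes> a) \<in> L" using ideal_lmult[OF assms(1) b(1) assms(4)] .
  then show ?thesis using b assms by (simp add: m_assoc[symmetric])
qed

lemma nakayama:
  assumes M: "ideal M R" and L: "ideal L R" and "M \<subseteq> L <+> \<mm> \<cdot> M"
  shows "M \<subseteq> L"
proof -
  have "M \<subseteq> sat R \<mm> (L <+> \<mm> \<cdot> M)"
    using assms(3) subset_sat[OF max_prime add_ideals[OF L ideal_prod_is_ideal[OF max_ideal M]]] by blast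
  then have "M \<subseteq> sat R \<mm> L" by (rule nakayama_sat[OF max_prime M L])
  also have "\<dots> \<subseteq> L" using mem_of_unit_multiple[OF L] by (auto simp: sat_def)
  finally show ?thesis .
qed

lemma prime_subset_max: "primeideal P R \<Longrightarrow> P \<subseteq> \<mm>"
  using proper_ideal_subset_max[OF prime_ideal one_notin_prime] .

text \<open>\<open>prime_chain_reroute\<close> asks for \<open>x\<close> in the top prime; with
  \<open>\<mm>\<close> on top every \<open>x \<in> \<mm>\<close> qualifies.\<close>

lemma prime_chain_top:
  assumes "prime_chain R J (Suc n) P"
  shows "prime_chain R J (Suc n) (P(Suc n := \<mm>))"
proof -
  have "P n \<subset> P (Suc n)" "P (Suc n) \<subseteq> \<mm>"
    using assms prime_subset_max by (auto simp: prime_chain_def)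
  then have "P n \<subset> \<mm>" by blast
  then show ?thesis using assms max_prime by (auto simp: prime_chain_def less_Suc_eq)
qed

lemma max_eq_Idl:
  assumes "\<mm> = Idl A" "A \<subseteq> carrier R" "B \<subseteq> \<mm>" "A \<subseteq> Idl B"
  shows "\<mm> = Idl B"
proof
  have B: "B \<subseteq> carrier R" using assms(3) ideal_subset[OF max_ideal] by blast
  show "\<mm> \<subseteq> Idl B" unfolding assms(1) using genideal_minimal[OF genideal_ideal[OF B] assms(4)] .
  show "Idl B \<subseteq> \<mm>" using genideal_minimal[OF max_ideal assms(3)] .
qed

text \<open>A ring of dimension at least \<open>d\<close> whose maximal ideal has \<open>d\<close> generators is a domain;
  here for \<open>R / J\<close>.\<close>

lemma prime_chain_bottom:
  assumes "ideal J R" "J \<subseteq> \<mm>" "finite V" "V \<subseteq> \<mm>" "card V \<le> d" "\<mm> = Idl (J \<union> V)" "prime_chain R J d P"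
  shows "P 0 = J"
  using assms
proof (induction d arbitrary: J V P)
  case 0
  then have "\<mm> = J" using Idl_ideal by simp
  then show ?case using 0 prime_subset_max[of "P 0"] by (auto simp: prime_chain_def)
next
  case (Suc d)
  have P0: "primeideal (P 0) R" and JP0: "J \<subseteq> P 0" and P01: "P 0 \<subset> P (Suc 0)" and P1: "primeideal (P (Suc 0)) R"
    using Suc.prems(7) by (auto simp: prime_chain_def)
  note P0i = prime_ideal[OF P0]
  \<comment> \<open>If all of \<open>V\<close> lay in \<open>P 0\<close>, then \<open>P 0\<close>
    would contain \<open>\<mm>\<close> and leave no room for \<open>P (Suc 0)\<close>.\<close>
  obtain x where x: "x \<in> V" "x \<notin> P 0"
  proof (rule ccontr)
    assume "\<not> thesis"
    then have "J \<union> V \<subseteq> P 0" using JP0 that by blast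
    then have "\<mm> \<subseteq> P 0" unfolding Suc.prems(6) by (rule genideal_minimal[OF P0i])
    then show False using P01 prime_subset_max[OF P1] by blast
  qed
  have xm: "x \<in> \<mm>" using x Suc.prems(4) by blast
  then have xc: "x \<in> carrier R" by (rule ideal_carr[OF max_ideal])
  have "prime_chain R (P 0) (Suc d) P" using Suc.prems(7) by (auto simp: prime_chain_def)
  from prime_chain_reroute[OF prime_chain_top[OF this], of x] xm
  obtain Q where Q: "prime_chain R (P 0) d Q" "x \<in> Q 0" by auto
  have Q0: "ideal (Q 0) R" using Q(1) prime_ideal by (auto simp: prime_chain_def)
  let ?J = "J <+> PIdl x"
  have J': "ideal ?J R" using add_ideals[OF Suc.prems(1) cgenideal_ideal[OF xc]] .
  have JJ': "J \<subseteq> ?J" using subset_add_left[OF Suc.prems(1) cgenideal_ideal[OF xc]] .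
  have xJ': "x \<in> ?J" using subset_add_right[OF Suc.prems(1) cgenideal_ideal[OF xc]] cgenideal_self[OF xc] by auto
  have J'm: "?J \<subseteq> \<mm>" using add_subset[OF max_ideal Suc.prems(2) cgenideal_minimal[OF max_ideal xm]] .
  have sub: "?J \<union> (V - {x}) \<subseteq> \<mm>" using J'm Suc.prems(4) by auto
  have "J \<union> V \<subseteq> Idl (?J \<union> (V - {x}))"
    using genideal_self[of "?J \<union> (V - {x})"] sub ideal_subset[OF max_ideal] JJ' xJ' by blast
  then have "\<mm> = Idl (?J \<union> (V - {x}))"
    using Suc.prems(2,4) ideal_subset[OF max_ideal] by (intro max_eq_Idl[OF Suc.prems(6) _ sub]) auto
  moreover have "?J \<subseteq> Q 0"
    using Q JP0 by (intro add_subset[OF Q0] cgenideal_minimal[OF Q0]) (auto simp: prime_chain_def)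
  then have "prime_chain R ?J d Q" using Q(1) by (auto simp: prime_chain_def)
  moreover have "card (V - {x}) \<le> d" using Suc.prems(3,5) x(1) by simp
  \<comment> \<open>One generator and one step of the chain have gone together, so the induction
    hypothesis applies over \<open>?J\<close>.\<close>
  ultimately have "Q 0 = ?J" using Suc.IH[OF J' J'm, of "V - {x}" Q] Suc.prems(3,4) by auto
  then have P0J': "P 0 \<subseteq> ?J" using Q(1) by (auto simp: prime_chain_def)
  \<comment> \<open>In \<open>a = j \<oplus> r \<otimes> x\<close> the prime \<open>P 0\<close>
    contains \<open>r \<otimes> x\<close> but not \<open>x\<close>, hence \<open>r\<close>. Thus
    \<open>P 0\<close> equals \<open>J\<close> up to \<open>\<mm> \<cdot> P 0\<close>.\<close>
  have "P 0 \<subseteq> J <+> \<mm> \<cdot> P 0"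
  proof
    fix a assume a: "a \<in> P 0"
    then have "a \<in> ?J" using P0J' by blast
    then obtain j r where j: "j \<in> J" "r \<in> carrier R" "a = j \<oplus> r \<otimes> x"
      unfolding mem_add_principal by blast
    have "j \<in> P 0" using j(1) JP0 by blast
    moreover have "r \<otimes> x \<oplus> j \<in> P 0"
      using a j xc ideal_carr[OF Suc.prems(1) j(1)] a_comm by simp
    ultimately have "r \<otimes> x \<in> P 0" using ideal_diff_cancel[OF P0i] j xc by simp
    then have "r \<in> P 0" using primeideal.I_prime[OF P0 j(2) xc] x(2) by blast
    then have "x \<otimes> r \<in> \<mm> \<cdot> P 0" using xm by (intro ideal_prod.prod)
    then show "a \<in> J <+> \<mm> \<cdot> P 0" using j m_comm[OF j(2) xc] by (auto simp: mem_set_add)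
  qed
  then have "P 0 \<subseteq> J" by (rule nakayama[OF P0i Suc.prems(1)])
  then show ?case using JP0 by blast
qed

text \<open>Modulo \<open>A\<close> there remain \<open>card V - card A\<close> generators and, by
  rerouting, a chain of length \<open>d - card A\<close>; then \<open>prime_chain_bottom\<close>
  makes \<open>Idl A\<close> the bottom prime.\<close>

lemma prime_independent_generators:
  assumes V: "finite V" "V \<subseteq> \<mm>" "card V \<le> d" "\<mm> = Idl V" and ch: "prime_chain R {} d P"
  shows "prime_independent R V"
proof -
  have Vc: "V \<subseteq> carrier R" using V(2) ideal_subset[OF max_ideal] by blast
  have "\<exists>Q. prime_chain R (Idl A) (d - card A) Q" if "finite A" "A \<subseteq> V" for A
    using that
  proof (induction A)
    case empty
    have "\<zero> \<in> P 0" using ch prime_ideal ideal_zero_closed by (auto simp: prime_chain_def)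
    then have "prime_chain R (Idl {}) d P" using ch by (auto simp: prime_chain_def Idl_empty)
    then show ?case by auto
  next
    case (insert x A)
    then obtain Q where Q: "prime_chain R (Idl A) (d - card A) Q" by auto
    have "card (insert x A) \<le> card V" using insert.prems V(1) by (intro card_mono) auto
    then have "Suc (card A) \<le> d" using insert V(3) by simp
    then have d: "d - card A = Suc (d - card (insert x A))" using insert by simp
    have xm: "x \<in> \<mm>" and xc: "x \<in> carrier R" and Ac: "A \<subseteq> carrier R" using insert.prems V(2) Vc by auto
    obtain Q' where Q': "prime_chain R (Idl A) (d - card (insert x A)) Q'" "x \<in> Q' 0"
      using prime_chain_reroute[OF prime_chain_top[OF Q[unfolded d]], of x] xm by auto
    have i: "ideal (Q' 0) R" using Q'(1) prime_ideal by (auto simp: prime_chain_def)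
    have "A \<subseteq> Q' 0" using genideal_self[OF Ac] Q'(1) by (auto simp: prime_chain_def)
    then have "Idl (insert x A) \<subseteq> Q' 0" using Q'(2) by (intro genideal_minimal[OF i]) auto
    then show ?case using Q'(1) by (auto simp: prime_chain_def)
  qed
  note chain = this
  have "primeideal (Idl A) R \<and> (\<forall>x\<in>V - A. x \<notin> Idl A)" if A: "A \<subseteq> V" for A
  proof -
    have Ac: "A \<subseteq> carrier R" "finite A" using A Vc V(1) finite_subset by auto
    have Ai: "ideal (Idl A) R" using genideal_ideal Ac by simp
    have Am: "Idl A \<subseteq> \<mm>" using genideal_minimal[OF max_ideal] A V(2) by auto
    obtain Q where Q: "prime_chain R (Idl A) (d - card A) Q" using chain[OF Ac(2) A] by blast
    have gen: "\<mm> = Idl (Idl A \<union> W)" if W: "V - Idl A \<subseteq> W" "W \<subseteq> V" for W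
    proof (rule max_eq_Idl[OF V(4) Vc])
      have "Idl A \<union> W \<subseteq> carrier R" using W Vc ideal_subset[OF Ai] by blast
      then have "Idl A \<union> W \<subseteq> Idl (Idl A \<union> W)" by (rule genideal_self)
      then show "V \<subseteq> Idl (Idl A \<union> W)" using W(1) by blast
      show "Idl A \<union> W \<subseteq> \<mm>" using W(2) Am V(2) by blast
    qed
    have AV: "card (V - A) = card V - card A" using card_Diff_subset[OF Ac(2) A] .
    have Q0: "Q 0 = Idl A"
    proof (rule prime_chain_bottom[OF Ai Am _ _ _ _ Q])
      show "finite (V - A)" "V - A \<subseteq> \<mm>" "card (V - A) \<le> d - card A" using V AV by auto
      show "\<mm> = Idl (Idl A \<union> (V - A))" using genideal_self[OF Ac(1)] by (intro gen) auto
    qed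
    have "x \<notin> Idl A" if x: "x \<in> V - A" for x
    proof
      assume xA: "x \<in> Idl A"
      have "card A < card V" using x A V(1) by (intro psubset_card_mono) auto
      then obtain e where e: "d - card A = Suc e" using V(3) by (metis Suc_diff_Suc order_less_le_trans)
      have "prime_chain R (Idl A) e (\<lambda>i. Q (Suc i))" using Q unfolding e by (auto simp: prime_chain_def)
      moreover have "card (V - A - {x}) \<le> e" using AV x V(1,3) e by simp
      moreover have "\<mm> = Idl (Idl A \<union> (V - A - {x}))"
        using xA genideal_self[OF Ac(1)] by (intro gen) auto
      ultimately have "Q (Suc 0) = Idl A"
        using V by (intro prime_chain_bottom[OF Ai Am, of "V - A - {x}" e "\<lambda>i. Q (Suc i)"]) auto
      moreover have "Q 0 \<subset> Q (Suc 0)" using Q unfolding e by (auto simp: prime_chain_def)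
      ultimately show False using Q0 by simp
    qed
    moreover have "primeideal (Idl A) R" using Q Q0 unfolding prime_chain_def by (metis le0)
    ultimately show ?thesis by blast
  qed
  then show ?thesis using V(1) Vc by (simp add: prime_independent_def)
qed

end

section \<open>Cancelling a parameter modulo powers of the others\<close>

context cring
begin

lemma mem_Idl_insert:
  assumes "A \<subseteq> carrier R" "x \<in> carrier R"
  shows "a \<in> Idl (insert x A) \<longleftrightarrow> (\<exists>j\<in>Idl A. \<exists>r\<in>carrier R. a = j \<oplus> r \<otimes> x)"
  unfolding Idl_insert[OF assms] mem_add_principal ..

lemma prime_independent_subset:
  assumes "prime_independent R V" "A \<subseteq> V"
  shows "primeideal (Idl A) R" "A \<subseteq> carrier R" "x \<in> V - A \<Longrightarrow> x \<notin> Idl A"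
  using assms unfolding prime_independent_def by auto

text \<open>Modulo \<open>Idl A\<close> the associated graded ring of \<open>Idl B\<close> is a
  polynomial ring over a domain in which \<open>z\<close> is nonzero. The set \<open>A\<close> makes
  the induction on \<open>B\<close> possible: an element \<open>w\<close> of \<open>B\<close> is
  either moved to \<open>A\<close>, where it counts as zero, or factored out, which lowers
  \<open>n\<close>.\<close>

lemma nonzerodivisor_mod_ideal_pow:
  assumes V: "prime_independent R V" and "finite B" "B \<subseteq> V" "A \<subseteq> V" "A \<inter> B = {}"
    and "z \<in> V - A - B" "a \<in> carrier R" "z \<otimes> a \<in> ideal_pow R (Idl B) n <+> Idl A"
  shows "a \<in> ideal_pow R (Idl B) n <+> Idl A"
  using assms(2-)
proof (induction B arbitrary: A z a n)
  case empty
  have Ai: "primeideal (Idl A) R" "z \<notin> Idl A" "ideal (Idl A) R" and zc: "z \<in> carrier R"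
    using prime_independent_subset[OF V] prime_ideal empty.prems V by (auto simp: prime_independent_def)
  have E: "ideal (Idl {}) R" using genideal_ideal by simp
  show ?case
  proof (cases n)
    case 0
    then show ?thesis using subset_add_left[OF oneideal Ai(3)] empty.prems(5) by (auto simp: ideal_pow_0)
  next
    case (Suc k)
    have "ideal_pow R (Idl {}) n \<subseteq> ideal_pow R (Idl {}) (Suc 0)"
      using Suc by (intro ideal_pow_antimono[OF E]) simp
    also have "\<dots> = {\<zero>}" using ideal_pow_1[OF E] by (simp add: Idl_empty)
    finally have "ideal_pow R (Idl {}) n \<subseteq> Idl A" using ideal_zero_closed[OF Ai(3)] by auto
    then have "z \<otimes> a \<in> Idl A" using add_subset[OF Ai(3) _ order_refl] empty.prems(6) by blast
    then have "a \<in> Idl A" using primeideal.I_prime[OF Ai(1) zc empty.prems(5)] Ai(2) by blast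
    then show ?thesis using subset_add_right[OF ideal_pow_ideal[OF E] Ai(3)] by blast
  qed
next
  case (insert w B)
  have Bc: "B \<subseteq> carrier R" and wc: "w \<in> carrier R" and zc: "z \<in> carrier R" and Ac: "A \<subseteq> carrier R"
    using insert.prems V by (auto simp: prime_independent_def)
  have sub: "B \<subseteq> V" "insert w A \<subseteq> V" "insert w A \<inter> B = {}" "z \<in> V - insert w A - B"
    "A \<subseteq> V" "A \<inter> B = {}" "w \<in> V - A - B"
    using insert.prems(1-4) insert.hyps by auto
  have Ai: "ideal (Idl A) R" and Bi: "ideal (Idl B) R" and Awi: "ideal (Idl (insert w A)) R"
    using genideal_ideal Ac Bc wc by auto
  define L where "L = Idl (insert w B)"
  have L: "ideal L R" unfolding L_def using genideal_ideal Bc wc by auto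
  have wL: "w \<in> L" and BL: "Idl B \<subseteq> L"
    unfolding L_def using genideal_self[of "insert w B"] Idl_mono[of "insert w B" B] Bc wc by auto
  have LA: "ideal (ideal_pow R L k <+> Idl A) R" for k using add_ideals[OF ideal_pow_ideal[OF L] Ai] .
  have BA: "ideal (ideal_pow R (Idl B) k <+> Idl A) R" for k using add_ideals[OF ideal_pow_ideal[OF Bi] Ai] .
  have BLA: "ideal_pow R (Idl B) k <+> Idl A \<subseteq> ideal_pow R L k <+> Idl A" for k
    using ideal_pow_mono[OF Bi L BL] by (intro set_add_subset_mono) auto
  have wpow: "w \<otimes> y \<in> ideal_pow R L (Suc k)" if "y \<in> ideal_pow R L k" for y k
    using ideal_prod.prod[OF that wL, of R] m_comm[OF wc ideal_carr[OF ideal_pow_ideal[OF L] that]]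
    by (simp add: ideal_pow_Suc)
  have "a \<in> ideal_pow R L n <+> Idl A" if "a \<in> carrier R" "z \<otimes> a \<in> ideal_pow R L n <+> Idl A" for a n
    using that
  proof (induction n arbitrary: a)
    case 0
    then show ?case using subset_add_left[OF oneideal Ai] by (auto simp: ideal_pow_0)
  next
    case (Suc n)
    note ac = Suc.prems(1)
    have split: "\<exists>y0 \<in> ideal_pow R (Idl B) (Suc n). \<exists>y1 \<in> ideal_pow R L n. y = y0 \<oplus> w \<otimes> y1"
      if "y \<in> ideal_pow R L (Suc n)" for y
      using ideal_pow_add_principal[OF Bi wc] that unfolding L_def Idl_insert[OF Bc wc] by metis
    obtain y a1 where y: "y \<in> ideal_pow R L (Suc n)" "a1 \<in> Idl A" "z \<otimes> a = y \<oplus> a1"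
      using Suc.prems(2) unfolding mem_set_add by blast
    obtain y0 y1 where y01: "y0 \<in> ideal_pow R (Idl B) (Suc n)" "y1 \<in> ideal_pow R L n" "y = y0 \<oplus> w \<otimes> y1"
      using split[OF y(1)] by blast
    have c: "y0 \<in> carrier R" "y1 \<in> carrier R" "a1 \<in> carrier R"
      using ideal_carr[OF ideal_pow_ideal[OF Bi] y01(1)] ideal_carr[OF ideal_pow_ideal[OF L] y01(2)]
        ideal_carr[OF Ai y(2)] .
    have "z \<otimes> a = y0 \<oplus> (a1 \<oplus> y1 \<otimes> w)" unfolding y(3) y01(3) using c wc by algebra
    moreover have "a1 \<oplus> y1 \<otimes> w \<in> Idl (insert w A)" using mem_Idl_insert[OF Ac wc] y(2) c by blast
    ultimately have "z \<otimes> a \<in> ideal_pow R (Idl B) (Suc n) <+> Idl (insert w A)"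
      using y01(1) unfolding mem_set_add by blast
    \<comment> \<open>With \<open>w\<close> moved to \<open>A\<close>, the outer hypothesis cancels
      \<open>z\<close>. It remains to treat the part \<open>r \<otimes> w\<close> of
      \<open>a\<close>.\<close>
    with sub(1-4) ac have "a \<in> ideal_pow R (Idl B) (Suc n) <+> Idl (insert w A)"
      by (rule insert.IH)
    then obtain l m where l: "l \<in> ideal_pow R (Idl B) (Suc n)" "m \<in> Idl (insert w A)" "a = l \<oplus> m"
      unfolding mem_set_add by blast
    obtain a0 r where r: "a0 \<in> Idl A" "r \<in> carrier R" "m = a0 \<oplus> r \<otimes> w"
      using l(2) mem_Idl_insert[OF Ac wc] by blast
    have c': "l \<in> carrier R" "a0 \<in> carrier R"
      using ideal_carr[OF ideal_pow_ideal[OF Bi] l(1)] ideal_carr[OF Ai r(1)] .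
    have lL: "l \<in> ideal_pow R L (Suc n)" using ideal_pow_mono[OF Bi L BL] l(1) by blast
    have la: "l \<oplus> a0 \<in> ideal_pow R L (Suc n) <+> Idl A" using lL r(1) unfolding mem_set_add by blast
    have "z \<otimes> (w \<otimes> r) = z \<otimes> a \<ominus> z \<otimes> (l \<oplus> a0)" unfolding l(3) r(3) using c' r(2) zc wc by algebra
    then have "z \<otimes> (w \<otimes> r) \<in> ideal_pow R L (Suc n) <+> Idl A"
      using ideal_minus_closed[OF LA Suc.prems(2) ideal_lmult[OF LA zc la]] by simp
    then obtain t b1 where t: "t \<in> ideal_pow R L (Suc n)" "b1 \<in> Idl A" "z \<otimes> (w \<otimes> r) = t \<oplus> b1"
      unfolding mem_set_add by blast
    obtain t0 t1 where t01: "t0 \<in> ideal_pow R (Idl B) (Suc n)" "t1 \<in> ideal_pow R L n" "t = t0 \<oplus> w \<otimes> t1"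
      using split[OF t(1)] by blast
    have c'': "t0 \<in> carrier R" "t1 \<in> carrier R" "b1 \<in> carrier R"
      using ideal_carr[OF ideal_pow_ideal[OF Bi] t01(1)] ideal_carr[OF ideal_pow_ideal[OF L] t01(2)]
        ideal_carr[OF Ai t(2)] .
    have "w \<otimes> (z \<otimes> r \<ominus> t1) = z \<otimes> (w \<otimes> r) \<ominus> w \<otimes> t1" using c'' r(2) zc wc by algebra
    also have "\<dots> = t0 \<oplus> b1" unfolding t(3) t01(3) using c'' r(2) zc wc by algebra
    finally have "w \<otimes> (z \<otimes> r \<ominus> t1) \<in> ideal_pow R (Idl B) (Suc n) <+> Idl A"
      using t01(1) t(2) unfolding mem_set_add by blast
    moreover have "z \<otimes> r \<ominus> t1 \<in> carrier R" using c'' r(2) zc by simp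
    \<comment> \<open>Now \<open>w\<close> plays the role of \<open>z\<close>, modulo a power of
      \<open>Idl B\<close> in which it does not occur.\<close>
    ultimately have "z \<otimes> r \<ominus> t1 \<in> ideal_pow R (Idl B) (Suc n) <+> Idl A"
      using insert.IH[OF sub(1,5,6,7)] by blast
    then have "z \<otimes> r \<ominus> t1 \<in> ideal_pow R L (Suc n) <+> Idl A" using BLA by blast
    moreover have "ideal_pow R L (Suc n) <+> Idl A \<subseteq> ideal_pow R L n <+> Idl A"
      using ideal_pow_antimono[OF L] by (intro set_add_subset_mono) auto
    ultimately have "z \<otimes> r \<ominus> t1 \<in> ideal_pow R L n <+> Idl A" by blast
    moreover have "t1 \<in> ideal_pow R L n <+> Idl A"
      using t01(2) subset_add_left[OF ideal_pow_ideal[OF L] Ai] by blast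
    ultimately have "(z \<otimes> r \<ominus> t1) \<oplus> t1 \<in> ideal_pow R L n <+> Idl A" by (rule ideal_add_closed[OF LA])
    moreover have "(z \<otimes> r \<ominus> t1) \<oplus> t1 = z \<otimes> r" using c'' r(2) zc by algebra
    \<comment> \<open>The inner hypothesis gives one degree less for \<open>r\<close>, which the
      factor \<open>w\<close> of \<open>r \<otimes> w\<close> restores.\<close>
    ultimately have "r \<in> ideal_pow R L n <+> Idl A" using Suc.IH[OF r(2)] by simp
    then obtain u a2 where u: "u \<in> ideal_pow R L n" "a2 \<in> Idl A" "r = u \<oplus> a2"
      unfolding mem_set_add by blast
    have c3: "u \<in> carrier R" "a2 \<in> carrier R"
      using ideal_carr[OF ideal_pow_ideal[OF L] u(1)] ideal_carr[OF Ai u(2)] .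
    have "a = (l \<oplus> a0) \<oplus> (w \<otimes> u \<oplus> w \<otimes> a2)" unfolding l(3) r(3) u(3) using c' c3 wc by algebra
    moreover have "w \<otimes> u \<oplus> w \<otimes> a2 \<in> ideal_pow R L (Suc n) <+> Idl A"
      using wpow[OF u(1)] ideal_lmult[OF Ai wc u(2)] unfolding mem_set_add by blast
    ultimately show ?case using ideal_add_closed[OF LA la] by simp
  qed
  then show ?case using insert.prems unfolding L_def by blast
qed

end

section \<open>Leading forms with respect to the maximal ideal\<close>

context noetherian_local
begin

text \<open>Here \<open>H\<close> is a colength one subideal of \<open>\<mm>\<close> above \<open>J + \<mm>\<^sup>2\<close>.\<close>

lemma adapted_generators:
  assumes J: "ideal J R" "J \<subseteq> \<mm>" "J \<noteq> \<mm>"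
    and V: "finite V" "V \<subseteq> \<mm>" "\<mm> = Idl V"
  obtains H y B where "ideal H R" "J \<subseteq> H" "finite B" "B \<subseteq> \<mm>" "y \<in> \<mm>" "y \<notin> B"
    "card (insert y B) \<le> card V" "\<mm> = Idl (insert y B)" "H \<subseteq> Idl B <+> \<mm> \<cdot> \<mm>"
proof -
  note mi = max_ideal
  have mm: "ideal (\<mm> \<cdot> \<mm>) R" using ideal_prod_is_ideal[OF mi mi] .
  have Jm: "ideal (J <+> \<mm> \<cdot> \<mm>) R" using add_ideals[OF J(1) mm] .
  have mm_sub: "\<mm> \<cdot> \<mm> \<subseteq> \<mm>" using ideal_prod_inter[OF mi mi] by blast
  define C where "C = {H. ideal H R \<and> J <+> \<mm> \<cdot> \<mm> \<subseteq> H \<and> H \<subseteq> \<mm> \<and> H \<noteq> \<mm>}"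
  have "J <+> \<mm> \<cdot> \<mm> \<noteq> \<mm>" using nakayama[OF mi J(1)] J(2,3) by blast
  moreover have "J <+> \<mm> \<cdot> \<mm> \<subseteq> \<mm>" using add_subset[OF mi J(2) mm_sub] .
  ultimately have "C \<noteq> {}" using Jm by (auto simp: C_def)
  moreover have "ideal K R" if "K \<in> C" for K using that by (simp add: C_def)
  ultimately obtain H where HC: "H \<in> C" and maxC: "\<And>K. K \<in> C \<Longrightarrow> H \<subseteq> K \<Longrightarrow> K = H"
    by (rule ideal_family_maximal) (assumption | rule that)+
  have H: "ideal H R" "J <+> \<mm> \<cdot> \<mm> \<subseteq> H" "H \<subseteq> \<mm>" "H \<noteq> \<mm>" using HC by (auto simp: C_def)
  have JH: "J \<subseteq> H" using H(2) subset_add_left[OF J(1) mm] by blast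
  have "\<not> V \<subseteq> H" using genideal_minimal[OF H(1), of V] V(3) H(3,4) by blast
  then obtain y where y: "y \<in> V" "y \<notin> H" by blast
  have ym: "y \<in> \<mm>" using y V by blast
  have yc: "y \<in> carrier R" using ideal_carr[OF mi ym] .
  have "H <+> PIdl y = \<mm>"
  proof (rule ccontr)
    assume "H <+> PIdl y \<noteq> \<mm>"
    moreover have "ideal (H <+> PIdl y) R" using add_ideals[OF H(1) cgenideal_ideal[OF yc]] .
    moreover have s: "H \<subseteq> H <+> PIdl y" using subset_add_left[OF H(1) cgenideal_ideal[OF yc]] .
    moreover have "H <+> PIdl y \<subseteq> \<mm>" using add_subset[OF mi H(3) cgenideal_minimal[OF mi ym]] .
    ultimately have "H <+> PIdl y = H" using H(2) by (intro maxC) (auto simp: C_def)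
    then show False
      using y(2) subset_add_right[OF H(1) cgenideal_ideal[OF yc]] cgenideal_self[OF yc] by blast
  qed
  then have "\<exists>h\<in>H. \<exists>r\<in>carrier R. a = h \<oplus> r \<otimes> y" if "a \<in> \<mm>" for a
    using that unfolding mem_add_principal[symmetric] by simp
  \<comment> \<open>Subtracting multiples of \<open>y\<close> moves the other generators of
    \<open>\<mm>\<close> into \<open>H\<close>.\<close>
  then have "\<forall>a\<in>V. \<exists>h. h \<in> H \<and> (\<exists>r\<in>carrier R. a = h \<oplus> r \<otimes> y)" using V(2) by blast
  then obtain h where h: "\<And>a. a \<in> V \<Longrightarrow> h a \<in> H \<and> (\<exists>r\<in>carrier R. a = h a \<oplus> r \<otimes> y)"
    using bchoice[of V "\<lambda>a h. h \<in> H \<and> (\<exists>r\<in>carrier R. a = h \<oplus> r \<otimes> y)"] by blast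
  define B where "B = h ` (V - {y})"
  have BH: "B \<subseteq> H" unfolding B_def using h by auto
  have Bm: "B \<subseteq> \<mm>" using BH H(3) by blast
  have Bc: "B \<subseteq> carrier R" using Bm ideal_subset[OF mi] by blast
  have Bi: "ideal (Idl B) R" using genideal_ideal[OF Bc] .
  have Bf: "finite B" unfolding B_def using V(1) by simp
  \<comment> \<open>\<open>h\<close> may identify generators, so only an inequality of cardinalities
    results.\<close>
  have "card B \<le> card (V - {y})" unfolding B_def using V(1) by (intro card_image_le) simp
  then have card: "card (insert y B) \<le> card V"
    using y(1) V(1) Bf card_Suc_Diff1[OF V(1) y(1)] card_insert_le_m1 by (simp add: card_insert_if)
  have yB: "y \<notin> B" using BH y(2) by blast
  have gen: "\<mm> = Idl (insert y B)"
  proof (rule max_eq_Idl[OF V(3)])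
    show "V \<subseteq> carrier R" using V(2) ideal_subset[OF mi] by blast
    show "insert y B \<subseteq> \<mm>" using Bm ym by blast
    show "V \<subseteq> Idl (insert y B)"
    proof
      fix a assume a: "a \<in> V"
      show "a \<in> Idl (insert y B)"
      proof (cases "a = y")
        case True
        then show ?thesis using genideal_self[of "insert y B"] Bc yc by auto
      next
        case False
        then have "h a \<in> Idl B" using genideal_self[OF Bc] a by (auto simp: B_def)
        then show ?thesis using h[OF a] mem_Idl_insert[OF Bc yc] by blast
      qed
    qed
  qed
  have "H \<subseteq> Idl B <+> \<mm> \<cdot> \<mm>"
  proof
    fix a assume a: "a \<in> H"
    then obtain b r where b: "b \<in> Idl B" "r \<in> carrier R" "a = b \<oplus> r \<otimes> y"
      using H(3) gen mem_Idl_insert[OF Bc yc] by blast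
    have bH: "b \<in> H" using genideal_minimal[OF H(1) BH] b(1) by blast
    have bc: "b \<in> carrier R" using ideal_carr[OF H(1) bH] .
    have "r \<otimes> y \<oplus> b \<in> H" using a b bc yc a_comm by simp
    then have ry: "r \<otimes> y \<in> H" using ideal_diff_cancel[OF H(1) _ bH] b yc by simp
    \<comment> \<open>A unit \<open>r\<close> would bring \<open>y\<close> into
      \<open>H\<close>.\<close>
    have "r \<in> \<mm>" using mem_of_unit_multiple[OF H(1) yc _ ry] b(2) y(2) by blast
    then have "r \<otimes> y \<in> \<mm> \<cdot> \<mm>" using ym by (rule ideal_prod.prod)
    then show "a \<in> Idl B <+> \<mm> \<cdot> \<mm>" using b unfolding mem_set_add by blast
  qed
  then show ?thesis using that[OF H(1) JH Bf Bm ym yB card gen] by blast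
qed

text \<open>Each factor from \<open>\<mm> \<cdot> \<mm>\<close> instead of \<open>L\<close> raises
  the order by at least one, so forms of degree \<open>k\<close> come from the power of
  \<open>L\<close> alone.\<close>

lemma ideal_pow_add_square:
  assumes L: "ideal L R" "L \<subseteq> \<mm>"
  shows "ideal_pow R (L <+> \<mm> \<cdot> \<mm>) k \<subseteq> ideal_pow R L k <+> ideal_pow R \<mm> (Suc k)"
proof (induction k)
  case 0
  then show ?case using subset_add_left[OF oneideal ideal_pow_ideal[OF max_ideal]] by (simp add: ideal_pow_0)
next
  case (Suc k)
  note mi = max_ideal
  let ?T = "ideal_pow R L (Suc k) <+> ideal_pow R \<mm> (Suc (Suc k))"
  have T: "ideal ?T R" using add_ideals[OF ideal_pow_ideal[OF L(1)] ideal_pow_ideal[OF mi]] .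
  show ?case unfolding ideal_pow_Suc[of _ k]
  proof (rule ideal_prod_minimal[OF T[unfolded ideal_pow_Suc[of _ k]]])
    fix a b assume a: "a \<in> ideal_pow R (L <+> \<mm> \<cdot> \<mm>) k" and b: "b \<in> L <+> \<mm> \<cdot> \<mm>"
    obtain a0 a1 where a01: "a0 \<in> ideal_pow R L k" "a1 \<in> ideal_pow R \<mm> (Suc k)" "a = a0 \<oplus> a1"
      using subsetD[OF Suc a] unfolding mem_set_add by blast
    obtain b0 b1 where b01: "b0 \<in> L" "b1 \<in> \<mm> \<cdot> \<mm>" "b = b0 \<oplus> b1"
      using b unfolding mem_set_add by blast
    have b1: "b1 \<in> ideal_pow R \<mm> 2"
      using b01(2) ideal_pow_1[OF mi] by (simp add: numeral_2_eq_2 ideal_pow_Suc[of _ "Suc 0"])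
    have a0: "a0 \<in> ideal_pow R \<mm> k" using a01(1) ideal_pow_mono[OF L(1) mi L(2)] by blast
    have b0: "b0 \<in> \<mm>" using b01 L(2) by blast
    have bm: "b \<in> \<mm>"
      unfolding b01(3) using ideal_add_closed[OF mi b0] ideal_prod_inter[OF mi mi] b01(2) by blast
    have c: "a0 \<in> carrier R" "a1 \<in> carrier R" "b0 \<in> carrier R" "b1 \<in> carrier R" "b \<in> carrier R"
      using ideal_carr[OF ideal_pow_ideal[OF mi] a0] ideal_carr[OF ideal_pow_ideal[OF mi] a01(2)]
        ideal_carr[OF mi b0] ideal_carr[OF ideal_pow_ideal[OF mi] b1] ideal_carr[OF mi bm] .
    have "a \<otimes> b = a0 \<otimes> b0 \<oplus> (a0 \<otimes> b1 \<oplus> a1 \<otimes> b)"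
      using c unfolding a01(3) b01(3) by algebra
    moreover have "a0 \<otimes> b0 \<in> ideal_pow R L (Suc k)"
      unfolding ideal_pow_Suc using a01(1) b01(1) by (rule ideal_prod.prod)
    moreover have "a0 \<otimes> b1 \<in> ideal_pow R \<mm> (Suc (Suc k))"
      using ideal_pow_mult[OF mi a0 b1] by simp
    moreover have "a1 \<otimes> b \<in> ideal_pow R \<mm> (Suc (Suc k))"
      unfolding ideal_pow_Suc[of _ "Suc k"] using a01(2) bm by (rule ideal_prod.prod)
    ultimately show "a \<otimes> b \<in> ideal_pow R L k \<cdot> L <+> ideal_pow R \<mm> (Suc (Suc k))"
      using ideal_add_closed[OF ideal_pow_ideal[OF mi]] unfolding mem_set_add ideal_pow_Suc[of _ k] by blast
  qed
qed

text \<open>If \<open>g\<close> is killed by \<open>\<mm>\<close> in the associated graded ring of \<open>J\<close>, compare leading forms in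
  the associated graded ring of \<open>\<mm>\<close>: the forms coming from \<open>J\<close> miss the variable \<open>y\<close>, whereas
  \<open>y g\<close> does not, so \<open>g\<close> has order above \<open>k\<close>.\<close>

theorem nilpotent_if_killed_by_max:
  assumes V: "finite V" "V \<subseteq> \<mm>" "card V \<le> d" "\<mm> = Idl V" and ch: "prime_chain R {} d P"
    and J: "ideal J R" "J \<subseteq> \<mm>" "J \<noteq> \<mm>"
    and g: "g \<in> ideal_pow R J k" and kill: "\<And>a. a \<in> \<mm> \<Longrightarrow> a \<otimes> g \<in> ideal_pow R J (Suc k)"
  shows "g [^] (k + 2) \<in> ideal_pow R J (k * (k + 2) + 1)"
proof -
  note mi = max_ideal
  obtain H y B where H: "ideal H R" "J \<subseteq> H" and B: "finite B" "B \<subseteq> \<mm>" and y: "y \<in> \<mm>" "y \<notin> B"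
    and card: "card (insert y B) \<le> card V" and gen: "\<mm> = Idl (insert y B)"
    and HB: "H \<subseteq> Idl B <+> \<mm> \<cdot> \<mm>"
    by (rule adapted_generators[OF J V(1,2,4)])
  have ind: "prime_independent R (insert y B)"
    using prime_independent_generators[OF _ _ _ gen ch] B y card V(3) by auto
  have Bc: "B \<subseteq> carrier R" using B ideal_subset[OF mi] by blast
  have yc: "y \<in> carrier R" using ideal_carr[OF mi y(1)] .
  define L where "L = Idl B"
  have L: "ideal L R" "L \<subseteq> \<mm>"
    unfolding L_def using genideal_ideal[OF Bc] genideal_minimal[OF mi B(2)] by auto
  have mL: "\<mm> = L <+> PIdl y" unfolding L_def gen Idl_insert[OF Bc yc] ..
  have Hpow: "ideal_pow R J i \<subseteq> ideal_pow R L i <+> ideal_pow R \<mm> (Suc i)" for i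
    using ideal_pow_mono[OF J(1) H(1,2)] ideal_pow_add_square[OF L]
      ideal_pow_mono[OF H(1) add_ideals[OF L(1) ideal_prod_is_ideal[OF mi mi]] HB[folded L_def]] by blast
  have msplit: "\<exists>z0 \<in> ideal_pow R L (Suc i). \<exists>z1 \<in> ideal_pow R \<mm> i. z = z0 \<oplus> y \<otimes> z1"
    if "z \<in> ideal_pow R \<mm> (Suc i)" for z i
    using ideal_pow_add_principal[OF L(1) yc] that unfolding mL by metis
  have Lm: "ideal_pow R L i \<subseteq> ideal_pow R \<mm> i" for i using ideal_pow_mono[OF L(1) mi L(2)] .
  have mid: "ideal (ideal_pow R \<mm> i) R" for i using ideal_pow_ideal[OF mi] .
  have Lid: "ideal (ideal_pow R L i) R" for i using ideal_pow_ideal[OF L(1)] .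
  have ym: "y \<otimes> z \<in> ideal_pow R \<mm> (Suc i)" if "z \<in> ideal_pow R \<mm> i" for z i
    using ideal_prod.prod[OF that y(1), of R] m_comm[OF yc ideal_carr[OF mid that]] by (simp add: ideal_pow_Suc)
  \<comment> \<open>\<open>g0\<close> represents the form of degree \<open>k\<close> of
    \<open>g\<close> and is free of \<open>y\<close>; \<open>c\<close> below does the same for
    \<open>y \<otimes> g\<close> in degree \<open>k + 1\<close>.\<close>
  obtain g0 q where g0: "g0 \<in> ideal_pow R L k" "q \<in> ideal_pow R \<mm> (Suc k)" "g = g0 \<oplus> q"
    using subsetD[OF Hpow g] unfolding mem_set_add by blast
  obtain c z where c: "c \<in> ideal_pow R L (Suc k)" "z \<in> ideal_pow R \<mm> (Suc (Suc k))" "y \<otimes> g = c \<oplus> z"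
    using subsetD[OF Hpow kill[OF y(1)]] unfolding mem_set_add by blast
  have cc: "g0 \<in> carrier R" "q \<in> carrier R" "c \<in> carrier R" "z \<in> carrier R"
    using ideal_carr[OF Lid g0(1)] ideal_carr[OF mid g0(2)] ideal_carr[OF Lid c(1)] ideal_carr[OF mid c(2)] .
  have "z \<ominus> y \<otimes> q \<in> ideal_pow R \<mm> (Suc (Suc k))"
    using ideal_minus_closed[OF mid c(2) ym[OF g0(2)]] .
  \<comment> \<open>Dividing by \<open>y\<close> twice isolates
    \<open>y \<otimes> (y \<otimes> z3)\<close>. Once it is moved to the left, everything on the
    right lies in a power of \<open>L\<close>, modulo which \<open>y\<close> can be
    cancelled.\<close>
  then obtain z0 z1 where z: "z0 \<in> ideal_pow R L (Suc (Suc k))" "z1 \<in> ideal_pow R \<mm> (Suc k)"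
    "z \<ominus> y \<otimes> q = z0 \<oplus> y \<otimes> z1" using msplit by blast
  obtain z2 z3 where z': "z2 \<in> ideal_pow R L (Suc k)" "z3 \<in> ideal_pow R \<mm> k" "z1 = z2 \<oplus> y \<otimes> z3"
    using msplit[OF z(2)] by blast
  have zc: "z0 \<in> carrier R" "z1 \<in> carrier R" "z2 \<in> carrier R" "z3 \<in> carrier R"
    using ideal_carr[OF Lid z(1)] ideal_carr[OF mid z(2)] ideal_carr[OF Lid z'(1)] ideal_carr[OF mid z'(2)] .
  have "y \<otimes> (g0 \<ominus> y \<otimes> z3) = y \<otimes> g \<ominus> y \<otimes> q \<ominus> y \<otimes> (y \<otimes> z3)"
    unfolding g0(3) using cc zc yc by algebra
  also have "\<dots> = c \<oplus> (z \<ominus> y \<otimes> q) \<ominus> y \<otimes> (y \<otimes> z3)" unfolding c(3) using cc zc yc by algebra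
  also have "\<dots> = c \<oplus> (z0 \<oplus> y \<otimes> z2)" unfolding z(3) z'(3) using cc zc yc by algebra
  finally have eq: "y \<otimes> (g0 \<ominus> y \<otimes> z3) = c \<oplus> (z0 \<oplus> y \<otimes> z2)" .
  have "z0 \<in> ideal_pow R L (Suc k)" using z(1) ideal_pow_antimono[OF L(1), of "Suc k" "Suc (Suc k)"] by auto
  then have "c \<oplus> (z0 \<oplus> y \<otimes> z2) \<in> ideal_pow R L (Suc k)"
    using ideal_add_closed[OF Lid c(1) ideal_add_closed[OF Lid _ ideal_lmult[OF Lid yc z'(1)]]] by blast
  then have "y \<otimes> (g0 \<ominus> y \<otimes> z3) \<in> ideal_pow R L (Suc k)" unfolding eq .
  then have mem: "y \<otimes> (g0 \<ominus> y \<otimes> z3) \<in> ideal_pow R (Idl B) (Suc k) <+> Idl {}"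
    unfolding L_def by (rule subsetD[OF subset_add_left[OF Lid[unfolded L_def] genideal_ideal[OF empty_subsetI]]])
  have "g0 \<ominus> y \<otimes> z3 \<in> carrier R" using cc zc yc by simp
  then have "g0 \<ominus> y \<otimes> z3 \<in> ideal_pow R (Idl B) (Suc k) <+> Idl {}"
    using y(2) by (intro nonzerodivisor_mod_ideal_pow[OF ind B(1) _ _ _ _ _ mem]) auto
  also have "\<dots> \<subseteq> ideal_pow R L (Suc k)"
    unfolding L_def[symmetric] Idl_empty using ideal_zero_closed[OF Lid] by (intro add_subset Lid) auto
  finally have "g0 \<ominus> y \<otimes> z3 \<in> ideal_pow R \<mm> (Suc k)" using Lm by blast
  then have "(g0 \<ominus> y \<otimes> z3) \<oplus> (y \<otimes> z3 \<oplus> q) \<in> ideal_pow R \<mm> (Suc k)"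
    using ideal_add_closed[OF mid _ ideal_add_closed[OF mid ym[OF z'(2)] g0(2)]] by blast
  moreover have "(g0 \<ominus> y \<otimes> z3) \<oplus> (y \<otimes> z3 \<oplus> q) = g" unfolding g0(3) using cc zc yc by algebra
  ultimately have gm: "g \<in> ideal_pow R \<mm> (Suc k)" by simp
  have gc: "g \<in> carrier R" using ideal_carr[OF mid gm] .
  \<comment> \<open>Each of \<open>i\<close> factors from \<open>\<mm>\<close> lifts one
    \<open>g\<close> from degree \<open>k\<close> to \<open>k + 1\<close>. The order of
    \<open>g\<close> just found allows \<open>z = g\<close> with \<open>i = Suc k\<close>, and
    \<open>(k + 1)^2 = k (k + 2) + 1\<close> explains the exponent \<open>k + 2\<close>.\<close>
  have "z \<otimes> g [^] i \<in> ideal_pow R J (Suc k * i)" if "z \<in> ideal_pow R \<mm> i" for z i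
    using that
  proof (induction i arbitrary: z)
    case 0
    then show ?case by (simp add: ideal_pow_0 nat_pow_0)
  next
    case (Suc i)
    have "ideal_pow R \<mm> (Suc i) \<subseteq> {z \<in> carrier R. z \<otimes> g [^] Suc i \<in> ideal_pow R J (Suc k * Suc i)}"
      unfolding ideal_pow_Suc[of _ i]
    proof (rule ideal_prod_minimal)
      show "ideal {z \<in> carrier R. z \<otimes> g [^] Suc i \<in> ideal_pow R J (Suc k * Suc i)} R"
        using gc by (intro colon_ideal ideal_pow_ideal J(1)) simp
      fix a b assume a: "a \<in> ideal_pow R \<mm> i" and b: "b \<in> \<mm>"
      have c: "a \<in> carrier R" "b \<in> carrier R" using ideal_carr[OF mid a] ideal_carr[OF mi b] .
      have "(a \<otimes> b) \<otimes> g [^] Suc i = (a \<otimes> g [^] i) \<otimes> (b \<otimes> g)" using c gc by (simp add: nat_pow_Suc m_ac)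
      also have "\<dots> \<in> ideal_pow R J (Suc k * i + Suc k)"
        using ideal_pow_mult[OF J(1) Suc.IH[OF a] kill[OF b]] .
      finally show "a \<otimes> b \<in> {z \<in> carrier R. z \<otimes> g [^] Suc i \<in> ideal_pow R J (Suc k * Suc i)}"
        using c by (simp add: add.commute)
    qed
    then show ?case using Suc.prems by blast
  qed
  from this[OF gm] have "g \<otimes> g [^] Suc k \<in> ideal_pow R J (Suc k * Suc k)" .
  moreover have "g \<otimes> g [^] Suc k = g [^] (k + 2)" using gc by (simp add: nat_pow_Suc m_comm)
  moreover have "Suc k * Suc k = k * (k + 2) + 1" by simp
  ultimately show ?thesis by metis
qed

end

section \<open>Localization\<close>

text \<open>For an ideal \<open>J\<close> this is \<open>J R\<^sub>S\<close>: fractions with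
  numerator in \<open>J\<close> already form an ideal, and membership can be tested on numerators,
  unlike in the generated ideal of \<open>loc_contraction\<close>.\<close>

definition loc_ext :: "('a, 'b) ring_scheme \<Rightarrow> 'a set \<Rightarrow> 'a set \<Rightarrow> ('a \<times> 'a) set set" where
  "loc_ext R S J = {loc_frac R S a s |a s. a \<in> J \<and> s \<in> S}"

text \<open>The operations of \<open>localization\<close> are unions over all representatives; a
  value independent of them collapses the union.\<close>

lemma UN_UN_pair_const:
  assumes "\<And>a s b t. (a, s) \<in> A \<Longrightarrow> (b, t) \<in> B \<Longrightarrow> F a s b t = C" "A \<noteq> {}" "B \<noteq> {}"
  shows "(\<Union>(a, s)\<in>A. \<Union>(b, t)\<in>B. F a s b t) = C"
proof -
  have "(case q of (b, t) \<Rightarrow> F a s b t) = C" if "(a, s) \<in> A" "q \<in> B" for a s q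
    using assms(1)[OF that(1)] that(2) by (cases q) simp
  then have "(\<Union>(b, t)\<in>B. F a s b t) = C" if "(a, s) \<in> A" for a s
    using that assms(3) by simp
  then have "(case p of (a, s) \<Rightarrow> \<Union>(b, t)\<in>B. F a s b t) = C" if "p \<in> A" for p
    using that by (cases p) simp
  then show ?thesis using assms(2) by simp
qed

locale multiplicative_subset = cring +
  fixes S
  assumes S_subset: "S \<subseteq> carrier R" and S_one: "\<one> \<in> S"
    and S_mult: "s \<in> S \<Longrightarrow> t \<in> S \<Longrightarrow> s \<otimes> t \<in> S"
begin

abbreviation L where "L \<equiv> localization R S"
abbreviation frac where "frac \<equiv> loc_frac R S"

lemma S_carrier [simp]: "s \<in> S \<Longrightarrow> s \<in> carrier R"
  using S_subset by blast

lemma loc_rel_iff: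
  "((a, s), (b, t)) \<in> loc_rel R S \<longleftrightarrow> a \<in> carrier R \<and> s \<in> S \<and> b \<in> carrier R \<and> t \<in> S \<and>
     (\<exists>u\<in>S. u \<otimes> (t \<otimes> a) = u \<otimes> (s \<otimes> b))"
proof -
  have "u \<otimes> (t \<otimes> a \<ominus> s \<otimes> b) = \<zero> \<longleftrightarrow> u \<otimes> (t \<otimes> a) = u \<otimes> (s \<otimes> b)"
    if "a \<in> carrier R" "s \<in> S" "b \<in> carrier R" "t \<in> S" "u \<in> S" for u
  proof -
    have "u \<otimes> (t \<otimes> a \<ominus> s \<otimes> b) = u \<otimes> (t \<otimes> a) \<ominus> u \<otimes> (s \<otimes> b)"
      using that by (simp add: a_minus_def r_distr r_minus)
    then show ?thesis using that by (simp add: r_right_minus_eq)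
  qed
  then show ?thesis unfolding loc_rel_def by auto
qed

lemma equiv_loc_rel: "equiv (carrier R \<times> S) (loc_rel R S)"
proof (rule equivI)
  show "loc_rel R S \<subseteq> (carrier R \<times> S) \<times> (carrier R \<times> S)" by (auto simp: loc_rel_def)
  show "refl_on (carrier R \<times> S) (loc_rel R S)"
    using S_one by (auto simp: refl_on_def loc_rel_iff)
  show "sym (loc_rel R S)" unfolding sym_def by (auto simp: loc_rel_iff) metis
  show "trans (loc_rel R S)" unfolding trans_def
  proof (clarify)
    fix a s b t c r
    assume "((a, s), (b, t)) \<in> loc_rel R S" "((b, t), (c, r)) \<in> loc_rel R S"
    then obtain u v where *: "a \<in> carrier R" "s \<in> S" "b \<in> carrier R" "t \<in> S" "c \<in> carrier R" "r \<in> S"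
      "u \<in> S" "v \<in> S" "u \<otimes> (t \<otimes> a) = u \<otimes> (s \<otimes> b)" "v \<otimes> (r \<otimes> b) = v \<otimes> (t \<otimes> c)"
      by (auto simp: loc_rel_iff)
    have "(u \<otimes> v \<otimes> t) \<otimes> (r \<otimes> a) = (v \<otimes> r) \<otimes> (u \<otimes> (t \<otimes> a))" using *(1-8) by (simp add: m_ac)
    also have "\<dots> = (u \<otimes> s) \<otimes> (v \<otimes> (r \<otimes> b))" unfolding *(9) using *(1-8) by (simp add: m_ac)
    also have "\<dots> = (u \<otimes> v \<otimes> t) \<otimes> (s \<otimes> c)" unfolding *(10) using *(1-8) by (simp add: m_ac)
    finally have "(u \<otimes> v \<otimes> t) \<otimes> (r \<otimes> a) = (u \<otimes> v \<otimes> t) \<otimes> (s \<otimes> c)" .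
    moreover have "u \<otimes> v \<otimes> t \<in> S" using * S_mult by simp
    ultimately show "((a, s), (c, r)) \<in> loc_rel R S" using * by (auto simp: loc_rel_iff)
  qed
qed

lemma frac_eq_iff:
  assumes "a \<in> carrier R" "s \<in> S" "b \<in> carrier R" "t \<in> S"
  shows "frac a s = frac b t \<longleftrightarrow> (\<exists>u\<in>S. u \<otimes> (t \<otimes> a) = u \<otimes> (s \<otimes> b))"
proof -
  have "frac a s = frac b t \<longleftrightarrow> ((a, s), (b, t)) \<in> loc_rel R S"
    unfolding loc_frac_def using assms by (intro eq_equiv_class_iff[OF equiv_loc_rel]) auto
  then show ?thesis using assms by (simp add: loc_rel_iff)
qed

lemma frac_eqI:
  assumes "a \<in> carrier R" "s \<in> S" "b \<in> carrier R" "t \<in> S" "t \<otimes> a = s \<otimes> b"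
  shows "frac a s = frac b t"
  using assms S_one by (auto simp: frac_eq_iff)

lemma carrier_L: "carrier L = {frac a s |a s. a \<in> carrier R \<and> s \<in> S}"
  unfolding localization_def loc_frac_def quotient_def by auto

lemma frac_carrier: "a \<in> carrier R \<Longrightarrow> s \<in> S \<Longrightarrow> frac a s \<in> carrier L"
  by (auto simp: carrier_L)

lemma one_L: "\<one>\<^bsub>L\<^esub> = frac \<one> \<one>" and zero_L: "\<zero>\<^bsub>L\<^esub> = frac \<zero> \<one>"
  by (simp_all add: localization_def)

lemma mem_frac:
  assumes "(b, t) \<in> frac a s" "a \<in> carrier R" "s \<in> S"
  shows "b \<in> carrier R" "t \<in> S" "\<exists>u\<in>S. u \<otimes> (t \<otimes> a) = u \<otimes> (s \<otimes> b)"
  using assms unfolding loc_frac_def Image_singleton_iff loc_rel_iff by auto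

lemma frac_self: "a \<in> carrier R \<Longrightarrow> s \<in> S \<Longrightarrow> (a, s) \<in> frac a s"
  unfolding loc_frac_def using S_one by (auto simp: loc_rel_iff)

lemma frac_mult:
  assumes a: "a \<in> carrier R" "s \<in> S" and b: "b \<in> carrier R" "t \<in> S"
  shows "frac a s \<otimes>\<^bsub>L\<^esub> frac b t = frac (a \<otimes> b) (s \<otimes> t)"
proof -
  have "frac (a' \<otimes> b') (s' \<otimes> t') = frac (a \<otimes> b) (s \<otimes> t)"
    if "(a', s') \<in> frac a s" "(b', t') \<in> frac b t" for a' s' b' t'
  proof -
    note A = mem_frac[OF that(1) a] and B = mem_frac[OF that(2) b]
    obtain u v where u: "u \<in> S" "u \<otimes> (s' \<otimes> a) = u \<otimes> (s \<otimes> a')"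
      and v: "v \<in> S" "v \<otimes> (t' \<otimes> b) = v \<otimes> (t \<otimes> b')" using A(3) B(3) by auto
    have "(u \<otimes> v) \<otimes> ((s \<otimes> t) \<otimes> (a' \<otimes> b')) = (u \<otimes> (s \<otimes> a')) \<otimes> (v \<otimes> (t \<otimes> b'))"
      using A B a b u v by (simp add: m_ac)
    also have "\<dots> = (u \<otimes> v) \<otimes> ((s' \<otimes> t') \<otimes> (a \<otimes> b))"
      unfolding u(2)[symmetric] v(2)[symmetric] using A B a b u(1) v(1) by (simp add: m_ac)
    finally show ?thesis using A B a b S_mult u(1) v(1) by (subst frac_eq_iff) auto
  qed
  note well_defined = this
  have "frac a s \<otimes>\<^bsub>L\<^esub> frac b t =
      (\<Union>(a', s')\<in>frac a s. \<Union>(b', t')\<in>frac b t. frac (a' \<otimes> b') (s' \<otimes> t'))"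
    by (simp add: localization_def)
  also have "\<dots> = frac (a \<otimes> b) (s \<otimes> t)"
    using frac_self[OF a] frac_self[OF b] by (intro UN_UN_pair_const well_defined) blast+
  finally show ?thesis .
qed

lemma frac_add:
  assumes a: "a \<in> carrier R" "s \<in> S" and b: "b \<in> carrier R" "t \<in> S"
  shows "frac a s \<oplus>\<^bsub>L\<^esub> frac b t = frac (a \<otimes> t \<oplus> b \<otimes> s) (s \<otimes> t)"
proof -
  have "frac (a' \<otimes> t' \<oplus> b' \<otimes> s') (s' \<otimes> t') = frac (a \<otimes> t \<oplus> b \<otimes> s) (s \<otimes> t)"
    if "(a', s') \<in> frac a s" "(b', t') \<in> frac b t" for a' s' b' t'
  proof -
    note A = mem_frac[OF that(1) a] and B = mem_frac[OF that(2) b]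
    obtain u v where u: "u \<in> S" "u \<otimes> (s' \<otimes> a) = u \<otimes> (s \<otimes> a')"
      and v: "v \<in> S" "v \<otimes> (t' \<otimes> b) = v \<otimes> (t \<otimes> b')" using A(3) B(3) by auto
    have "(u \<otimes> v) \<otimes> ((s \<otimes> t) \<otimes> (a' \<otimes> t' \<oplus> b' \<otimes> s'))
        = (u \<otimes> (s \<otimes> a')) \<otimes> (v \<otimes> (t \<otimes> t')) \<oplus> (v \<otimes> (t \<otimes> b')) \<otimes> (u \<otimes> (s \<otimes> s'))"
      using A B a b u v by (simp add: m_ac r_distr l_distr)
    also have "\<dots> = (u \<otimes> v) \<otimes> ((s' \<otimes> t') \<otimes> (a \<otimes> t \<oplus> b \<otimes> s))"
      unfolding u(2)[symmetric] v(2)[symmetric] using A B a b u(1) v(1)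
      by (simp add: m_ac r_distr l_distr)
    finally show ?thesis using A B a b S_mult u(1) v(1) by (subst frac_eq_iff) auto
  qed
  note well_defined = this
  have "frac a s \<oplus>\<^bsub>L\<^esub> frac b t =
      (\<Union>(a', s')\<in>frac a s. \<Union>(b', t')\<in>frac b t. frac (a' \<otimes> t' \<oplus> b' \<otimes> s') (s' \<otimes> t'))"
    by (simp add: localization_def)
  also have "\<dots> = frac (a \<otimes> t \<oplus> b \<otimes> s) (s \<otimes> t)"
    using frac_self[OF a] frac_self[OF b] by (intro UN_UN_pair_const well_defined) blast+
  finally show ?thesis .
qed

lemma L_cases:
  assumes "x \<in> carrier L" obtains a s where "a \<in> carrier R" "s \<in> S" "x = frac a s"
  using assms by (auto simp: carrier_L)

lemma cring_L: "cring L"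
proof (rule cringI)
  show "abelian_group L"
  proof (rule abelian_groupI)
    fix x y assume "x \<in> carrier L" "y \<in> carrier L"
    then show "x \<oplus>\<^bsub>L\<^esub> y \<in> carrier L"
      by (elim L_cases) (auto simp: frac_add intro!: frac_carrier S_mult)
  next
    show "\<zero>\<^bsub>L\<^esub> \<in> carrier L" using S_one by (simp add: zero_L frac_carrier)
  next
    fix x y z assume "x \<in> carrier L" "y \<in> carrier L" "z \<in> carrier L"
    then show "x \<oplus>\<^bsub>L\<^esub> y \<oplus>\<^bsub>L\<^esub> z = x \<oplus>\<^bsub>L\<^esub> (y \<oplus>\<^bsub>L\<^esub> z)"
      by (elim L_cases) (auto simp: frac_add S_mult l_distr r_distr m_ac a_ac)
  next
    fix x y assume "x \<in> carrier L" "y \<in> carrier L"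
    then show "x \<oplus>\<^bsub>L\<^esub> y = y \<oplus>\<^bsub>L\<^esub> x"
      by (elim L_cases) (auto simp: frac_add S_mult m_ac a_ac)
  next
    fix x assume "x \<in> carrier L"
    then show "\<zero>\<^bsub>L\<^esub> \<oplus>\<^bsub>L\<^esub> x = x"
      by (elim L_cases) (auto simp: zero_L frac_add S_one)
  next
    fix x assume "x \<in> carrier L"
    then obtain a s where a: "a \<in> carrier R" "s \<in> S" "x = frac a s" by (elim L_cases)
    have "frac (\<ominus> a) s \<oplus>\<^bsub>L\<^esub> x = frac (\<ominus> a \<otimes> s \<oplus> a \<otimes> s) (s \<otimes> s)" using a by (simp add: frac_add)
    also have "\<ominus> a \<otimes> s \<oplus> a \<otimes> s = \<zero>" using a by (simp add: l_minus l_neg)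
    also have "frac \<zero> (s \<otimes> s) = \<zero>\<^bsub>L\<^esub>" unfolding zero_L using a S_one S_mult by (intro frac_eqI) auto
    finally show "\<exists>y\<in>carrier L. y \<oplus>\<^bsub>L\<^esub> x = \<zero>\<^bsub>L\<^esub>" using a frac_carrier[of "\<ominus> a" s] by auto
  qed
  show "comm_monoid L"
  proof (rule comm_monoidI)
    fix x y assume "x \<in> carrier L" "y \<in> carrier L"
    then show "x \<otimes>\<^bsub>L\<^esub> y \<in> carrier L"
      by (elim L_cases) (auto simp: frac_mult intro!: frac_carrier S_mult)
  next
    show "\<one>\<^bsub>L\<^esub> \<in> carrier L" using S_one by (simp add: one_L frac_carrier)
  next
    fix x y z assume "x \<in> carrier L" "y \<in> carrier L" "z \<in> carrier L"
    then show "x \<otimes>\<^bsub>L\<^esub> y \<otimes>\<^bsub>L\<^esub> z = x \<otimes>\<^bsub>L\<^esub> (y \<otimes>\<^bsub>L\<^esub> z)"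
      by (elim L_cases) (auto simp: frac_mult S_mult m_ac)
  next
    fix x assume "x \<in> carrier L"
    then show "\<one>\<^bsub>L\<^esub> \<otimes>\<^bsub>L\<^esub> x = x" by (elim L_cases) (auto simp: one_L frac_mult S_one)
  next
    fix x y assume "x \<in> carrier L" "y \<in> carrier L"
    then show "x \<otimes>\<^bsub>L\<^esub> y = y \<otimes>\<^bsub>L\<^esub> x"
      by (elim L_cases) (auto simp: frac_mult m_ac)
  qed
  fix x y z assume "x \<in> carrier L" "y \<in> carrier L" "z \<in> carrier L"
  then obtain a s b t c r where *: "a \<in> carrier R" "s \<in> S" "x = frac a s" "b \<in> carrier R" "t \<in> S"
    "y = frac b t" "c \<in> carrier R" "r \<in> S" "z = frac c r" by (metis L_cases)
  have "(x \<oplus>\<^bsub>L\<^esub> y) \<otimes>\<^bsub>L\<^esub> z = frac ((a \<otimes> t \<oplus> b \<otimes> s) \<otimes> c) (s \<otimes> t \<otimes> r)"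
    using * by (simp add: frac_add frac_mult S_mult)
  also have "\<dots> = frac (a \<otimes> c \<otimes> (t \<otimes> r) \<oplus> b \<otimes> c \<otimes> (s \<otimes> r)) (s \<otimes> r \<otimes> (t \<otimes> r))"
    using * S_mult by (intro frac_eqI) (auto simp: l_distr r_distr m_ac)
  also have "\<dots> = x \<otimes>\<^bsub>L\<^esub> z \<oplus>\<^bsub>L\<^esub> y \<otimes>\<^bsub>L\<^esub> z" using * by (simp add: frac_add frac_mult S_mult)
  finally show "(x \<oplus>\<^bsub>L\<^esub> y) \<otimes>\<^bsub>L\<^esub> z = x \<otimes>\<^bsub>L\<^esub> z \<oplus>\<^bsub>L\<^esub> y \<otimes>\<^bsub>L\<^esub> z" .
qed

sublocale L: cring L
  by (rule cring_L)

lemma loc_extI: "a \<in> J \<Longrightarrow> s \<in> S \<Longrightarrow> frac a s \<in> loc_ext R S J"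
  by (auto simp: loc_ext_def)

lemma loc_extE:
  assumes "x \<in> loc_ext R S J" obtains a s where "a \<in> J" "s \<in> S" "x = frac a s"
  using assms by (auto simp: loc_ext_def)

lemma loc_ext_ideal:
  assumes J: "ideal J R" shows "ideal (loc_ext R S J) L"
proof (rule idealI[OF L.ring_axioms])
  show "subgroup (loc_ext R S J) (add_monoid L)"
  proof (rule group.subgroupI)
    show "Group.group (add_monoid L)" by (rule L.a_group)
    show "loc_ext R S J \<subseteq> carrier (add_monoid L)"
      using frac_carrier ideal_carr[OF J] by (auto simp: loc_ext_def)
    show "loc_ext R S J \<noteq> {}" using ideal_zero_closed[OF J] S_one by (auto simp: loc_ext_def)
  next
    fix x assume "x \<in> loc_ext R S J"
    then obtain a s where a: "a \<in> J" "s \<in> S" "x = frac a s" by (rule loc_extE)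
    have ac: "a \<in> carrier R" using ideal_carr[OF J a(1)] .
    have "frac (\<ominus> a) s \<oplus>\<^bsub>L\<^esub> x = frac (\<ominus> a \<otimes> s \<oplus> a \<otimes> s) (s \<otimes> s)" using a ac by (simp add: frac_add)
    also have "\<ominus> a \<otimes> s \<oplus> a \<otimes> s = \<zero>" using a ac by (simp add: l_minus l_neg)
    also have "frac \<zero> (s \<otimes> s) = \<zero>\<^bsub>L\<^esub>" unfolding zero_L using a S_one S_mult by (intro frac_eqI) auto
    finally have "\<ominus>\<^bsub>L\<^esub> x = frac (\<ominus> a) s" using a ac by (intro L.minus_equality) (auto intro: frac_carrier)
    then have "\<ominus>\<^bsub>L\<^esub> x \<in> loc_ext R S J"
      using a(2) ideal_uminus_closed[OF J a(1)] by (auto simp: loc_ext_def)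
    then show "inv\<^bsub>add_monoid L\<^esub> x \<in> loc_ext R S J" by (simp only: a_inv_def)
  next
    fix x y assume "x \<in> loc_ext R S J" "y \<in> loc_ext R S J"
    then obtain a s b t where a: "a \<in> J" "s \<in> S" "x = frac a s" and b: "b \<in> J" "t \<in> S" "y = frac b t"
      by (elim loc_extE)
    have "x \<oplus>\<^bsub>L\<^esub> y = frac (a \<otimes> t \<oplus> b \<otimes> s) (s \<otimes> t)"
      using a b ideal_carr[OF J a(1)] ideal_carr[OF J b(1)] by (simp add: frac_add)
    moreover have "a \<otimes> t \<oplus> b \<otimes> s \<in> J"
      using a b by (intro ideal_add_closed[OF J] ideal_rmult[OF J _ a(1)] ideal_rmult[OF J _ b(1)]) auto
    ultimately show "x \<otimes>\<^bsub>add_monoid L\<^esub> y \<in> loc_ext R S J"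
      using loc_extI[OF _ S_mult[OF a(2) b(2)]] by simp
  qed
next
  fix x y assume "x \<in> loc_ext R S J" and y: "y \<in> carrier L"
  then obtain a s b t where a: "a \<in> J" "s \<in> S" "x = frac a s" and b: "b \<in> carrier R" "t \<in> S" "y = frac b t"
    by (elim loc_extE L_cases)
  have ac: "a \<in> carrier R" using ideal_carr[OF J a(1)] .
  have "y \<otimes>\<^bsub>L\<^esub> x = frac (b \<otimes> a) (t \<otimes> s)" using a b ac by (simp add: frac_mult)
  then show "y \<otimes>\<^bsub>L\<^esub> x \<in> loc_ext R S J"
    using loc_extI[OF ideal_lmult[OF J b(1) a(1)] S_mult[OF b(2) a(2)]] by simp
  then show "x \<otimes>\<^bsub>L\<^esub> y \<in> loc_ext R S J" using L.m_comm y a ac by (metis frac_carrier)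
qed

lemma frac_mem_loc_ext_iff:
  assumes J: "ideal J R" and a: "a \<in> carrier R" "s \<in> S"
  shows "frac a s \<in> loc_ext R S J \<longleftrightarrow> (\<exists>u\<in>S. u \<otimes> a \<in> J)"
proof
  assume "frac a s \<in> loc_ext R S J"
  then obtain b t where b: "b \<in> J" "t \<in> S" "frac a s = frac b t" by (rule loc_extE)
  have bc: "b \<in> carrier R" using ideal_carr[OF J b(1)] .
  obtain u where u: "u \<in> S" "u \<otimes> (t \<otimes> a) = u \<otimes> (s \<otimes> b)" using b bc a frac_eq_iff by auto
  have "(u \<otimes> t) \<otimes> a = (u \<otimes> s) \<otimes> b" using u a b bc by (simp add: m_assoc)
  also have "\<dots> \<in> J" using ideal_lmult[OF J _ b(1)] u a by simp
  finally show "\<exists>u\<in>S. u \<otimes> a \<in> J" using S_mult[OF u(1) b(2)] by blast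
next
  assume "\<exists>u\<in>S. u \<otimes> a \<in> J"
  then obtain u where u: "u \<in> S" "u \<otimes> a \<in> J" by blast
  have "frac a s = frac (u \<otimes> a) (u \<otimes> s)" using u a S_mult by (intro frac_eqI) (auto simp: m_ac)
  then show "frac a s \<in> loc_ext R S J" using loc_extI[OF u(2) S_mult[OF u(1) a(2)]] by simp
qed

lemma frac_pow: "a \<in> carrier R \<Longrightarrow> frac a \<one> [^]\<^bsub>L\<^esub> (n::nat) = frac (a [^] n) \<one>"
proof (induction n)
  case 0
  then show ?case by (simp add: nat_pow_0 one_L L.nat_pow_0)
next
  case (Suc n)
  then show ?case using S_one by (simp add: nat_pow_Suc L.nat_pow_Suc frac_mult)
qed

lemma loc_ext_pow:
  assumes I: "ideal I R"
  shows "ideal_pow L (loc_ext R S I) n = loc_ext R S (ideal_pow R I n)"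
proof (induction n)
  case 0
  show ?case unfolding ideal_pow_0 L.ideal_pow_0 carrier_L loc_ext_def by auto
next
  case (Suc n)
  have In: "ideal (ideal_pow R I k) R" for k using ideal_pow_ideal[OF I] .
  have eI: "ideal (loc_ext R S I) L" using loc_ext_ideal[OF I] .
  have "loc_ext R S (ideal_pow R I n) \<cdot>\<^bsub>L\<^esub> loc_ext R S I \<subseteq> loc_ext R S (ideal_pow R I (Suc n))"
  proof (rule L.ideal_prod_minimal[OF loc_ext_ideal[OF In]])
    fix x y assume "x \<in> loc_ext R S (ideal_pow R I n)" "y \<in> loc_ext R S I"
    then obtain a s b t where a: "a \<in> ideal_pow R I n" "s \<in> S" "x = frac a s"
      and b: "b \<in> I" "t \<in> S" "y = frac b t" by (elim loc_extE)
    have "x \<otimes>\<^bsub>L\<^esub> y = frac (a \<otimes> b) (s \<otimes> t)"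
      using a b ideal_carr[OF In a(1)] ideal_carr[OF I b(1)] by (simp add: frac_mult)
    moreover have "a \<otimes> b \<in> ideal_pow R I (Suc n)" unfolding ideal_pow_Suc using a(1) b(1) by (rule ideal_prod.prod)
    ultimately show "x \<otimes>\<^bsub>L\<^esub> y \<in> loc_ext R S (ideal_pow R I (Suc n))"
      using loc_extI[OF _ S_mult[OF a(2) b(2)]] by simp
  qed
  moreover have "loc_ext R S (ideal_pow R I (Suc n)) \<subseteq> loc_ext R S (ideal_pow R I n) \<cdot>\<^bsub>L\<^esub> loc_ext R S I"
    (is "_ \<subseteq> ?K")
  proof
    have K: "ideal ?K L" using L.ideal_prod_is_ideal[OF loc_ext_ideal[OF In] eI] .
    fix x assume "x \<in> loc_ext R S (ideal_pow R I (Suc n))"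
    then obtain a s where a: "a \<in> ideal_pow R I n \<cdot> I" "s \<in> S" "x = frac a s"
      unfolding ideal_pow_Suc by (rule loc_extE)
    have "a \<in> carrier R \<and> frac a s \<in> ?K" using a(1)
    proof induction
      case (prod a b)
      have c: "a \<in> carrier R" "b \<in> carrier R" using ideal_carr[OF In prod(1)] ideal_carr[OF I prod(2)] .
      have "frac (a \<otimes> b) s = frac a s \<otimes>\<^bsub>L\<^esub> frac b \<one>" using c a(2) S_one by (simp add: frac_mult)
      moreover have "\<dots> \<in> ?K"
        using prod a(2) S_one by (intro ideal_prod.prod loc_extI)
      ultimately show ?case using c by simp
    next
      case (sum a b)
      have "frac a s \<oplus>\<^bsub>L\<^esub> frac b s = frac (a \<oplus> b) s"
        using sum a(2) S_mult by (simp add: frac_add) (intro frac_eqI, auto simp: l_distr r_distr m_ac)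
      then show ?case using sum L.ideal_add_closed[OF K, of "frac a s" "frac b s"] by simp
    qed
    then show "x \<in> ?K" using a(3) by simp
  qed
  ultimately show ?case unfolding L.ideal_pow_Suc Suc by blast
qed

lemma mem_loc_contractionD:
  assumes J: "ideal J R" and r: "r \<in> loc_contraction R S J"
  shows "r \<in> carrier R" "\<exists>u\<in>S. u \<otimes> r \<in> J"
proof -
  show rc: "r \<in> carrier R" using r by (simp add: loc_contraction_def)
  have "(\<lambda>a. frac a \<one>) ` J \<subseteq> loc_ext R S J" using S_one by (auto simp: loc_ext_def)
  then have "Idl\<^bsub>L\<^esub> ((\<lambda>a. frac a \<one>) ` J) \<subseteq> loc_ext R S J" by (rule L.genideal_minimal[OF loc_ext_ideal[OF J]])
  then have "frac r \<one> \<in> loc_ext R S J" using r by (auto simp: loc_contraction_def)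
  then show "\<exists>u\<in>S. u \<otimes> r \<in> J" using frac_mem_loc_ext_iff[OF J rc S_one] by simp
qed

lemma subset_loc_contraction:
  assumes J: "ideal J R" shows "J \<subseteq> loc_contraction R S J"
proof
  fix r assume r: "r \<in> J"
  have "(\<lambda>a. frac a \<one>) ` J \<subseteq> carrier L" using frac_carrier ideal_carr[OF J] S_one by auto
  then have "(\<lambda>a. frac a \<one>) ` J \<subseteq> Idl\<^bsub>L\<^esub> ((\<lambda>a. frac a \<one>) ` J)" by (rule L.genideal_self)
  then show "r \<in> loc_contraction R S J" using r ideal_carr[OF J r] by (auto simp: loc_contraction_def)
qed

end

lemma (in cring) multiplicative_subset_compl_primes:
  assumes "\<And>P. P \<in> \<P> \<Longrightarrow> primeideal P R"
  shows "multiplicative_subset R (carrier R - \<Union>\<P>)"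
proof (intro multiplicative_subset.intro multiplicative_subset_axioms.intro is_cring)
  show "\<one> \<in> carrier R - \<Union>\<P>" using one_notin_prime[OF assms] by auto
next
  fix s t assume "s \<in> carrier R - \<Union>\<P>" "t \<in> carrier R - \<Union>\<P>"
  then have st: "s \<in> carrier R" "t \<in> carrier R" "\<And>P. P \<in> \<P> \<Longrightarrow> s \<notin> P \<and> t \<notin> P" by auto
  then have "s \<otimes> t \<notin> P" if "P \<in> \<P>" for P
    using prime_compl_mult[OF assms[OF that], of s t] that by auto
  then show "s \<otimes> t \<in> carrier R - \<Union>\<P>" using st by auto
qed simp

lemma (in cring) multiplicative_subset_compl_prime:
  "primeideal P R \<Longrightarrow> multiplicative_subset R (carrier R - P)"
  using multiplicative_subset_compl_primes[of "{P}"] by simp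

text \<open>Identifies the maximal ideal that \<open>regular_ring\<close> leaves unnamed. A fraction
  outside it has its numerator outside \<open>P\<close> and so can be inverted.\<close>

lemma (in cring) loc_ext_prime_maximal:
  assumes P: "primeideal P R"
  shows "maximalideal (loc_ext R (carrier R - P) P) (localization R (carrier R - P))"
proof -
  interpret multiplicative_subset R "carrier R - P" by (rule multiplicative_subset_compl_prime[OF P])
  let ?M = "loc_ext R (carrier R - P) P"
  note Pi = prime_ideal[OF P]
  show ?thesis
  proof (rule maximalidealI[OF loc_ext_ideal[OF Pi]])
    have "frac \<one> \<one> \<notin> ?M"
      using frac_mem_loc_ext_iff[OF Pi one_closed S_one] by auto
    then show "carrier L \<noteq> ?M" using one_L L.one_closed by auto
  next
    fix K assume K: "ideal K L" "?M \<subseteq> K" "K \<subseteq> carrier L"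
    show "K = ?M \<or> K = carrier L"
    proof (cases "K = ?M")
      case False
      then obtain x where x: "x \<in> K" "x \<notin> ?M" using K(2) by blast
      then have "x \<in> carrier L" using K(3) by blast
      then obtain a s where a: "a \<in> carrier R" "s \<in> carrier R - P" "x = frac a s" by (rule L_cases)
      have "a \<notin> P" using loc_extI[OF _ a(2)] x(2) a(3) by blast
      then have aP: "a \<in> carrier R - P" using a(1) by blast
      have sc: "s \<in> carrier R" using a(2) by blast
      have "frac s a \<otimes>\<^bsub>L\<^esub> x = frac (s \<otimes> a) (a \<otimes> s)"
        unfolding a(3) by (rule frac_mult[OF sc aP a(1,2)])
      also have "\<dots> = \<one>\<^bsub>L\<^esub>" unfolding one_L
        using a(1) sc by (intro frac_eqI S_mult[OF aP a(2)] S_one) (simp_all add: m_comm)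
      finally have "\<one>\<^bsub>L\<^esub> \<in> K" using L.ideal_lmult[OF K(1) frac_carrier[OF sc aP] x(1)] by simp
      then show ?thesis using ideal.one_imp_carrier[OF K(1)] by simp
    qed simp
  qed
qed

section \<open>Frobenius splittings\<close>

context noetherian_cring
begin

text \<open>\<open>finetely_gen\<close> supplies arbitrary generators, whereas in the graded case a
  finite set has to be found among homogeneous ones.\<close>

lemma finite_subset_of_generators:
  assumes A: "A \<subseteq> carrier R"
  obtains B where "B \<subseteq> A" "finite B" "Idl B = Idl A"
proof -
  define C where "C = {Idl B |B. B \<subseteq> A \<and> finite B}"
  have "Idl {} \<in> C" unfolding C_def by blast
  then have "C \<noteq> {}" by blast
  moreover have "ideal K R" if "K \<in> C" for K using that A genideal_ideal by (auto simp: C_def)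
  ultimately obtain M where MC: "M \<in> C" and maxC: "\<And>K. K \<in> C \<Longrightarrow> M \<subseteq> K \<Longrightarrow> K = M"
    by (rule ideal_family_maximal) (assumption | rule that)+
  then obtain B where B: "B \<subseteq> A" "finite B" "M = Idl B" by (auto simp: C_def)
  have "a \<in> Idl B" if a: "a \<in> A" for a
  proof -
    have s: "insert a B \<subseteq> carrier R" using a A B(1) by blast
    have "Idl (insert a B) \<in> C" unfolding C_def using B(1,2) a by blast
    moreover have "M \<subseteq> Idl (insert a B)" unfolding B(3) using Idl_mono[OF s] by blast
    ultimately have "Idl (insert a B) = Idl B" using maxC B(3) by simp
    then show ?thesis using genideal_self[OF s] by auto
  qed
  then have "Idl A \<subseteq> Idl B" using B(1) A by (intro genideal_minimal genideal_ideal) auto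
  then show ?thesis using that B Idl_mono[OF A B(1)] by auto
qed

lemma min_num_gens_witness:
  assumes "A \<subseteq> H" "H \<subseteq> carrier R" "I = Idl A"
  obtains B where "B \<subseteq> H" "finite B" "card B = min_num_gens R H I" "I = Idl B"
proof -
  have A: "A \<subseteq> carrier R" using assms by blast
  obtain B where "B \<subseteq> A" "finite B" "Idl B = Idl A" using finite_subset_of_generators[OF A] .
  then have "\<exists>n. \<exists>B. B \<subseteq> H \<and> finite B \<and> card B = n \<and> I = Idl B" using assms by blast
  then have "\<exists>B. B \<subseteq> H \<and> finite B \<and> card B = min_num_gens R H I \<and> I = Idl B"
    unfolding min_num_gens_def by (rule LeastI_ex)
  then show ?thesis using that by blast
qed

end

section \<open>Repeated factors in powers of an ideal\<close>

context cring
begin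

text \<open>Some \<open>a \<in> A\<close> occurs at least \<open>p\<close> times in a product of \<open>p + m\<close> elements of \<open>A\<close>.\<close>

lemma ideal_pow_pigeonhole:
  assumes A: "finite A" "A \<subseteq> carrier R" and K: "ideal K R"
    and big: "card A * (p - 1) < p + m"
    and fac: "\<And>a w. a \<in> A \<Longrightarrow> w \<in> ideal_pow R (Idl A) m \<Longrightarrow> a [^] p \<otimes> w \<in> K"
  shows "ideal_pow R (Idl A) (p + m) \<subseteq> K"
proof -
  define I where "I = Idl A"
  have I: "ideal I R" unfolding I_def using genideal_ideal[OF A(2)] .
  have AI: "A \<subseteq> I" unfolding I_def using genideal_self[OF A(2)] .
  \<comment> \<open>\<open>B\<close> holds the generators still under consideration.
    \<open>w\<close> gathers \<open>c\<close> factors already set aside and \<open>z\<close> the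
    other \<open>t\<close>, too many for each element of \<open>B\<close> to occur at most
    \<open>p - 1\<close> times.\<close>
  have "w \<otimes> z \<in> K" if "finite B" "B \<subseteq> A" "w \<in> ideal_pow R I c" "z \<in> ideal_pow R (Idl B) t"
    "c + t = p + m" "card B * (p - 1) < t" for B w c z t
    using that
  proof (induction B arbitrary: w c z t)
    case empty
    have E: "ideal (Idl {}) R" using genideal_ideal by simp
    have "ideal_pow R (Idl {}) t \<subseteq> ideal_pow R (Idl {}) (Suc 0)"
      using empty by (intro ideal_pow_antimono[OF E]) simp
    also have "\<dots> = {\<zero>}" using ideal_pow_1[OF E] by (simp add: Idl_empty)
    finally have "z = \<zero>" using empty by blast
    then show ?case using ideal_zero_closed[OF K] ideal_carr[OF ideal_pow_ideal[OF I] empty(2)] by simp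
  next
    case (insert a B)
    have Bc: "B \<subseteq> carrier R" and ac: "a \<in> carrier R" and aI: "a \<in> I" and aA: "a \<in> A" and BA: "B \<subseteq> A"
      using insert.prems(1) A(2) AI by auto
    have Bi: "ideal (Idl B) R" using genideal_ideal[OF Bc] .
    define L where "L = Idl (insert a B)"
    have Leq: "L = Idl B <+> PIdl a" unfolding L_def using Idl_insert[OF Bc ac] .
    have L: "ideal L R" unfolding L_def using genideal_ideal[of "insert a B"] Bc ac by simp
    have LI: "L \<subseteq> I" unfolding L_def using genideal_minimal[OF I, of "insert a B"] insert.prems(1) AI by blast
    have apow: "a [^] i \<in> ideal_pow R I i" for i :: nat
      using nat_pow_mem_ideal_pow[OF I, of a "Suc 0" i] aI ideal_pow_1[OF I] by simp
    \<comment> \<open>\<open>i\<close> copies of \<open>a\<close> have been taken out. At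
      \<open>i = p\<close> the assumption \<open>fac\<close> applies; for smaller \<open>i\<close>
      the part of \<open>z\<close> without \<open>a\<close> still has more than
      \<open>card B * (p - 1)\<close> factors.\<close>
    have "a [^] i \<otimes> (w \<otimes> z) \<in> K" if "i \<le> p" "w \<in> ideal_pow R I c" "z \<in> ideal_pow R L t"
      "i + c + t = p + m" "Suc (card B) * (p - 1) < t + i" for i w c z t
      using that
    proof (induction i arbitrary: z t rule: inc_induct)
      case base
      have "z \<in> ideal_pow R I t" using base.prems(2) ideal_pow_mono[OF L I LI] by blast
      from ideal_pow_mult[OF I base.prems(1) this] have "w \<otimes> z \<in> ideal_pow R I m"
        using base.prems(3) by simp
      then show ?case using fac[OF aA] unfolding I_def by blast
    next
      case (step i)
      have "p - 1 \<le> Suc (card B) * (p - 1)" by simp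
      then have "t \<noteq> 0" using step.prems(4) step.hyps by linarith
      then obtain k where t: "t = Suc k" using not0_implies_Suc by blast
      obtain z0 z1 where z: "z0 \<in> ideal_pow R (Idl B) (Suc k)" "z1 \<in> ideal_pow R L k" "z = z0 \<oplus> a \<otimes> z1"
        using ideal_pow_add_principal[OF Bi ac] step.prems(2) unfolding t Leq by metis
      have c: "z0 \<in> carrier R" "z1 \<in> carrier R" "w \<in> carrier R"
        using ideal_carr[OF ideal_pow_ideal[OF Bi] z(1)] ideal_carr[OF ideal_pow_ideal[OF L] z(2)]
          ideal_carr[OF ideal_pow_ideal[OF I] step.prems(1)] .
      have "a [^] Suc i \<otimes> (w \<otimes> z1) \<in> K"
        using step.prems(1,3,4) z(2) t by (intro step.IH[of z1 k]) auto
      moreover have "(a [^] i \<otimes> w) \<otimes> z0 \<in> K"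
      proof (rule insert.IH[OF BA ideal_pow_mult[OF I apow step.prems(1)] z(1)])
        show "i + c + Suc k = p + m" using step.prems(3) t by simp
        show "card B * (p - 1) < Suc k" using step.prems(4) step.hyps t by simp
      qed
      moreover have "a [^] i \<otimes> (w \<otimes> z) = (a [^] i \<otimes> w) \<otimes> z0 \<oplus> a [^] Suc i \<otimes> (w \<otimes> z1)"
        unfolding z(3) nat_pow_Suc using c ac by (simp add: r_distr m_ac)
      ultimately show ?case using ideal_add_closed[OF K] by simp
    qed
    from this[of 0 w c z t] show ?case
      using insert.prems insert.hyps ideal_carr[OF ideal_pow_ideal[OF I] insert.prems(2)]
        ideal_carr[OF ideal_pow_ideal[OF L]] by (simp add: nat_pow_0 L_def)
  qed
  note claim = this
  have "z \<in> K" if z: "z \<in> ideal_pow R I (p + m)" for z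
  proof -
    have "\<one> \<otimes> z \<in> K"
      using claim[OF A(1) order_refl, of \<one> 0 z "p + m"] z big by (simp add: ideal_pow_0 I_def)
    then show ?thesis using ideal_carr[OF ideal_pow_ideal[OF I] z] by simp
  qed
  then show ?thesis unfolding I_def by blast
qed

end

text \<open>A splitting \<open>\<phi>\<close> of \<open>R \<subseteq> R\<^sup>1\<^sup>/\<^sup>p\<close>, viewed as the map \<open>\<psi> f = \<phi> (f\<^sup>1\<^sup>/\<^sup>p)\<close> on \<open>R\<close>.\<close>

locale frobenius_splitting = cring +
  fixes p :: nat and \<psi>
  assumes p_gt1: "1 < p"
    and split_closed: "f \<in> carrier R \<Longrightarrow> \<psi> f \<in> carrier R"
    and split_add: "f \<in> carrier R \<Longrightarrow> g \<in> carrier R \<Longrightarrow> \<psi> (f \<oplus> g) = \<psi> f \<oplus> \<psi> g"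
    and split_smult: "r \<in> carrier R \<Longrightarrow> f \<in> carrier R \<Longrightarrow> \<psi> (r [^] p \<otimes> f) = r \<otimes> \<psi> f"
    and split_power: "r \<in> carrier R \<Longrightarrow> \<psi> (r [^] p) = r"
begin

lemma split_zero: "\<psi> \<zero> = \<zero>"
  using split_smult[of \<zero> \<zero>] split_closed[of \<zero>] by simp

lemma split_uminus:
  assumes "f \<in> carrier R" shows "\<psi> (\<ominus> f) = \<ominus> \<psi> f"
proof -
  have "\<psi> (\<ominus> f) \<oplus> \<psi> f = \<zero>" using split_add[of "\<ominus> f" f] assms by (simp add: l_neg split_zero)
  then show ?thesis using assms split_closed by (metis minus_equality a_inv_closed)
qed

text \<open>The preimage of \<open>J\<close> under \<open>\<psi>\<close> need not be an ideal, since
  only \<open>p\<close>-th powers can be pulled out. This is the largest ideal inside it, as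
  required by \<open>ideal_pow_pigeonhole\<close>.\<close>

lemma split_colon_ideal:
  assumes J: "ideal J R"
  shows "ideal {z \<in> carrier R. \<forall>r\<in>carrier R. \<psi> (r \<otimes> z) \<in> J} R" (is "ideal ?K R")
proof (rule idealI[OF ring_axioms])
  show "subgroup ?K (add_monoid R)"
  proof (rule group.subgroupI)
    show "Group.group (add_monoid R)" by (rule a_group)
    show "?K \<subseteq> carrier (add_monoid R)" by auto
    have "\<zero> \<in> ?K" using ideal_zero_closed[OF J] by (simp add: split_zero)
    then show "?K \<noteq> {}" by blast
  next
    fix a assume a: "a \<in> ?K"
    then have "\<ominus> a \<in> ?K" using ideal_uminus_closed[OF J] by (simp add: r_minus split_uminus)
    then show "inv\<^bsub>add_monoid R\<^esub> a \<in> ?K" by (simp only: a_inv_def)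
  next
    fix a b assume "a \<in> ?K" "b \<in> ?K"
    then show "a \<otimes>\<^bsub>add_monoid R\<^esub> b \<in> ?K" using ideal_add_closed[OF J] by (simp add: r_distr split_add)
  qed
next
  fix a x assume a: "a \<in> ?K" and x: "x \<in> carrier R"
  have "\<psi> (r \<otimes> (x \<otimes> a)) \<in> J" if "r \<in> carrier R" for r
  proof -
    have "r \<otimes> (x \<otimes> a) = (r \<otimes> x) \<otimes> a" using a x that by (simp add: m_assoc)
    then show ?thesis using a x that by simp
  qed
  then show "x \<otimes> a \<in> ?K" using a x by simp
  then show "a \<otimes> x \<in> ?K" using a x m_comm by simp
qed

text \<open>A factor \<open>a [^] p\<close> leaves the splitting as a single \<open>a\<close>, while
  the remaining factors fall under the induction hypothesis for \<open>n - 1\<close>. The bound on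
  \<open>N\<close> guarantees such a factor as soon as \<open>n + 1 > N\<close>.\<close>

lemma split_ideal_pow:
  assumes A: "finite A" "A \<subseteq> carrier R" and I: "I = Idl A"
    and sub: "\<And>n. ideal_pow R I n \<subseteq> S n" and eq: "\<And>n. n \<le> N \<Longrightarrow> ideal_pow R I n = S n"
    and N: "card A * (p - 1) \<le> N * p"
    and S: "\<And>n f. f \<in> S (n * p + 1) \<Longrightarrow> \<psi> f \<in> S (n + 1)"
    and f: "f \<in> ideal_pow R I (n * p + 1)"
  shows "\<psi> f \<in> ideal_pow R I (n + 1)"
  using f
proof (induction n arbitrary: f)
  case 0
  have Ii: "ideal I R" unfolding I using genideal_ideal[OF A(2)] .
  show ?case
  proof (cases "N = 0")
    \<comment> \<open>The bound then leaves no generators, so \<open>I\<close> is the zero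
      ideal.\<close>
    case True
    then have "card A = 0" using N p_gt1 by auto
    then have "I = {\<zero>}" using A(1) I by (simp add: Idl_empty)
    then show ?thesis using 0 ideal_pow_1[OF Ii] by (simp add: split_zero)
  next
    case False
    have "f \<in> S (0 * p + 1)" using 0 sub by blast
    then show ?thesis using S[of f 0] eq[of 1] False by simp
  qed
next
  case (Suc k)
  have Ii: "ideal I R" unfolding I using genideal_ideal[OF A(2)] .
  have AI: "A \<subseteq> I" unfolding I using genideal_self[OF A(2)] .
  show ?case
  proof (cases "Suc k + 1 \<le> N")
    case True
    have "f \<in> S (Suc k * p + 1)" using Suc.prems sub by blast
    then show ?thesis using S[of f "Suc k"] eq[OF True] by simp
  next
    case False
    define K where "K = {z \<in> carrier R. \<forall>r\<in>carrier R. \<psi> (r \<otimes> z) \<in> ideal_pow R I (Suc k + 1)}"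
    have K: "ideal K R" unfolding K_def by (rule split_colon_ideal[OF ideal_pow_ideal[OF Ii]])
    have "N * p \<le> Suc k * p" using False by (intro mult_le_mono1) simp
    then have "card A * (p - 1) < p + (k * p + 1)" using N by simp
    moreover have "a [^] p \<otimes> w \<in> K" if a: "a \<in> A" and w: "w \<in> ideal_pow R (Idl A) (k * p + 1)" for a w
    proof -
      have ac: "a \<in> carrier R" using a A by blast
      have wI: "w \<in> ideal_pow R I (k * p + 1)" using w I by simp
      have wc: "w \<in> carrier R" using ideal_carr[OF ideal_pow_ideal[OF Ii] wI] .
      have "\<psi> (r \<otimes> (a [^] p \<otimes> w)) \<in> ideal_pow R I (Suc k + 1)" if r: "r \<in> carrier R" for r
      proof -
        have rw: "r \<otimes> w \<in> ideal_pow R I (k * p + 1)" using ideal_lmult[OF ideal_pow_ideal[OF Ii] r wI] .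
        have "r \<otimes> (a [^] p \<otimes> w) = a [^] p \<otimes> (r \<otimes> w)" using ac wc r by (simp add: m_ac)
        then have "\<psi> (r \<otimes> (a [^] p \<otimes> w)) = a \<otimes> \<psi> (r \<otimes> w)"
          using ac wc r by (simp only: split_smult m_closed)
        also have "\<dots> = \<psi> (r \<otimes> w) \<otimes> a" using ac wc r split_closed by (intro m_comm) auto
        also have "\<dots> \<in> ideal_pow R I (Suc (k + 1))"
          unfolding ideal_pow_Suc using Suc.IH[OF rw] a AI by (intro ideal_prod.prod) auto
        finally show ?thesis by simp
      qed
      then show ?thesis using ac wc by (simp add: K_def)
    qed
    ultimately have "ideal_pow R (Idl A) (p + (k * p + 1)) \<subseteq> K" by (rule ideal_pow_pigeonhole[OF A K])
    then have "f \<in> K" using Suc.prems I by (simp add: add.assoc subset_iff)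
    then have "\<psi> (\<one> \<otimes> f) \<in> ideal_pow R I (Suc k + 1)" unfolding K_def by blast
    then show ?thesis using \<open>f \<in> K\<close> by (simp add: K_def)
  qed
qed

text \<open>The exponent \<open>j\<close> may be raised to the larger \<open>p ^ j\<close>. Since
  \<open>\<psi>\<close> takes \<open>a [^] (p ^ Suc e)\<close> to \<open>a [^] (p ^ e)\<close>,
  using \<open>split\<close> with \<open>n = k * p ^ e\<close> repeatedly descends to
  \<open>a\<close> itself.\<close>

lemma reduced_associated_graded:
  assumes I: "ideal I R"
    and split: "\<And>n f. f \<in> ideal_pow R I (n * p + 1) \<Longrightarrow> \<psi> f \<in> ideal_pow R I (n + 1)"
    and a: "a \<in> ideal_pow R I k" "a [^] j \<in> ideal_pow R I (k * j + 1)"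
  shows "a \<in> ideal_pow R I (k + 1)"
proof -
  have ac: "a \<in> carrier R" using ideal_carr[OF ideal_pow_ideal[OF I] a(1)] .
  have "j < p ^ j" using p_gt1 by (intro power_gt_expt) simp
  then obtain q where q: "p ^ j = j + q" using less_imp_add_positive by metis
  have "a [^] j \<otimes> a [^] q \<in> ideal_pow R I ((k * j + 1) + k * q)"
    using ideal_pow_mult[OF I a(2) nat_pow_mem_ideal_pow[OF I a(1)]] .
  moreover have "a [^] j \<otimes> a [^] q = a [^] (p ^ j)" unfolding q using ac by (rule nat_pow_mult)
  moreover have "(k * j + 1) + k * q = k * p ^ j + 1" unfolding q by (simp add: distrib_left)
  ultimately have "a [^] (p ^ j) \<in> ideal_pow R I (k * p ^ j + 1)" by simp
  then show ?thesis
  proof (induction j)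
    case 0
    then show ?case using ac by (simp add: nat_pow_Suc nat_pow_0)
  next
    case (Suc e)
    have "(a [^] (p ^ e)) [^] p \<in> ideal_pow R I ((k * p ^ e) * p + 1)"
      using Suc.prems ac by (simp add: nat_pow_pow mult_ac)
    from split[OF this] have "a [^] (p ^ e) \<in> ideal_pow R I (k * p ^ e + 1)"
      using ac by (simp add: split_power)
    then show ?case by (rule Suc.IH)
  qed
qed

end

text \<open>Turns a finite \<open>krull_dim\<close>, defined as a supremum, into an actual chain of
  primes. The element \<open>0\<close> excludes the empty set, whose supremum is also
  \<open>0\<close>.\<close>

lemma enat_Sup_attained:
  assumes "Sup C = enat d" "enat 0 \<in> C" shows "enat d \<in> C"
proof (rule ccontr)
  assume n: "enat d \<notin> C"
  then obtain e where d: "d = Suc e" using assms(2) by (cases d) auto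
  have "x \<le> enat e" if "x \<in> C" for x
  proof -
    have "x \<le> enat d" using Sup_upper[OF that] assms(1) by simp
    moreover have "x \<noteq> enat d" using that n by blast
    ultimately show ?thesis unfolding d by (cases x) auto
  qed
  then have "Sup C \<le> enat e" by (rule Sup_least)
  then show False using assms(1) d by simp
qed

text \<open>The inequality \<open>card V \<le> d\<close> is inherited by the generating sets that
  \<open>adapted_generators\<close> substitutes for \<open>V\<close>.\<close>

lemma regular_local_ring_generators:
  fixes R :: "('a, 'b) ring_scheme" (structure)
  assumes "regular_local_ring R \<mm>"
  shows "noetherian_local R \<mm>"
    and "\<exists>V d P. finite V \<and> V \<subseteq> \<mm> \<and> card V \<le> d \<and> \<mm> = Idl V \<and> prime_chain R {} d P"
proof -
  have "cring R" "noetherian_ring R" "maximalideal \<mm> R" "\<And>M. maximalideal M R \<Longrightarrow> M = \<mm>"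
    using assms by (auto simp: regular_local_ring_def local_ring_def)
  then show nl: "noetherian_local R \<mm>"
    by (intro noetherian_local.intro noetherian_cring.intro noetherian_local_axioms.intro)
  then interpret noetherian_local R \<mm> .
  obtain A where A: "A \<subseteq> carrier R" "\<mm> = Idl A" using finetely_gen[OF max_ideal] by blast
  obtain V where V: "V \<subseteq> carrier R" "finite V" "card V = min_num_gens R (carrier R) \<mm>" "\<mm> = Idl V"
    using min_num_gens_witness[OF A(1) order_refl A(2)] .
  define C where "C = {enat n |n. \<exists>P :: nat \<Rightarrow> 'a set.
     (\<forall>i\<le>n. primeideal (P i) R) \<and> (\<forall>i<n. P i \<subset> P (Suc i))}"
  have "enat 0 \<in> C" unfolding C_def using max_prime by (auto intro!: exI[of _ "\<lambda>_. \<mm>"])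
  have "enat (card V) = krull_dim R" unfolding V(3) using assms unfolding regular_local_ring_def by blast
  moreover have "krull_dim R = Sup C" unfolding krull_dim_def C_def ..
  ultimately have "Sup C = enat (card V)" by simp
  then have "enat (card V) \<in> C" using \<open>enat 0 \<in> C\<close> by (rule enat_Sup_attained)
  then have "\<exists>P. prime_chain R {} (card V) P" unfolding C_def prime_chain_def by simp
  moreover have "V \<subseteq> \<mm>" using genideal_self[OF V(1)] V(4) by simp
  ultimately show "\<exists>V d P. finite V \<and> V \<subseteq> \<mm> \<and> card V \<le> d \<and> \<mm> = Idl V \<and> prime_chain R {} d P"
    using V(2,4) by (intro exI[of _ V] exI[of _ "card V"]) simp
qed

section \<open>The associated graded ring\<close>

context noetherian_cring
begin

text \<open>\<open>Q\<close> is maximal among the annihilators, in the associated graded ring of \<open>I\<close>, of nonzero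
  homogeneous elements killed by \<open>s\<close>. As that ring is reduced, the powers of \<open>g\<close> have the same
  annihilator.\<close>

lemma associated_prime_of_torsion:
  assumes I: "ideal I R"
    and red: "\<And>a k j. a \<in> ideal_pow R I k \<Longrightarrow> a [^] (j::nat) \<in> ideal_pow R I (k * j + 1) \<Longrightarrow>
      a \<in> ideal_pow R I (k + 1)"
    and f: "f \<in> ideal_pow R I n" "f \<notin> ideal_pow R I (n + 1)"
    and s: "s \<in> carrier R" "s \<otimes> f \<in> ideal_pow R I (n + 1)"
  obtains Q g k where "primeideal Q R" "I \<subseteq> Q" "s \<in> Q"
    "g \<in> ideal_pow R I k" "\<forall>a\<in>Q. a \<otimes> g \<in> ideal_pow R I (k + 1)"
    "\<forall>j>0. \<forall>u\<in>carrier R. u \<otimes> g [^] (j::nat) \<in> ideal_pow R I (k * j + 1) \<longrightarrow> u \<in> Q"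
proof -
  have Ip: "ideal (ideal_pow R I n) R" for n using ideal_pow_ideal[OF I] .
  define ann where "ann k g = {a \<in> carrier R. a \<otimes> g \<in> ideal_pow R I (k + 1)}" for k g
  define C where "C = {ann k g |k g. g \<in> ideal_pow R I k \<and> g \<notin> ideal_pow R I (k + 1) \<and> s \<in> ann k g}"
  have CI: "ann k g \<in> C" if "g \<in> ideal_pow R I k" "g \<notin> ideal_pow R I (k + 1)" "s \<in> ann k g" for k g
    unfolding C_def using that by blast
  have "s \<in> ann n f" using s by (simp add: ann_def)
  then have "C \<noteq> {}" using CI[OF f] by blast
  moreover have "ideal K R" if K: "K \<in> C" for K
  proof -
    obtain k g where "K = ann k g" "g \<in> ideal_pow R I k" using K unfolding C_def by blast
    then show ?thesis unfolding ann_def using colon_ideal[OF Ip ideal_carr[OF Ip]] by simp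
  qed
  ultimately obtain Q where QC: "Q \<in> C" and maxC: "\<And>K. K \<in> C \<Longrightarrow> Q \<subseteq> K \<Longrightarrow> K = Q"
    by (rule ideal_family_maximal) (assumption | rule that)+
  then obtain k g where Q: "Q = ann k g" and g: "g \<in> ideal_pow R I k" "g \<notin> ideal_pow R I (k + 1)"
    and sQ: "s \<in> Q" unfolding C_def by blast
  have gc: "g \<in> carrier R" using ideal_carr[OF Ip g(1)] .
  have Qi: "ideal Q R" unfolding Q ann_def using colon_ideal[OF Ip gc] .
  have killed: "a \<otimes> g \<in> ideal_pow R I (k + 1)" if "a \<in> Q" for a using that by (simp add: Q ann_def)
  \<comment> \<open>By maximality, a nonzero homogeneous element killed by \<open>Q\<close> has
    annihilator exactly \<open>Q\<close>.\<close>
  have eqQ: "ann m h = Q" if "h \<in> ideal_pow R I m" "h \<notin> ideal_pow R I (m + 1)" "Q \<subseteq> ann m h" for m h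
    using maxC[OF CI[OF that(1,2)] that(3)] that(3) sQ by blast
  have prime: "primeideal Q R"
  proof (rule primeidealI[OF Qi is_cring])
    have "\<one> \<notin> Q" using g(2) gc by (auto simp: Q ann_def)
    then show "carrier R \<noteq> Q" by auto
  next
    fix a b assume ab: "a \<in> carrier R" "b \<in> carrier R" "a \<otimes> b \<in> Q"
    show "a \<in> Q \<or> b \<in> Q"
    proof (cases "a \<in> Q")
      case False
      have "a \<otimes> g \<notin> ideal_pow R I (k + 1)" using False ab(1) by (simp add: Q ann_def)
      moreover have "Q \<subseteq> ann k (a \<otimes> g)"
      proof
        fix x assume x: "x \<in> Q"
        have xc: "x \<in> carrier R" using ideal_carr[OF Qi x] .
        have "x \<otimes> (a \<otimes> g) = a \<otimes> (x \<otimes> g)" using xc ab(1) gc by (simp add: m_ac)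
        then show "x \<in> ann k (a \<otimes> g)" using ideal_lmult[OF Ip ab(1) killed[OF x]] xc by (simp add: ann_def)
      qed
      ultimately have "ann k (a \<otimes> g) = Q" using eqQ[OF ideal_lmult[OF Ip ab(1) g(1)]] by blast
      moreover have "b \<otimes> (a \<otimes> g) = (a \<otimes> b) \<otimes> g" using ab gc by (simp add: m_ac)
      then have "b \<in> ann k (a \<otimes> g)" using killed[OF ab(3)] ab(2) by (simp add: ann_def)
      ultimately show ?thesis by blast
    qed simp
  qed
  have "a \<in> Q" if a: "a \<in> I" for a
    using ideal_prod.prod[OF g(1) a, of R] m_comm[OF gc ideal_carr[OF I a]] ideal_carr[OF I a]
    by (simp add: Q ann_def ideal_pow_Suc)
  then have IQ: "I \<subseteq> Q" by blast
  have "u \<in> Q" if j: "0 < j" and u: "u \<in> carrier R" "u \<otimes> g [^] j \<in> ideal_pow R I (k * j + 1)" for j :: nat and u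
  proof -
    obtain i where i: "j = Suc i" using j gr0_implies_Suc by blast
    have "Q \<subseteq> ann (k * j) (g [^] j)"
    proof
      fix x assume x: "x \<in> Q"
      have xc: "x \<in> carrier R" using ideal_carr[OF Qi x] .
      have "x \<otimes> g [^] j = (x \<otimes> g) \<otimes> g [^] i" unfolding i nat_pow_Suc using xc gc by (simp add: m_ac)
      also have "\<dots> \<in> ideal_pow R I ((k + 1) + k * i)"
        using ideal_pow_mult[OF I killed[OF x] nat_pow_mem_ideal_pow[OF I g(1)]] .
      also have "(k + 1) + k * i = k * j + 1" by (simp add: i)
      finally show "x \<in> ann (k * j) (g [^] j)" using xc by (simp add: ann_def)
    qed
    moreover have "g [^] j \<notin> ideal_pow R I (k * j + 1)" using red[OF g(1)] g(2) by blast
    ultimately have "ann (k * j) (g [^] j) = Q" using eqQ[OF nat_pow_mem_ideal_pow[OF I g(1)]] by blast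
    then show ?thesis using u by (auto simp: ann_def)
  qed
  then show ?thesis using that[OF prime IQ sQ g(1)] killed by blast
qed

theorem no_torsion_in_associated_graded:
  assumes reg: "regular_ring R" and I: "ideal I R"
    and red: "\<And>a k j. a \<in> ideal_pow R I k \<Longrightarrow> a [^] (j::nat) \<in> ideal_pow R I (k * j + 1) \<Longrightarrow>
      a \<in> ideal_pow R I (k + 1)"
    and f: "f \<in> ideal_pow R I n"
    and s: "s \<in> carrier R - \<Union>(minimal_primes R I)" "s \<otimes> f \<in> ideal_pow R I (n + 1)"
  shows "f \<in> ideal_pow R I (n + 1)"
proof (rule ccontr)
  assume f1: "f \<notin> ideal_pow R I (n + 1)"
  have sc: "s \<in> carrier R" using s(1) by blast
  have Ip: "ideal (ideal_pow R I n) R" for n using ideal_pow_ideal[OF I] .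
  obtain Q g k where Q: "primeideal Q R" "I \<subseteq> Q" "s \<in> Q"
    and g: "g \<in> ideal_pow R I k" and kill: "\<forall>a\<in>Q. a \<otimes> g \<in> ideal_pow R I (k + 1)"
    and ann: "\<forall>j>0. \<forall>u\<in>carrier R. u \<otimes> g [^] (j::nat) \<in> ideal_pow R I (k * j + 1) \<longrightarrow> u \<in> Q"
    by (rule associated_prime_of_torsion[OF I red f f1 sc s(2)])
  note Qi = prime_ideal[OF Q(1)]
  have gc: "g \<in> carrier R" using ideal_carr[OF Ip g] .
  interpret multiplicative_subset R "carrier R - Q" by (rule multiplicative_subset_compl_prime[OF Q(1)])
  let ?M = "loc_ext R (carrier R - Q) Q" and ?J = "loc_ext R (carrier R - Q) I"
  obtain \<mm> where \<mm>: "regular_local_ring L \<mm>" using reg Q(1) unfolding regular_ring_def by blast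
  have "?M = \<mm>" using \<mm> loc_ext_prime_maximal[OF Q(1)] unfolding regular_local_ring_def local_ring_def by blast
  with \<mm> have M: "regular_local_ring L ?M" by simp
  interpret M: noetherian_local L ?M by (rule regular_local_ring_generators(1)[OF M])
  obtain V d P where V: "finite V" "V \<subseteq> ?M" "card V \<le> d" "?M = Idl\<^bsub>L\<^esub> V" and P: "prime_chain L {} d P"
    using regular_local_ring_generators(2)[OF M] by blast
  have J: "ideal ?J L" using loc_ext_ideal[OF I] .
  have JM: "?J \<subseteq> ?M" using Q(2) by (auto simp: loc_ext_def)
  have JneM: "?J \<noteq> ?M"
  proof
    assume eq: "?J = ?M"
    \<comment> \<open>If \<open>I\<close> and \<open>Q\<close> agree locally at \<open>Q\<close>,
      then \<open>Q\<close> is minimal over \<open>I\<close>; but \<open>s \<in> Q\<close> avoids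
      all minimal primes.\<close>
    have "Q \<subseteq> P" if P: "primeideal P R" "I \<subseteq> P" "P \<subseteq> Q" for P
    proof
      fix y assume y: "y \<in> Q"
      have yc: "y \<in> carrier R" using ideal_carr[OF Qi y] .
      have "frac y \<one> \<in> ?J" unfolding eq using loc_extI[OF y S_one] .
      then obtain u where u: "u \<in> carrier R - Q" "u \<otimes> y \<in> I" using frac_mem_loc_ext_iff[OF I yc S_one] by blast
      then show "y \<in> P" using primeideal.I_prime[OF P(1) _ yc, of u] P(2,3) by blast
    qed
    then have "Q \<in> minimal_primes R I" unfolding minimal_primes_def using Q by blast
    then show False using s(1) Q(3) by blast
  qed
  let ?g = "frac g \<one>"
  have gJ: "?g \<in> ideal_pow L ?J k" unfolding loc_ext_pow[OF I] using loc_extI[OF g S_one] .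
  have "x \<otimes>\<^bsub>L\<^esub> ?g \<in> ideal_pow L ?J (Suc k)" if x: "x \<in> ?M" for x
  proof -
    obtain a t where a: "a \<in> Q" "t \<in> carrier R - Q" "x = frac a t" using x by (rule loc_extE)
    have "x \<otimes>\<^bsub>L\<^esub> ?g = frac (a \<otimes> g) (t \<otimes> \<one>)"
      unfolding a(3) by (rule frac_mult[OF ideal_carr[OF Qi a(1)] a(2) gc S_one])
    also have "\<dots> \<in> ideal_pow L ?J (k + 1)"
      unfolding loc_ext_pow[OF I] using loc_extI[OF bspec[OF kill a(1)] S_mult[OF a(2) S_one]] .
    finally show ?thesis by simp
  qed
  from M.nilpotent_if_killed_by_max[OF V P J JM JneM gJ this]
  have "frac (g [^] (k + 2)) \<one> \<in> loc_ext R (carrier R - Q) (ideal_pow R I (k * (k + 2) + 1))"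
    unfolding loc_ext_pow[OF I] frac_pow[OF gc] .
  moreover have "g [^] (k + 2) \<in> carrier R" using gc by simp
  ultimately have "\<exists>u\<in>carrier R - Q. u \<otimes> g [^] (k + 2) \<in> ideal_pow R I (k * (k + 2) + 1)"
    by (simp only: frac_mem_loc_ext_iff[OF Ip _ S_one])
  then obtain u where u: "u \<in> carrier R - Q" "u \<otimes> g [^] (k + 2) \<in> ideal_pow R I (k * (k + 2) + 1)"
    by (rule bexE)
  \<comment> \<open>Clearing denominators left \<open>u\<close> annihilating
    \<open>g [^] (k + 2)\<close> in the associated graded ring over \<open>R\<close>, where that
    annihilator is \<open>Q\<close>.\<close>
  have "u \<in> Q" by (rule ann[rule_format, OF _ _ u(2)]) (use u(1) in simp_all)
  then show False using u(1) by blast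
qed

end

lemma (in cring) frobenius_splitting_of_pth_root_splitting:
  assumes "1 < p" and lin: "R_linear_to_ring R (pth_root_ring R p) \<phi>"
    and split: "\<And>r. r \<in> carrier R \<Longrightarrow> \<phi> (pth_root_incl R p r) = r"
  shows "frobenius_splitting R p (\<lambda>f. \<phi> (PRoot f))"
  using assms
  by (unfold_locales)
    (auto simp: R_linear_to_ring_def pth_root_ring_def pth_root_incl_def Pi_def)

theorem theorem5p7:
  fixes R :: "('a, 'b) ring_scheme" and \<mm> I K :: "'a set" and d p \<mu> :: nat and x :: "nat \<Rightarrow> 'a"
  assumes "Factorial_Ring.prime p" and "has_characteristic R p"
    and "regular_ring R" and "F_finite R p"
    and "ideal I R"
    and "(local_ring R \<mm> \<and> \<mu> = min_num_gens R (carrier R) I) \<or>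
         (std_graded_polynomial_ring R K d x \<and> \<mm> = homogeneous_maximal_ideal R d x \<and>
          homogeneous_ideal R K d x I \<and> \<mu> = min_num_gens R (homogeneous_elements R K d x) I)"
    and "symbolic_F_split R p I"
    and "\<And>n::nat. int n \<le> \<lceil>real \<mu> * (real p - 1) / real p\<rceil> \<Longrightarrow>
           ideal_pow R I n = symbolic_power R I n"
  shows "\<forall>n::nat. ideal_pow R I n = symbolic_power R I n"
proof -
  have p: "1 < p" using assms(1) by (rule prime_gt_1_nat)
  interpret noetherian_cring R
    using assms(3) by (intro noetherian_cring.intro) (auto simp: regular_ring_def)
  note I = \<open>ideal I R\<close>
  have Ip: "ideal (ideal_pow R I n) R" for n using ideal_pow_ideal[OF I] .
  obtain A where A: "finite A" "A \<subseteq> carrier R" "I = Idl\<^bsub>R\<^esub> A" "card A = \<mu>"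
    using assms(6)
  proof (elim disjE conjE)
    assume \<mu>: "\<mu> = min_num_gens R (carrier R) I"
    obtain B where B: "B \<subseteq> carrier R" "I = Idl\<^bsub>R\<^esub> B" using finetely_gen[OF I] by blast
    show thesis
      using min_num_gens_witness[OF B(1) order_refl B(2)] that \<mu> by metis
  next
    assume \<mu>: "\<mu> = min_num_gens R (homogeneous_elements R K d x) I"
      and gr: "std_graded_polynomial_ring R K d x" and hom: "homogeneous_ideal R K d x I"
    have H: "homogeneous_elements R K d x \<subseteq> carrier R"
      using gr unfolding homogeneous_elements_def graded_piece_def std_graded_polynomial_ring_def
        bij_betw_def by blast
    obtain B where B: "B \<subseteq> homogeneous_elements R K d x" "I = Idl\<^bsub>R\<^esub> B"
      using hom unfolding homogeneous_ideal_def by blast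
    show thesis
      using min_num_gens_witness[OF B(1) H B(2)] that \<mu> H by (metis subset_trans)
  qed
  obtain \<phi> where \<phi>: "R_linear_to_ring R (pth_root_ring R p) \<phi>"
    "\<And>r. r \<in> carrier R \<Longrightarrow> \<phi> (pth_root_incl R p r) = r"
    and \<phi>S: "\<And>n. \<phi> ` (PRoot ` symbolic_power R I (n * p + 1)) \<subseteq> symbolic_power R I (n + 1)"
    using assms(7) unfolding symbolic_F_split_def by blast
  interpret frobenius_splitting R p "\<lambda>f. \<phi> (PRoot f)"
    by (rule frobenius_splitting_of_pth_root_splitting[OF p \<phi>])
  interpret S: multiplicative_subset R "carrier R - \<Union>(minimal_primes R I)"
    by (rule multiplicative_subset_compl_primes) (simp add: minimal_primes_def)
  have sub: "ideal_pow R I n \<subseteq> symbolic_power R I n" for n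
    unfolding symbolic_power_def by (rule S.subset_loc_contraction[OF Ip])
  define N where "N = nat \<lceil>real \<mu> * (real p - 1) / real p\<rceil>"
  have eq: "ideal_pow R I n = symbolic_power R I n" if "n \<le> N" for n
  proof (rule assms(8))
    have "0 \<le> real \<mu> * (real p - 1) / real p" using p by simp
    then show "int n \<le> \<lceil>real \<mu> * (real p - 1) / real p\<rceil>" using that unfolding N_def by linarith
  qed
  \<comment> \<open>Rounding up yields the integer inequality behind the pigeonhole count.\<close>
  have "real \<mu> * (real p - 1) / real p \<le> real N" unfolding N_def by linarith
  then have "real \<mu> * (real p - 1) \<le> real N * real p" using p by (simp add: divide_le_eq)
  then have "real (\<mu> * (p - 1)) \<le> real (N * p)" using p by (simp add: of_nat_diff)
  then have N: "card A * (p - 1) \<le> N * p" unfolding A(4) by (simp only: of_nat_le_iff)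
  have split: "\<phi> (PRoot f) \<in> ideal_pow R I (n + 1)" if "f \<in> ideal_pow R I (n * p + 1)" for n f
    using split_ideal_pow[OF A(1-3) sub eq N _ that] \<phi>S by blast
  note red = reduced_associated_graded[OF I split]
  have "f \<in> ideal_pow R I n" if f: "f \<in> symbolic_power R I n" for f n
  proof -
    obtain u where fc: "f \<in> carrier R"
      and u: "u \<in> carrier R - \<Union>(minimal_primes R I)" "u \<otimes>\<^bsub>R\<^esub> f \<in> ideal_pow R I n"
      using S.mem_loc_contractionD[OF Ip] f unfolding symbolic_power_def by blast
    \<comment> \<open>As long as \<open>k < n\<close>, the multiple \<open>u \<otimes> f\<close>
      lies in the power \<open>k + 1\<close>, so the class of \<open>f\<close> in degree
      \<open>k\<close> is torsion and \<open>f\<close> climbs one power.\<close>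
    have "f \<in> ideal_pow R I k" if "k \<le> n" for k
      using that
    proof (induction k)
      case 0
      then show ?case using fc by (simp add: ideal_pow_0)
    next
      case (Suc k)
      have uf: "u \<otimes>\<^bsub>R\<^esub> f \<in> ideal_pow R I (k + 1)"
        using u(2) ideal_pow_antimono[OF I, of "k + 1" n] Suc.prems by auto
      have "f \<in> ideal_pow R I k" using Suc by simp
      from no_torsion_in_associated_graded[OF assms(3) I red this u(1) uf] show ?case by simp
    qed
    then show ?thesis by simp
  qed
  then show ?thesis using sub by blast
qed

end
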